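(* For each $d\ge 2$ let $Z^d=(X^d_t,V^d_t)_{t\ge0}$ be the Forward Event-Chain Monte Carlo (FECMC) process in dimension $d$ with standard Gaussian target $\pi^d=N_d(0,I_d)$, velocity distribution $\mu^d=\mathrm{Unif}(S^{d-1})$, and global refreshment rate $\rho=0$, assumed to have invariant distribution $\pi^d\otimes\mu^d$ and to be started from $Z^d_0\sim\pi^d\otimes\mu^d$. Let $$R^d_t:=(X^d_t|V^d_t)=\sum_{i=1}^d X^{d,i}_tV^{d,i}_t,\qquad t\ge0.$$ Then, as $d\to\infty$, the process $R^d$ converges weakly, as random elements of the Skorokhod space $D([0,\infty),\mathbb{R})$, to a piecewise deterministic Markov process $R^F$ whose (extended) generator $L^F$ is given by $$L^Ff(x)=f'(x)+x_+\bigl(\mathbb{E}[f(-\tau)]-f(x)\bigr),$$ where $x_+=\max(x,0)$ and the expectation is over a standard Rayleigh random variable $\tau$, i.e. one with density $xe^{-x^2/2}$ on $x>0$.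
   Context: Notation: $(\cdot|\cdot)$ is the Euclidean inner product and $|\cdot|$ the Euclidean norm on $\mathbb{R}^d$; $x_+=\max(x,0)$; $S^{d-1}$ is the unit sphere in $\mathbb{R}^d$. FECMC process (standard Gaussian target, $\rho=0$). The potential is $U^d(x)=|x|^2/2$, so $\nabla U^d(x)=x$, and $n(x):=x/|x|$ for $x\neq0$. $Z^d=(X^d,V^d)$ is the piecewise deterministic Markov process on $\mathbb{R}^d\times S^{d-1}$ such that between jumps $\frac{d}{dt}X^d_t=V^d_t$ and $V^d$ is constant; velocity jumps occur with rate $\lambda(x,v)=(v|\nabla U^d(x))_+=(v|x)_+$; at a jump occurring at $(x,v)$ the position is unchanged and $v$ is replaced by $$v_{\mathrm{new}}=-w\,n(x)+\sqrt{1-w^2}\,\frac{Av^\perp}{|v^\perp|},\qquad v^\perp:=v-(v|n(x))n(x),$$ where $w$ is drawn, independently of everything else, from the density $$q^{\parallel,d}(w)=(d-1)\,w\,(1-w^2)^{\frac{d-3}{2}}1_{(0,1)}(w),$$ and $A$ is drawn from a probability distribution $\nu^x$ on orthogonal matrices acting on the hyperplane $n(x)^\perp=\{u:(u|n(x))=0\}$. The choice of $\nu^x$ is left unspecified, subject only to $\pi^d\otimes\mu^d$ being invariant. *)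

theory Defs
  imports "HOL-Probability.Probability"
begin

section \<open>The Skorokhod space of real paths and weak convergence\<close>

definition cadlag_paths :: "(real \<Rightarrow> real) set" where
  "cadlag_paths = {x \<in> extensional {0..}.
     (\<forall>t\<ge>0. continuous (at_right t) x) \<and> (\<forall>t>0. \<exists>l. (x \<longlongrightarrow> l) (at_left t))}"

text \<open>Time changes: a strictly increasing map of the half-line onto itself is automatically
  continuous and fixes 0.\<close>

definition time_change :: "(real \<Rightarrow> real) \<Rightarrow> bool" where
  "time_change l \<longleftrightarrow> strict_mono_on {0..} l \<and> l ` {0..} = {0..}"

definition skorokhod_tendsto :: "(nat \<Rightarrow> real \<Rightarrow> real) \<Rightarrow> (real \<Rightarrow> real) \<Rightarrow> bool" where
  "skorokhod_tendsto xs x \<longleftrightarrow> (\<exists>l. (\<forall>n. time_change (l n)) \<and>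
     uniform_limit {0..} l (\<lambda>t. t) sequentially \<and>
     (\<forall>m. uniform_limit {0..m} (\<lambda>n t. xs n (l n t)) x sequentially))"

text \<open>The Skorokhod (J1) topology on the space of cadlag functions on the half-line is the
  metrizable topology whose convergent sequences are given by \<^const>\<open>skorokhod_tendsto\<close>
  (Jacod and Shiryaev, Theorem VI.1.14; Billingsley, Theorem 16.1).  As it is metrizable, its open
  sets are exactly the sequentially open ones.\<close>

definition skorokhod :: "(real \<Rightarrow> real) topology" where
  "skorokhod = topology (\<lambda>U. U \<subseteq> cadlag_paths \<and>
     (\<forall>x\<in>U. \<forall>xs. range xs \<subseteq> cadlag_paths \<and> skorokhod_tendsto xs x \<longrightarrow>
        (\<forall>\<^sub>F n in sequentially. xs n \<in> U)))"

lemma openin_skorokhod: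
  "openin skorokhod U \<longleftrightarrow> U \<subseteq> cadlag_paths \<and>
     (\<forall>x\<in>U. \<forall>xs. range xs \<subseteq> cadlag_paths \<and> skorokhod_tendsto xs x \<longrightarrow>
        (\<forall>\<^sub>F n in sequentially. xs n \<in> U))"
proof -
  have "istopology (\<lambda>U. U \<subseteq> cadlag_paths \<and>
     (\<forall>x\<in>U. \<forall>xs. range xs \<subseteq> cadlag_paths \<and> skorokhod_tendsto xs x \<longrightarrow>
        (\<forall>\<^sub>F n in sequentially. xs n \<in> U)))" (is "istopology ?P")
    unfolding istopology_def
  proof (intro conjI allI impI)
    fix S T assume S: "?P S" and T: "?P T"
    show "S \<inter> T \<subseteq> cadlag_paths"
      using S by blast
    show "\<forall>x\<in>S \<inter> T. \<forall>xs. range xs \<subseteq> cadlag_paths \<and> skorokhod_tendsto xs x \<longrightarrow>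
        (\<forall>\<^sub>F n in sequentially. xs n \<in> S \<inter> T)"
    proof (intro ballI allI impI)
      fix x xs assume x: "x \<in> S \<inter> T" and xs: "range xs \<subseteq> cadlag_paths \<and> skorokhod_tendsto xs x"
      have "\<forall>\<^sub>F n in sequentially. xs n \<in> S" "\<forall>\<^sub>F n in sequentially. xs n \<in> T"
        using S T x xs by blast+
      then show "\<forall>\<^sub>F n in sequentially. xs n \<in> S \<inter> T"
        by eventually_elim simp
    qed
  next
    fix K assume K: "\<forall>S\<in>K. ?P S"
    then show "\<Union>K \<subseteq> cadlag_paths"
      by blast
    show "\<forall>x\<in>\<Union>K. \<forall>xs. range xs \<subseteq> cadlag_paths \<and> skorokhod_tendsto xs x \<longrightarrow>
        (\<forall>\<^sub>F n in sequentially. xs n \<in> \<Union>K)"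
    proof (intro ballI allI impI)
      fix x xs assume x: "x \<in> \<Union>K" and xs: "range xs \<subseteq> cadlag_paths \<and> skorokhod_tendsto xs x"
      then obtain S where S: "S \<in> K" "x \<in> S"
        by blast
      then have "\<forall>\<^sub>F n in sequentially. xs n \<in> S"
        using K xs by blast
      then show "\<forall>\<^sub>F n in sequentially. xs n \<in> \<Union>K"
        by eventually_elim (use S in blast)
    qed
  qed
  then show ?thesis
    by (simp add: skorokhod_def)
qed

lemma topspace_skorokhod [simp]: "topspace skorokhod = cadlag_paths"
proof
  show "topspace skorokhod \<subseteq> cadlag_paths"
    using openin_skorokhod[of "topspace skorokhod"] by simp
  have "openin skorokhod cadlag_paths"
    unfolding openin_skorokhod by (auto intro!: always_eventually)
  then show "cadlag_paths \<subseteq> topspace skorokhod"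
    by (rule openin_subset)
qed

definition borel_algebra :: "'a topology \<Rightarrow> 'a measure" where
  "borel_algebra T = sigma (topspace T) {U. openin T U}"

definition path_of :: "(real \<Rightarrow> 'w \<Rightarrow> real) \<Rightarrow> 'w \<Rightarrow> real \<Rightarrow> real" where
  "path_of R \<omega> = (\<lambda>t\<in>{0..}. R t \<omega>)"

text \<open>Measurability is part of the definition, since the Bochner integral of a non-measurable
  function is 0 by convention.\<close>

definition weakly_converges ::
  "'b topology \<Rightarrow> (nat \<Rightarrow> 'w measure) \<Rightarrow> (nat \<Rightarrow> 'w \<Rightarrow> 'b) \<Rightarrow> 'v measure \<Rightarrow> ('v \<Rightarrow> 'b) \<Rightarrow> bool" where
  "weakly_converges T M \<xi> N \<zeta> \<longleftrightarrow>
     (\<forall>\<^sub>F n in sequentially. \<xi> n \<in> M n \<rightarrow>\<^sub>M borel_algebra T) \<and>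
     \<zeta> \<in> N \<rightarrow>\<^sub>M borel_algebra T \<and>
     (\<forall>g. continuous_map T euclideanreal g \<and> bounded (g ` topspace T) \<longrightarrow>
        (\<lambda>n. \<integral>\<omega>. g (\<xi> n \<omega>) \<partial>M n) \<longlonglongrightarrow> (\<integral>\<omega>. g (\<zeta> \<omega>) \<partial>N))"

section \<open>Piecewise deterministic Markov processes\<close>

definition jump_history ::
  "'w measure \<Rightarrow> 's measure \<Rightarrow> (nat \<Rightarrow> 'w \<Rightarrow> real) \<Rightarrow> (nat \<Rightarrow> 'w \<Rightarrow> 's) \<Rightarrow> nat \<Rightarrow> 'w measure" where
  "jump_history M S T Y n = vimage_algebra (space M) (\<lambda>\<omega>. \<lambda>i\<in>{..n}. (T i \<omega>, Y i \<omega>))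
     (PiM {..n} (\<lambda>_. borel \<Otimes>\<^sub>M S))"

text \<open>\<open>Z\<close> is a PDMP with state space \<open>S\<close>, flow \<open>\<phi>\<close>, jump rate \<open>r\<close> and jump kernel \<open>Q\<close>:
  \<open>T n\<close> is the \<open>n\<close>-th jump time and \<open>Y n\<close> the state right after it (\<open>Y 0\<close> the initial state).
  The last clause is the conditional law, given the first \<open>n\<close> jumps, of the next waiting time
  and the next post-jump state: survival function \<open>exp (- \<integral>\<^sub>0\<^sup>s r (\<phi> u y) du)\<close>, then a draw
  from \<open>Q\<close> at the pre-jump state.  Jump times are finite and do not accumulate;
  finiteness is no restriction for the processes below, whose total hazard along the flow is
  infinite.\<close>

definition pdmp ::
  "'w measure \<Rightarrow> 's measure \<Rightarrow> (real \<Rightarrow> 's \<Rightarrow> 's) \<Rightarrow> ('s \<Rightarrow> real) \<Rightarrow> ('s \<Rightarrow> 's measure) \<Rightarrow>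
     (real \<Rightarrow> 'w \<Rightarrow> 's) \<Rightarrow> bool" where
  "pdmp M S \<phi> r Q Z \<longleftrightarrow> prob_space M \<and> (\<exists>T Y.
     (\<forall>n. T n \<in> borel_measurable M) \<and>
     (\<forall>n. Y n \<in> M \<rightarrow>\<^sub>M S) \<and>
     (\<forall>\<omega>\<in>space M. T 0 \<omega> = 0 \<and> strict_mono (\<lambda>n. T n \<omega>) \<and>
        filterlim (\<lambda>n. T n \<omega>) at_top sequentially \<and>
        (\<forall>n. \<forall>t\<in>{T n \<omega>..<T (Suc n) \<omega>}. Z t \<omega> = \<phi> (t - T n \<omega>) (Y n \<omega>))) \<and>
     (\<forall>n. \<forall>A\<in>sets (jump_history M S T Y n). \<forall>t\<ge>0. \<forall>C\<in>sets S.
        emeasure M {\<omega>\<in>A. T (Suc n) \<omega> - T n \<omega> \<le> t \<and> Y (Suc n) \<omega> \<in> C} =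
        (\<integral>\<^sup>+\<omega>\<in>A. (\<integral>\<^sup>+s\<in>{0..t}.
            ennreal (r (\<phi> s (Y n \<omega>)) * exp (- (LINT u:{0..s}|lborel. r (\<phi> u (Y n \<omega>))))) *
            emeasure (Q (\<phi> s (Y n \<omega>))) C \<partial>lborel) \<partial>M)))"

section \<open>Extended generators\<close>

definition natural_filtration :: "'w measure \<Rightarrow> (real \<Rightarrow> 'w \<Rightarrow> real) \<Rightarrow> real \<Rightarrow> 'w measure" where
  "natural_filtration M R t =
     sigma (space M) {R s -` B \<inter> space M | s B. 0 \<le> s \<and> s \<le> t \<and> B \<in> sets borel}"

definition is_martingale ::
  "'w measure \<Rightarrow> (real \<Rightarrow> 'w measure) \<Rightarrow> (real \<Rightarrow> 'w \<Rightarrow> real) \<Rightarrow> bool" where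
  "is_martingale M F C \<longleftrightarrow>
     (\<forall>t\<ge>0. C t \<in> borel_measurable (F t) \<and> integrable M (C t)) \<and>
     (\<forall>s t. 0 \<le> s \<and> s \<le> t \<longrightarrow> (AE \<omega> in M. real_cond_exp M (F s) (C t) \<omega> = C s \<omega>))"

definition is_local_martingale ::
  "'w measure \<Rightarrow> (real \<Rightarrow> 'w measure) \<Rightarrow> (real \<Rightarrow> 'w \<Rightarrow> real) \<Rightarrow> bool" where
  "is_local_martingale M F C \<longleftrightarrow>
     (\<forall>t\<ge>0. C t \<in> borel_measurable (F t)) \<and>
     (\<exists>\<sigma> :: nat \<Rightarrow> 'w \<Rightarrow> real.
        (\<forall>n. stopping_time F (\<sigma> n) \<and> (\<forall>\<omega>\<in>space M. 0 \<le> \<sigma> n \<omega>)) \<and>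
        (AE \<omega> in M. incseq (\<lambda>n. \<sigma> n \<omega>) \<and> filterlim (\<lambda>n. \<sigma> n \<omega>) at_top sequentially) \<and>
        (\<forall>n. is_martingale M F (\<lambda>t \<omega>. C (min t (\<sigma> n \<omega>)) \<omega>)))"

text \<open>\<open>f\<close> belongs to the domain of the extended generator of the process \<open>R\<close> in the sense of
  Davis, and the generator maps it to \<open>h\<close>.\<close>

definition extended_generator ::
  "'w measure \<Rightarrow> (real \<Rightarrow> 'w \<Rightarrow> real) \<Rightarrow> (real \<Rightarrow> real) \<Rightarrow> (real \<Rightarrow> real) \<Rightarrow> bool" where
  "extended_generator M R f h \<longleftrightarrow>
     f \<in> borel_measurable borel \<and> h \<in> borel_measurable borel \<and>
     (AE \<omega> in M. \<forall>t\<ge>0. set_integrable lborel {0..t} (\<lambda>s. h (R s \<omega>))) \<and>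
     is_local_martingale M (natural_filtration M R)
       (\<lambda>t \<omega>. f (R t \<omega>) - f (R 0 \<omega>) - (LINT s:{0..t}|lborel. h (R s \<omega>)))"

text \<open>\<open>f\<close> is locally absolutely continuous with derivative (density) \<open>f'\<close>; every continuously
  differentiable function qualifies.\<close>

definition abs_continuous_deriv :: "(real \<Rightarrow> real) \<Rightarrow> (real \<Rightarrow> real) \<Rightarrow> bool" where
  "abs_continuous_deriv f f' \<longleftrightarrow> f' \<in> borel_measurable borel \<and>
     (\<forall>a b. a \<le> b \<longrightarrow> set_integrable lborel {a..b} f' \<and> f b - f a = (LINT x:{a..b}|lborel. f' x))"

section \<open>Euclidean space with varying dimension\<close>

text \<open>As the dimension is a variable, vectors of length \<open>d\<close> are extensional functions on
  \<open>{..<d}\<close>, i.e. points of the finite product space below.  Division by a vanishing norm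
  gives 0; this only concerns a null set of states.\<close>

type_synonym vec = "nat \<Rightarrow> real"

definition vec_space :: "nat \<Rightarrow> vec measure" where
  "vec_space d = PiM {..<d} (\<lambda>_. borel)"

definition vinner :: "nat \<Rightarrow> vec \<Rightarrow> vec \<Rightarrow> real" where
  "vinner d x y = (\<Sum>i<d. x i * y i)"

abbreviation vnorm :: "nat \<Rightarrow> vec \<Rightarrow> real" where
  "vnorm d x \<equiv> L2_set x {..<d}"

definition vdir :: "nat \<Rightarrow> vec \<Rightarrow> vec" where
  "vdir d x = (\<lambda>i\<in>{..<d}. x i / vnorm d x)"

definition vperp :: "nat \<Rightarrow> vec \<Rightarrow> vec \<Rightarrow> vec" where
  "vperp d x v = (\<lambda>i\<in>{..<d}. v i - vinner d v (vdir d x) * vdir d x i)"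

type_synonym mat = "nat \<times> nat \<Rightarrow> real"

definition mat_space :: "nat \<Rightarrow> mat measure" where
  "mat_space d = PiM ({..<d} \<times> {..<d}) (\<lambda>_. borel)"

definition mat_vec :: "nat \<Rightarrow> mat \<Rightarrow> vec \<Rightarrow> vec" where
  "mat_vec d A u = (\<lambda>i\<in>{..<d}. \<Sum>j<d. A (i, j) * u j)"

definition std_gaussian :: "nat \<Rightarrow> vec measure" where
  "std_gaussian d = PiM {..<d} (\<lambda>_. density lborel std_normal_density)"

text \<open>Normalized surface measure: the radial projection of the uniform distribution on the
  unit ball.\<close>

definition sphere_uniform :: "nat \<Rightarrow> vec measure" where
  "sphere_uniform d =
     distr (uniform_measure (PiM {..<d} (\<lambda>_. lborel)) {x \<in> space (vec_space d). vnorm d x \<le> 1})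
       (vec_space d) (vdir d)"

section \<open>The FECMC process\<close>

text \<open>The matrix \<open>A\<close> restricts to an orthogonal map of the hyperplane perpendicular to \<open>x\<close>;
  its action off the hyperplane is irrelevant.\<close>

definition orthogonal_on_hyperplane :: "nat \<Rightarrow> vec \<Rightarrow> mat \<Rightarrow> bool" where
  "orthogonal_on_hyperplane d x A \<longleftrightarrow>
     (\<forall>u. vinner d u (vdir d x) = 0 \<longrightarrow>
        vinner d (mat_vec d A u) (vdir d x) = 0 \<and> vnorm d (mat_vec d A u) = vnorm d u)"

definition hyperplane_kernel :: "nat \<Rightarrow> (vec \<Rightarrow> mat measure) \<Rightarrow> bool" where
  "hyperplane_kernel d \<nu> \<longleftrightarrow> \<nu> \<in> vec_space d \<rightarrow>\<^sub>M prob_algebra (mat_space d) \<and>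
     (\<forall>x\<in>space (vec_space d). vnorm d x \<noteq> 0 \<longrightarrow> (AE A in \<nu> x. orthogonal_on_hyperplane d x A))"

definition radial_law :: "nat \<Rightarrow> real measure" where
  "radial_law d = density lborel
     (\<lambda>w. ennreal ((real d - 1) * w * (1 - w\<^sup>2) powr ((real d - 3) / 2) * indicator {0<..<1} w))"

definition new_velocity :: "nat \<Rightarrow> vec \<Rightarrow> vec \<Rightarrow> real \<Rightarrow> mat \<Rightarrow> vec" where
  "new_velocity d x v w A =
     (\<lambda>i\<in>{..<d}. - w * vdir d x i +
        sqrt (1 - w\<^sup>2) * (mat_vec d A (vperp d x v) i / vnorm d (vperp d x v)))"

definition fecmc_jump :: "nat \<Rightarrow> (vec \<Rightarrow> mat measure) \<Rightarrow> vec \<times> vec \<Rightarrow> (vec \<times> vec) measure" where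
  "fecmc_jump d \<nu> = (\<lambda>(x, v). distr (radial_law d \<Otimes>\<^sub>M \<nu> x) (vec_space d \<Otimes>\<^sub>M vec_space d)
     (\<lambda>(w, A). (x, new_velocity d x v w A)))"

definition fecmc_flow :: "nat \<Rightarrow> real \<Rightarrow> vec \<times> vec \<Rightarrow> vec \<times> vec" where
  "fecmc_flow d s = (\<lambda>(x, v). (\<lambda>i\<in>{..<d}. x i + s * v i, v))"

text \<open>The gradient of the Gaussian potential \<open>|x|\<^sup>2 / 2\<close> at \<open>x\<close> is \<open>x\<close>.\<close>

definition fecmc_rate :: "nat \<Rightarrow> vec \<times> vec \<Rightarrow> real" where
  "fecmc_rate d = (\<lambda>(x, v). max (vinner d v x) 0)"

definition fecmc_process ::
  "nat \<Rightarrow> (vec \<Rightarrow> mat measure) \<Rightarrow> 'w measure \<Rightarrow> (real \<Rightarrow> 'w \<Rightarrow> vec) \<Rightarrow> (real \<Rightarrow> 'w \<Rightarrow> vec) \<Rightarrow> bool" where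
  "fecmc_process d \<nu> M X V \<longleftrightarrow>
     hyperplane_kernel d \<nu> \<and>
     pdmp M (vec_space d \<Otimes>\<^sub>M vec_space d) (fecmc_flow d) (fecmc_rate d) (fecmc_jump d \<nu>)
       (\<lambda>t \<omega>. (X t \<omega>, V t \<omega>)) \<and>
     (\<forall>t\<ge>0. \<forall>\<omega>\<in>space M. vnorm d (V t \<omega>) = 1)"

text \<open>Law of \<open>(X t, V t)\<close>.  A distribution is invariant iff the process started from it has
  this law at every time.\<close>

definition law_at ::
  "nat \<Rightarrow> 'w measure \<Rightarrow> (real \<Rightarrow> 'w \<Rightarrow> vec) \<Rightarrow> (real \<Rightarrow> 'w \<Rightarrow> vec) \<Rightarrow> real \<Rightarrow> (vec \<times> vec) measure" where
  "law_at d M X V t = distr M (vec_space d \<Otimes>\<^sub>M vec_space d) (\<lambda>\<omega>. (X t \<omega>, V t \<omega>))"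

section \<open>The limit process\<close>

definition rayleigh :: "real measure" where
  "rayleigh = density lborel (\<lambda>x. ennreal (x * exp (- x\<^sup>2 / 2) * indicator {0<..} x))"

definition limit_generator :: "(real \<Rightarrow> real) \<Rightarrow> (real \<Rightarrow> real) \<Rightarrow> real \<Rightarrow> real" where
  "limit_generator f f' x = f' x + max x 0 * ((\<integral>\<tau>. f (- \<tau>) \<partial>rayleigh) - f x)"

text \<open>The PDMP with the characteristics read off from the generator: unit drift, jump rate
  \<open>max x 0\<close>, jumps to \<open>- \<tau>\<close> with \<open>\<tau>\<close> Rayleigh.  The generator clause covers Davis' domain,
  i.e. all locally absolutely continuous \<open>f\<close> for which the expectation is finite.\<close>

definition limit_process :: "'w measure \<Rightarrow> (real \<Rightarrow> 'w \<Rightarrow> real) \<Rightarrow> bool" where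
  "limit_process N R \<longleftrightarrow>
     pdmp N borel (\<lambda>s x. x + s) (\<lambda>x. max x 0) (\<lambda>_. distr rayleigh borel uminus) R \<and>
     (\<forall>f f'. abs_continuous_deriv f f' \<and> integrable rayleigh (\<lambda>\<tau>. f (- \<tau>)) \<longrightarrow>
        extended_generator N R f (limit_generator f f'))"

end

(* Between jumps R has slope 1, since |V| = 1. So R is a sawtooth path, determined by its jump times and
   its values after the jumps, and it depends continuously on these sequences in the Skorokhod topology.

   A velocity drawn at x makes (x|v) = -w|x|, whatever the rotation A is, and |x + sv|^2 is
   |x|^2 + 2s(x|v) + s^2. Hence the waiting times, the post-jump values of R and |X|^2/d form a Markov
   chain by themselves. It can be driven by independent standard exponential variables e, e': the waiting
   time from r is sqrt(max(r,0)^2 + 2e) - r, and the jump goes to -sqrt(1 - exp(-2e'/(d-1))) |X|.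
   Initially R is N(0,1) distributed, because V is uniform and independent of X, and |X|^2/d tends to 1.
   As d grows the driven chain converges pointwise to the one in which |X|^2/d = 1 and the jump
   goes to -sqrt(2e'), a Rayleigh variable with negative sign. Pointwise convergence of the driven
   chains, locally uniform in the initial value, gives weak convergence of the paths.

   The generator of the limit follows from the compensator formula for the jumps. Since a path started
   at r stays below max(r,0) + t, the jump rate is bounded on bounded time intervals once the initial
   value is, so localising by the initial value suffices. *)
theory Submission
  imports Defs
begin

section \<open>Sawtooth paths in the Skorokhod space\<close>

text \<open>The processes for different \<open>d\<close> live on unrelated probability spaces and
  come without driving noise, so they are not coupled with the limit. Only laws are transferred: the
  law of the coded jump chain is identified with that of a driven chain, and a test function of the
  path turns into a mean over the noise, regarded as a function of the initial state. The driven
  chains of all dimensions and of the limit are instances of one recursion, so convergence becomes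
  continuity in its parameters.

  The Skorokhod topology is given through its convergent sequences. Continuity of test functions and
  measurability of paths are therefore both reduced to sequences of jump data, where convergence is
  componentwise.

  For the generator the filtration is the one generated by the path, whereas the compensator is
  computed from coordinates of the noise. The two meet because, up to the next jump, an event of the
  past agrees almost surely with one that depends on finitely many coordinates.\<close>

definition jump_times :: "(nat \<Rightarrow> real) \<Rightarrow> bool" where
  "jump_times T \<longleftrightarrow> T 0 = 0 \<and> strict_mono T \<and> filterlim T at_top sequentially"

definition jump_index :: "(nat \<Rightarrow> real) \<Rightarrow> real \<Rightarrow> nat" where
  "jump_index T t = (LEAST n. t < T (Suc n))"

definition sawtooth :: "(nat \<Rightarrow> real) \<Rightarrow> (nat \<Rightarrow> real) \<Rightarrow> real \<Rightarrow> real" where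
  "sawtooth T r t = r (jump_index T t) + (t - T (jump_index T t))"

lemma jump_times_less: "jump_times T \<Longrightarrow> T n < T (Suc n)"
  by (simp add: jump_times_def strict_mono_Suc_iff)

lemma jump_times_mono: "jump_times T \<Longrightarrow> m \<le> n \<Longrightarrow> T m \<le> T n"
  by (simp add: jump_times_def strict_mono_less_eq)

lemma jump_times_nonneg: "jump_times T \<Longrightarrow> 0 \<le> T n"
  using jump_times_mono[of T 0 n] by (simp add: jump_times_def)

lemma jump_times_exceed: "jump_times T \<Longrightarrow> \<exists>n. t < T n"
  unfolding jump_times_def filterlim_at_top_dense eventually_sequentially by blast

lemma jump_index_bounds:
  assumes T: "jump_times T" and t: "0 \<le> t"
  shows "T (jump_index T t) \<le> t" "t < T (Suc (jump_index T t))"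
proof -
  obtain n where "t < T n" using jump_times_exceed[OF T] by blast
  then have "t < T (Suc n)" using jump_times_less[OF T, of n] by linarith
  then show "t < T (Suc (jump_index T t))"
    unfolding jump_index_def by (rule LeastI)
  show "T (jump_index T t) \<le> t"
  proof (cases "jump_index T t")
    case 0
    then show ?thesis using T t by (simp add: jump_times_def)
  next
    case (Suc k)
    then have "\<not> t < T (Suc k)"
      using not_less_Least[of k "\<lambda>n. t < T (Suc n)"] by (simp add: jump_index_def)
    then show ?thesis using Suc by simp
  qed
qed

lemma jump_index_eq:
  assumes T: "jump_times T" and t: "T n \<le> t" "t < T (Suc n)"
  shows "jump_index T t = n"
proof -
  have "0 \<le> t" using jump_times_nonneg[OF T, of n] t by linarith
  note b = jump_index_bounds[OF T this]
  have "\<not> Suc n \<le> jump_index T t" "\<not> Suc (jump_index T t) \<le> n"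
    using b t jump_times_mono[OF T, of "Suc n" "jump_index T t"]
      jump_times_mono[OF T, of "Suc (jump_index T t)" n] by linarith+
  then show ?thesis by linarith
qed

lemma sawtooth_eq:
  "jump_times T \<Longrightarrow> T n \<le> t \<Longrightarrow> t < T (Suc n) \<Longrightarrow> sawtooth T r t = r n + (t - T n)"
  by (simp add: sawtooth_def jump_index_eq)

lemma jump_interval_cases:
  assumes "jump_times T" "0 \<le> t"
  obtains n where "T n \<le> t" "t < T (Suc n)"
  using jump_index_bounds[OF assms] by blast

lemma sawtooth_cadlag:
  assumes T: "jump_times T"
  shows "(\<lambda>t\<in>{0..}. sawtooth T r t) \<in> cadlag_paths"
  unfolding cadlag_paths_def
proof (intro CollectI conjI allI impI)
  show "(\<lambda>t\<in>{0..}. sawtooth T r t) \<in> extensional {0..}" by simp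
next
  fix t :: real assume t: "0 \<le> t"
  then obtain n where n: "T n \<le> t" "t < T (Suc n)" using jump_interval_cases[OF T] by blast
  have "\<forall>\<^sub>F s in at_right t. t < s" "\<forall>\<^sub>F s in at_right t. s < T (Suc n)"
    using n by (auto simp: eventually_at_right_less eventually_at_right[OF n(2)])
  then have ev: "\<forall>\<^sub>F s in at_right t. r n + (s - T n) = (\<lambda>t\<in>{0..}. sawtooth T r t) s"
    by eventually_elim (use n t in \<open>auto simp: sawtooth_eq[OF T, of n]\<close>)
  have "((\<lambda>s. r n + (s - T n)) \<longlongrightarrow> r n + (t - T n)) (at_right t)"
    by (intro tendsto_intros)
  then have "((\<lambda>t\<in>{0..}. sawtooth T r t) \<longlongrightarrow> r n + (t - T n)) (at_right t)"
    by (rule Lim_transform_eventually[OF _ ev])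
  moreover have "(\<lambda>t\<in>{0..}. sawtooth T r t) t = r n + (t - T n)"
    using n t by (simp add: sawtooth_eq[OF T, of n])
  ultimately show "continuous (at_right t) (\<lambda>t\<in>{0..}. sawtooth T r t)"
    by (simp add: continuous_within)
next
  fix t :: real assume t: "0 < t"
  \<comment> \<open>The left limit at a jump time belongs to the preceding segment, so the intervals
    have to be closed on the right here. The index before \<open>t\<close> exists because
    \<open>T 0 = 0 < t\<close>.\<close>
  have "\<exists>n. T n < t \<and> t \<le> T (Suc n)"
  proof (cases "T (jump_index T t) = t")
    case True
    then have "jump_index T t \<noteq> 0" using t T by (metis jump_times_def less_irrefl)
    then obtain k where k: "jump_index T t = Suc k" by (cases "jump_index T t") auto
    then show ?thesis using True jump_times_less[OF T, of k] by (intro exI[of _ k]) auto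
  next
    case False
    then show ?thesis using jump_index_bounds[OF T, of t] t
      by (intro exI[of _ "jump_index T t"]) auto
  qed
  then obtain n where n: "T n < t" "t \<le> T (Suc n)" by blast
  have "\<forall>\<^sub>F s in at_left t. s < t" "\<forall>\<^sub>F s in at_left t. T n < s"
    using n eventually_at_left[OF n(1)] by (auto simp: eventually_at_filter)
  then have ev: "\<forall>\<^sub>F s in at_left t. r n + (s - T n) = (\<lambda>t\<in>{0..}. sawtooth T r t) s"
    by eventually_elim
      (use n jump_times_nonneg[OF T, of n] in \<open>auto simp: sawtooth_eq[OF T, of n]\<close>)
  have "((\<lambda>s. r n + (s - T n)) \<longlongrightarrow> r n + (t - T n)) (at_left t)"
    by (intro tendsto_intros)
  then have "((\<lambda>t\<in>{0..}. sawtooth T r t) \<longlongrightarrow> r n + (t - T n)) (at_left t)"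
    by (rule Lim_transform_eventually[OF _ ev])
  then show "\<exists>l. ((\<lambda>t\<in>{0..}. sawtooth T r t) \<longlongrightarrow> l) (at_left t)" by blast
qed

section \<open>Piecewise linear time changes\<close>

definition interpolate :: "(nat \<Rightarrow> real) \<Rightarrow> (nat \<Rightarrow> real) \<Rightarrow> real \<Rightarrow> real" where
  "interpolate T U t = (let k = jump_index T t in
     U k + (t - T k) * ((U (Suc k) - U k) / (T (Suc k) - T k)))"

lemma interpolate_eq:
  "jump_times T \<Longrightarrow> T k \<le> t \<Longrightarrow> t < T (Suc k) \<Longrightarrow>
    interpolate T U t = U k + (t - T k) * ((U (Suc k) - U k) / (T (Suc k) - T k))"
  by (simp add: interpolate_def jump_index_eq)

lemma interpolate_bounds:
  assumes T: "jump_times T" and U: "jump_times U" and t: "T k \<le> t" "t < T (Suc k)"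
  shows "U k \<le> interpolate T U t" "interpolate T U t < U (Suc k)"
proof -
  have pos: "0 < U (Suc k) - U k" "0 < T (Suc k) - T k"
    using jump_times_less[OF U] jump_times_less[OF T] by simp_all
  then show "U k \<le> interpolate T U t"
    using t by (auto simp: interpolate_eq[OF T t])
  have "(t - T k) / (T (Suc k) - T k) * (U (Suc k) - U k) < 1 * (U (Suc k) - U k)"
    using pos t by (intro mult_strict_right_mono) auto
  then show "interpolate T U t < U (Suc k)"
    by (simp add: interpolate_eq[OF T t])
qed

lemma interpolate_inverse:
  assumes T: "jump_times T" and U: "jump_times U" and t: "0 \<le> t"
  shows "interpolate U T (interpolate T U t) = t"
proof -
  obtain k where k: "T k \<le> t" "t < T (Suc k)" using jump_interval_cases[OF T t] by blast
  have pos: "U (Suc k) - U k \<noteq> 0" "T (Suc k) - T k \<noteq> 0"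
    using jump_times_less[OF U, of k] jump_times_less[OF T, of k] by auto
  show ?thesis
    unfolding interpolate_eq[OF U interpolate_bounds[OF T U k]]
    unfolding interpolate_eq[OF T k] using pos by simp
qed

lemma interpolate_nonneg:
  assumes T: "jump_times T" and U: "jump_times U" and t: "0 \<le> t"
  shows "0 \<le> interpolate T U t"
proof -
  obtain k where k: "T k \<le> t" "t < T (Suc k)" using jump_interval_cases[OF T t] by blast
  show ?thesis using interpolate_bounds(1)[OF T U k] jump_times_nonneg[OF U, of k] by linarith
qed

text \<open>Exchanging the two sequences of jump times inverts the map, which gives surjectivity.
  Monotonicity holds within a segment because slopes are positive, and across segments because each
  segment is mapped into the corresponding one.\<close>

lemma time_change_interpolate:
  assumes T: "jump_times T" and U: "jump_times U"
  shows "time_change (interpolate T U)"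
  unfolding time_change_def
proof
  show "interpolate T U ` {0..} = {0..}"
  proof (intro equalityI subsetI)
    fix u assume "u \<in> {0::real..}"
    then have "interpolate T U (interpolate U T u) = u" "interpolate U T u \<in> {0..}"
      using interpolate_inverse[OF U T] interpolate_nonneg[OF U T] by simp_all
    then show "u \<in> interpolate T U ` {0..}" by (rule image_eqI[OF sym])
  next
    fix u assume "u \<in> interpolate T U ` {0..}"
    then obtain t where "u = interpolate T U t" "0 \<le> t" by auto
    then show "u \<in> {0..}" using interpolate_nonneg[OF T U] by simp
  qed
  show "strict_mono_on {0..} (interpolate T U)"
  proof (rule strict_mono_onI)
    fix s t :: real assume st: "s \<in> {0..}" "t \<in> {0..}" "s < t"
    then have nonneg: "0 \<le> s" "0 \<le> t" by auto
    obtain k where k: "T k \<le> s" "s < T (Suc k)"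
      using jump_interval_cases[OF T nonneg(1)] by blast
    obtain l where l: "T l \<le> t" "t < T (Suc l)"
      using jump_interval_cases[OF T nonneg(2)] by blast
    have "\<not> Suc l \<le> k" using jump_times_mono[OF T, of "Suc l" k] k l st by linarith
    then consider "k = l" | "Suc k \<le> l" by linarith
    then show "interpolate T U s < interpolate T U t"
    proof cases
      case 1
      have "(s - T k) * ((U (Suc k) - U k) / (T (Suc k) - T k))
          < (t - T k) * ((U (Suc k) - U k) / (T (Suc k) - T k))"
        using st jump_times_less[OF U, of k] jump_times_less[OF T, of k]
        by (intro mult_strict_right_mono) auto
      then show ?thesis using 1 k l by (simp add: interpolate_eq[OF T, of k])
    next
      case 2
      then show ?thesis
        using interpolate_bounds(2)[OF T U k] interpolate_bounds(1)[OF T U l]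
          jump_times_mono[OF U 2] by linarith
    qed
  qed
qed

text \<open>Within a segment the displacement is a convex combination of the displacements at its
  two end points.\<close>

lemma interpolate_dist:
  assumes T: "jump_times T" and t: "0 \<le> t" and d: "\<And>k. \<bar>U k - T k\<bar> \<le> d"
  shows "\<bar>interpolate T U t - t\<bar> \<le> d"
proof -
  obtain k where k: "T k \<le> t" "t < T (Suc k)" using jump_interval_cases[OF T t] by blast
  define \<theta> where "\<theta> = (t - T k) / (T (Suc k) - T k)"
  have pos: "0 < T (Suc k) - T k" using jump_times_less[OF T] by simp
  then have \<theta>: "0 \<le> \<theta>" "\<theta> \<le> 1" "t = T k + \<theta> * (T (Suc k) - T k)"
    using k by (auto simp: \<theta>_def)
  have "interpolate T U t = U k + \<theta> * (U (Suc k) - U k)"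
    by (simp add: interpolate_eq[OF T k] \<theta>_def)
  then have "interpolate T U t - t = (1 - \<theta>) * (U k - T k) + \<theta> * (U (Suc k) - T (Suc k))"
    by (subst (2) \<theta>(3)) (simp add: algebra_simps)
  also have "\<bar>\<dots>\<bar> \<le> (1 - \<theta>) * \<bar>U k - T k\<bar> + \<theta> * \<bar>U (Suc k) - T (Suc k)\<bar>"
    using \<theta> by (intro abs_triangle_ineq[THEN order_trans] add_mono) (auto simp: abs_mult)
  also have "\<dots> \<le> (1 - \<theta>) * d + \<theta> * d"
    using \<theta> d by (intro add_mono mult_left_mono) auto
  finally show ?thesis by (simp add: algebra_simps)
qed

text \<open>Turns convergence for each fixed number \<open>K\<close> of jumps into convergence along
  a number of jumps that grows slowly with \<open>j\<close>: take the largest admissible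
  \<open>K\<close> whose error at \<open>j\<close> is at most \<open>1 / (K + 1)\<close>.\<close>

lemma diagonal_index:
  fixes \<delta> :: "nat \<Rightarrow> nat \<Rightarrow> real"
  assumes lim: "\<And>K. (\<lambda>j. \<delta> K j) \<longlonglongrightarrow> 0" and nonneg: "\<And>K j. 0 \<le> \<delta> K j"
  obtains \<kappa> :: "nat \<Rightarrow> nat" where "filterlim \<kappa> at_top sequentially" "(\<lambda>j. \<delta> (\<kappa> j) j) \<longlonglongrightarrow> 0"
proof -
  \<comment> \<open>The bound \<open>K \<le> j\<close> keeps the set finite and the alternative
    \<open>K = 0\<close> keeps it nonempty, so that the maximum exists for every
    \<open>j\<close>.\<close>
  define A where "A j = {K. K \<le> j \<and> (K = 0 \<or> \<delta> K j \<le> 1 / real (Suc K))}" for j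
  define \<kappa> where "\<kappa> j = Max (A j)" for j
  have A: "finite (A j)" "A j \<noteq> {}" for j
    by (auto simp: A_def)
  have large: "\<forall>\<^sub>F j in sequentially. K \<le> \<kappa> j" for K
  proof -
    have "\<forall>\<^sub>F j in sequentially. \<delta> K j < 1 / real (Suc K)"
      using lim[of K] by (rule order_tendstoD) simp
    then show ?thesis
      using eventually_ge_at_top[of K]
    proof eventually_elim
      case (elim j)
      then have "K \<in> A j" by (simp add: A_def)
      then show ?case unfolding \<kappa>_def using A(1) by (rule Max_ge[rotated])
    qed
  qed
  then have \<kappa>: "filterlim \<kappa> at_top sequentially"
    by (simp add: filterlim_at_top)
  have small: "\<forall>\<^sub>F j in sequentially. \<delta> (\<kappa> j) j \<le> 1 / real (Suc (\<kappa> j))"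
    using large[of 1]
  proof eventually_elim
    case (elim j)
    have "\<kappa> j \<in> A j" unfolding \<kappa>_def using A by (intro Max_in)
    then show ?case using elim by (auto simp: A_def)
  qed
  have "(\<lambda>j. 1 / real (Suc (\<kappa> j))) \<longlonglongrightarrow> 0"
    using filterlim_compose[OF LIMSEQ_Suc[OF lim_1_over_n] \<kappa>] by simp
  then have "(\<lambda>j. \<delta> (\<kappa> j) j) \<longlonglongrightarrow> 0"
    by (rule tendsto_sandwich[OF _ small tendsto_const, rotated]) (simp add: nonneg)
  then show ?thesis using that \<kappa> by blast
qed

text \<open>Only the jump times up to index \<open>\<kappa> j\<close> are matched by the time change, which is a translation
  afterwards: the convergence of the jump times need not be uniform in the index.\<close>

lemma skorokhod_tendsto_sawtooth:
  assumes T: "jump_times T" and U: "\<And>j. jump_times (U j)"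
    and UT: "\<And>k. (\<lambda>j. U j k) \<longlonglongrightarrow> T k" and ur: "\<And>k. (\<lambda>j. u j k) \<longlonglongrightarrow> r k"
  shows "skorokhod_tendsto (\<lambda>j. \<lambda>t\<in>{0..}. sawtooth (U j) (u j) t) (\<lambda>t\<in>{0..}. sawtooth T r t)"
proof -
  define \<delta> where "\<delta> K j = (\<Sum>k\<le>K. \<bar>U j k - T k\<bar> + \<bar>u j k - r k\<bar>)" for K j
  have "(\<lambda>j. \<delta> K j) \<longlonglongrightarrow> (\<Sum>k\<le>K. \<bar>T k - T k\<bar> + \<bar>r k - r k\<bar>)" for K
    unfolding \<delta>_def by (intro tendsto_intros UT ur)
  then have "(\<lambda>j. \<delta> K j) \<longlonglongrightarrow> 0" for K by simp
  moreover have "0 \<le> \<delta> K j" for K j by (auto simp: \<delta>_def intro!: sum_nonneg)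
  ultimately obtain \<kappa> :: "nat \<Rightarrow> nat" where
    \<kappa>: "filterlim \<kappa> at_top sequentially" and \<delta>: "(\<lambda>j. \<delta> (\<kappa> j) j) \<longlonglongrightarrow> 0"
    using diagonal_index[of \<delta>] by metis
  define W where "W j k = (if k \<le> \<kappa> j then U j k else T k + (U j (\<kappa> j) - T (\<kappa> j)))" for j k
  have W: "jump_times (W j)" for j
    unfolding jump_times_def
  proof (intro conjI)
    show "W j 0 = 0" using U[of j] by (simp add: W_def jump_times_def)
    have "W j k < W j (Suc k)" for k
    proof -
      consider "Suc k \<le> \<kappa> j" | "k = \<kappa> j" | "\<kappa> j < k" by linarith
      then show ?thesis
        using jump_times_less[OF U[of j], of k] jump_times_less[OF T, of k]
        by cases (auto simp: W_def)
    qed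
    then show "strict_mono (W j)" by (simp add: strict_mono_Suc_iff)
    have "filterlim (\<lambda>k. (U j (\<kappa> j) - T (\<kappa> j)) + T k) at_top sequentially"
      using T by (intro filterlim_tendsto_add_at_top[OF tendsto_const]) (simp add: jump_times_def)
    moreover have "\<forall>\<^sub>F k in sequentially. (U j (\<kappa> j) - T (\<kappa> j)) + T k = W j k"
      using eventually_gt_at_top[of "\<kappa> j"] by eventually_elim (simp add: W_def)
    ultimately show "filterlim (W j) at_top sequentially"
      by (rule filterlim_mono_eventually[OF _ order_refl order_refl])
  qed
  have WT: "\<bar>W j k - T k\<bar> \<le> \<delta> (\<kappa> j) j" for j k
  proof -
    have "\<bar>U j k - T k\<bar> \<le> \<delta> (\<kappa> j) j" if "k \<le> \<kappa> j" for k
      unfolding \<delta>_def using that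
      by (intro order_trans[OF _ member_le_sum[of k]]) auto
    then show ?thesis by (auto simp: W_def)
  qed
  have ur': "\<bar>u j k - r k\<bar> \<le> \<delta> (\<kappa> j) j" if "k \<le> \<kappa> j" for j k
    unfolding \<delta>_def using that by (intro order_trans[OF _ member_le_sum[of k]]) auto
  define l where "l j = interpolate T (W j)" for j
  have l: "time_change (l j)" for j unfolding l_def by (rule time_change_interpolate[OF T W])
  have ld: "\<bar>l j t - t\<bar> \<le> \<delta> (\<kappa> j) j" if "0 \<le> t" for j t
    unfolding l_def by (rule interpolate_dist[OF T that WT])
  have "uniform_limit {0..} l (\<lambda>t. t) sequentially"
    proof (rule uniform_limitI)
      fix e :: real assume "0 < e"
      with \<delta> have "\<forall>\<^sub>F j in sequentially. \<delta> (\<kappa> j) j < e" by (rule order_tendstoD)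
      then show "\<forall>\<^sub>F j in sequentially. \<forall>t\<in>{0..}. dist (l j t) t < e"
      proof eventually_elim
        case (elim j)
        have "dist (l j t) t < e" if "0 \<le> t" for t
          using ld[OF that, of j] elim by (simp add: dist_real_def)
        then show ?case by simp
      qed
    qed
  moreover have "uniform_limit {0..m} (\<lambda>j t. (\<lambda>t\<in>{0..}. sawtooth (U j) (u j) t) (l j t))
        (\<lambda>t\<in>{0..}. sawtooth T r t) sequentially" for m :: real
    proof (rule uniform_limitI)
      fix e :: real assume e: "0 < e"
      \<comment> \<open>All segments met on \<open>{0..m}\<close> have index below \<open>K\<close>.
        As soon as \<open>K \<le> \<kappa> j\<close>, the time change matches both end points of
        each of them, and the error is the sum of three terms: displacement of time, of the jump
        time, and of the value after the jump.\<close>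
      obtain K where K: "m < T K" using jump_times_exceed[OF T] by blast
      have "\<forall>\<^sub>F j in sequentially. \<delta> (\<kappa> j) j < e / 3"
        using \<delta> e by (intro order_tendstoD(2)) auto
      moreover have "\<forall>\<^sub>F j in sequentially. K \<le> \<kappa> j" using \<kappa> by (simp add: filterlim_at_top)
      ultimately show "\<forall>\<^sub>F j in sequentially. \<forall>t\<in>{0..m}.
          dist ((\<lambda>t\<in>{0..}. sawtooth (U j) (u j) t) (l j t)) ((\<lambda>t\<in>{0..}. sawtooth T r t) t) < e"
      proof eventually_elim
        case (elim j)
        show ?case
        proof
          fix t assume t: "t \<in> {0..m}"
          then have t0: "0 \<le> t" by simp
          obtain k where k: "T k \<le> t" "t < T (Suc k)"
            using jump_interval_cases[OF T t0] by blast
          have "\<not> K \<le> k" using K k t jump_times_mono[OF T, of K k] by force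
          then have k': "k \<le> \<kappa> j" "Suc k \<le> \<kappa> j" using elim by linarith+
          have "U j k \<le> l j t" "l j t < U j (Suc k)"
            using interpolate_bounds[OF T W k, of j] k' by (simp_all add: l_def W_def)
          then have 1: "sawtooth (U j) (u j) (l j t) = u j k + (l j t - U j k)"
            by (rule sawtooth_eq[OF U])
          have 2: "sawtooth T r t = r k + (t - T k)" by (rule sawtooth_eq[OF T k])
          have "\<bar>U j k - T k\<bar> \<le> \<delta> (\<kappa> j) j" using WT[of j k] k' by (simp add: W_def)
          then have "\<bar>sawtooth (U j) (u j) (l j t) - sawtooth T r t\<bar> < e"
            using ld[OF t0, of j] ur'[OF k'(1)] elim(1) unfolding 1 2 by linarith
          moreover have "0 \<le> l j t" unfolding l_def by (rule interpolate_nonneg[OF T W t0])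
          ultimately show "dist ((\<lambda>t\<in>{0..}. sawtooth (U j) (u j) t) (l j t)) ((\<lambda>t\<in>{0..}. sawtooth T r t) t) < e"
            using t0 by (simp add: dist_real_def)
        qed
      qed
    qed
  ultimately show ?thesis
    unfolding skorokhod_tendsto_def using l by blast
qed

section \<open>Paths coded by sequences of jump times and values\<close>

definition jump_data :: "(nat \<Rightarrow> real \<times> real) set" where
  "jump_data = {x. jump_times (fst \<circ> x)}"

definition data_path :: "(nat \<Rightarrow> real \<times> real) \<Rightarrow> real \<Rightarrow> real" where
  "data_path x = (\<lambda>t\<in>{0..}. sawtooth (fst \<circ> x) (snd \<circ> x) t)"

lemma data_path_cadlag: "x \<in> jump_data \<Longrightarrow> data_path x \<in> cadlag_paths"
  unfolding data_path_def jump_data_def by (intro sawtooth_cadlag) simp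

lemma data_path_tendsto:
  assumes "x \<in> jump_data" "\<And>j. xs j \<in> jump_data" "\<And>k. (\<lambda>j. xs j k) \<longlonglongrightarrow> x k"
  shows "skorokhod_tendsto (\<lambda>j. data_path (xs j)) (data_path x)"
  unfolding data_path_def using assms(1,2) tendsto_fst[OF assms(3)] tendsto_snd[OF assms(3)]
  by (intro skorokhod_tendsto_sawtooth) (auto simp: jump_data_def)

text \<open>Open sets of this topology are sequentially open by \<open>openin_skorokhod\<close>, so
  a continuous function respects the convergence supplied by
  \<open>data_path_tendsto\<close>.\<close>

lemma continuous_map_data_path_tendsto:
  assumes g: "continuous_map skorokhod euclideanreal g"
    and "x \<in> jump_data" "\<And>j. xs j \<in> jump_data" "\<And>k. (\<lambda>j. xs j k) \<longlonglongrightarrow> x k"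
  shows "(\<lambda>j. g (data_path (xs j))) \<longlonglongrightarrow> g (data_path x)"
proof (rule topological_tendstoI)
  fix S assume S: "open S" "g (data_path x) \<in> S"
  define U where "U = {y \<in> topspace skorokhod. g y \<in> S}"
  have "openin skorokhod U"
    unfolding U_def using g S(1) by (auto simp: continuous_map_def)
  moreover have "data_path x \<in> U" using S assms data_path_cadlag by (simp add: U_def)
  moreover have "range (\<lambda>j. data_path (xs j)) \<subseteq> cadlag_paths" using assms data_path_cadlag by auto
  ultimately have "\<forall>\<^sub>F j in sequentially. data_path (xs j) \<in> U"
    using data_path_tendsto[OF assms(2-4)] unfolding openin_skorokhod by blast
  then show "\<forall>\<^sub>F j in sequentially. g (data_path (xs j)) \<in> S"
    by eventually_elim (simp add: U_def)
qed

text \<open>The coding map is sequentially continuous. Its domain lies in a countable product of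
  metric spaces, where closures are reached by sequences, so sequential continuity is enough for
  preimages of open sets to be relatively open.\<close>

lemma openin_data_path_vimage:
  assumes U: "openin skorokhod U"
  shows "openin (top_of_set jump_data) {x \<in> jump_data. data_path x \<in> U}"
proof -
  let ?C = "{x \<in> jump_data. data_path x \<notin> U}"
  have "data_path x \<notin> U" if x: "x \<in> jump_data" "x \<in> closure ?C" for x
  proof -
    obtain xs where *: "(\<forall>n. xs n \<in> ?C)" "xs \<longlonglongrightarrow> x"
      using x(2) unfolding closure_sequential by blast
    have "(\<lambda>j. xs j k) \<longlonglongrightarrow> x k" for k
    proof -
      have "isCont (\<lambda>x :: nat \<Rightarrow> real \<times> real. x k) x"
        using continuous_on_eq_continuous_at[OF open_UNIV, THEN iffD1, OF continuous_on_product_coordinates[of k]]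
        by blast
      then show ?thesis using *(2) by (rule isCont_tendsto_compose)
    qed
    then have "skorokhod_tendsto (\<lambda>j. data_path (xs j)) (data_path x)"
      using * x by (intro data_path_tendsto) auto
    moreover have "range (\<lambda>j. data_path (xs j)) \<subseteq> cadlag_paths" using * data_path_cadlag by auto
    ultimately have "\<forall>\<^sub>F n in sequentially. data_path (xs n) \<in> U" if "data_path x \<in> U"
      using U that unfolding openin_skorokhod by blast
    then show ?thesis using * by auto
  qed
  then have "{x \<in> jump_data. data_path x \<in> U} = jump_data \<inter> (- closure ?C)"
    using closure_subset[of ?C] by auto
  then show ?thesis
    unfolding openin_open by (intro exI[of _ "- closure ?C"] conjI) (simp_all add: open_Compl)
qed

text \<open>Borel sets of the path space are handled through the coding alone: preimages of open
  sets are traces of open sets of the sequence space, and on a countable product of second countable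
  spaces these lie in the product sigma-algebra.\<close>

lemma measurable_data_path:
  assumes x: "x \<in> L \<rightarrow>\<^sub>M PiM UNIV (\<lambda>_::nat. borel)" and E: "\<And>\<omega>. \<omega> \<in> space L \<Longrightarrow> x \<omega> \<in> jump_data"
  shows "(\<lambda>\<omega>. data_path (x \<omega>)) \<in> L \<rightarrow>\<^sub>M borel_algebra skorokhod"
  unfolding borel_algebra_def
proof (rule measurable_measure_of)
  show "{U. openin skorokhod U} \<subseteq> Pow (topspace skorokhod)"
    using openin_subset by fastforce
  show "(\<lambda>\<omega>. data_path (x \<omega>)) \<in> space L \<rightarrow> topspace skorokhod" using E data_path_cadlag by auto
  fix U assume "U \<in> {U. openin skorokhod U}"
  then obtain W where W: "open W" "{x \<in> jump_data. data_path x \<in> U} = jump_data \<inter> W"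
    using openin_data_path_vimage[of U] by (auto simp: openin_open)
  have "(\<lambda>\<omega>. data_path (x \<omega>)) -` U \<inter> space L = x -` W \<inter> space L"
    using W(2) E by auto
  also have "\<dots> \<in> sets L"
    using x W(1) by (intro measurable_sets[OF x]) (simp add: sets_PiM_equal_borel)
  finally show "(\<lambda>\<omega>. data_path (x \<omega>)) -` U \<inter> space L \<in> sets L" .
qed

text \<open>Divergence of the monotone sequence of jump times is replaced by a countable condition,
  from which measurability can be read off.\<close>

lemma jump_data_iff:
  "x \<in> jump_data \<longleftrightarrow> fst (x 0) = 0 \<and> (\<forall>n. fst (x n) < fst (x (Suc n))) \<and>
     (\<forall>m::nat. \<exists>n. real m \<le> fst (x n))"
proof -
  have "filterlim (\<lambda>n. fst (x n)) at_top sequentially \<longleftrightarrow> (\<forall>m::nat. \<exists>n. real m \<le> fst (x n))"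
    if "strict_mono (\<lambda>n. fst (x n))"
  proof
    assume "filterlim (\<lambda>n. fst (x n)) at_top sequentially"
    then show "\<forall>m::nat. \<exists>n. real m \<le> fst (x n)"
      unfolding filterlim_at_top eventually_sequentially by blast
  next
    assume *: "\<forall>m::nat. \<exists>n. real m \<le> fst (x n)"
    show "filterlim (\<lambda>n. fst (x n)) at_top sequentially"
      unfolding filterlim_at_top eventually_sequentially
    proof
      fix z :: real
      obtain m :: nat where m: "z \<le> real m" using real_arch_simple by blast
      obtain n where "real m \<le> fst (x n)" using * by blast
      then show "\<exists>N. \<forall>n\<ge>N. z \<le> fst (x n)"
        using m strict_mono_less_eq[OF that, of n] by (meson order_trans)
    qed
  qed
  then show ?thesis
    by (auto simp: jump_data_def jump_times_def comp_def strict_mono_Suc_iff)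
qed

lemma jump_data_measurable: "jump_data \<in> sets (PiM UNIV (\<lambda>_::nat. borel))"
proof -
  have [measurable]: "(\<lambda>x. fst (x n)) \<in> borel_measurable (PiM UNIV (\<lambda>_::nat. borel :: (real \<times> real) measure))" for n
    by (rule measurable_compose[OF measurable_component_singleton[of n]],
        (auto intro!: borel_measurable_continuous_onI continuous_intros)[2])
  have "{x \<in> space (PiM UNIV (\<lambda>_::nat. borel :: (real \<times> real) measure)). fst (x 0) = 0 \<and>
     (\<forall>n. fst (x n) < fst (x (Suc n))) \<and> (\<forall>m::nat. \<exists>n. real m \<le> fst (x n))} \<in> sets (PiM UNIV (\<lambda>_::nat. borel))"
    by measurable
  also have "{x \<in> space (PiM UNIV (\<lambda>_::nat. borel :: (real \<times> real) measure)). fst (x 0) = 0 \<and>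
     (\<forall>n. fst (x n) < fst (x (Suc n))) \<and> (\<forall>m::nat. \<exists>n. real m \<le> fst (x n))} = jump_data"
    by (auto simp: jump_data_iff space_PiM)
  finally show ?thesis .
qed

lemma measurable_path_functional:
  assumes g: "continuous_map skorokhod euclideanreal g"
  shows "(\<lambda>x. if x \<in> jump_data then g (data_path x) else 0) \<in> borel_measurable (PiM UNIV (\<lambda>_::nat. borel))"
proof -
  let ?P = "PiM UNIV (\<lambda>_::nat. borel :: (real \<times> real) measure)"
  have g': "g \<in> borel_algebra skorokhod \<rightarrow>\<^sub>M borel"
  proof (rule borel_measurableI)
    fix S :: "real set" assume "open S"
    then have "openin skorokhod {y \<in> topspace skorokhod. g y \<in> S}"
      using g by (auto simp: continuous_map_def)
    moreover have "g -` S \<inter> space (borel_algebra skorokhod) = {y \<in> topspace skorokhod. g y \<in> S}"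
      by (auto simp: borel_algebra_def space_measure_of_conv)
    ultimately show "g -` S \<inter> space (borel_algebra skorokhod) \<in> sets (borel_algebra skorokhod)"
      unfolding borel_algebra_def
      using openin_subset by (subst sets_measure_of) fastforce+
  qed
  have "(\<lambda>x. data_path x) \<in> restrict_space ?P jump_data \<rightarrow>\<^sub>M borel_algebra skorokhod"
    by (intro measurable_data_path measurable_restrict_space1)
      (auto simp: space_restrict_space)
  from measurable_compose[OF this g'] show ?thesis
    by (intro measurable_If_restrict_space_iff[THEN iffD2])
      (auto simp: jump_data_measurable space_PiM)
qed

section \<open>Waiting times and the law of the velocity component\<close>

definition expo :: "real measure" where
  "expo = density lborel (exponential_density 1)"

lemma prob_space_expo: "prob_space expo"
  unfolding expo_def by (rule prob_space_exponential_density) simp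

lemma sets_expo [measurable_cong, simp]: "sets expo = sets borel"
  by (simp add: expo_def)

lemma space_expo [simp]: "space expo = UNIV"
  by (simp add: expo_def)

lemma nn_integral_greaterThan_eq:
  "(\<integral>\<^sup>+x. f x * indicator {a::real<..} x \<partial>lborel) = (\<integral>\<^sup>+x. f x * indicator {a..} x \<partial>lborel)"
  using AE_lborel_singleton[of a]
  by (intro nn_integral_cong_AE) (auto elim!: eventually_mono split: split_indicator)

lemma emeasure_expo_greaterThan:
  assumes "0 \<le> c"
  shows "emeasure expo {c<..} = ennreal (exp (- c))"
proof -
  have "emeasure expo {c<..} = (\<integral>\<^sup>+x. ennreal (exponential_density 1 x) * indicator {c<..} x \<partial>lborel)"
    unfolding expo_def by (simp add: emeasure_density)
  also have "\<dots> = (\<integral>\<^sup>+x. ennreal (exp (- x)) * indicator {c..} x \<partial>lborel)"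
    unfolding nn_integral_greaterThan_eq using assms
    by (intro nn_integral_cong) (auto simp: exponential_density_def split: split_indicator)
  also have "\<dots> = 0 - (- exp (- c))"
  proof (rule nn_integral_FTC_atLeast)
    show "((\<lambda>x::real. - exp (- x)) \<longlongrightarrow> 0) at_top"
      using tendsto_minus[OF filterlim_compose[OF exp_at_bot filterlim_uminus_at_bot_at_top]] by simp
  qed (auto intro!: derivative_eq_intros)
  finally show ?thesis by simp
qed

lemma AE_expo: "AE e in expo. 0 < e"
proof -
  have "AE e in lborel. 0 < exponential_density 1 e \<longrightarrow> 0 < (e::real)"
    using AE_lborel_singleton[of 0] by eventually_elim (auto simp: exponential_density_def)
  then show ?thesis
    unfolding expo_def by (subst AE_density) auto
qed

lemma emeasure_expo_cong:
  assumes "\<And>e. 0 < e \<Longrightarrow> e \<in> A \<longleftrightarrow> e \<in> B" "A \<in> sets borel" "B \<in> sets borel"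
  shows "emeasure expo A = emeasure expo B"
  using AE_expo assms by (intro emeasure_eq_AE) (auto elim!: eventually_mono)

lemma emeasure_expo_full:
  assumes "\<And>e. 0 < e \<Longrightarrow> e \<in> A" "A \<in> sets borel"
  shows "emeasure expo A = 1"
  using emeasure_expo_cong[of A UNIV] assms prob_space.emeasure_space_1[OF prob_space_expo] by simp

lemma emeasure_distr_expo:
  assumes [measurable]: "g \<in> borel_measurable borel" and "0 \<le> c"
    and "\<And>e. 0 < e \<Longrightarrow> x < g e \<longleftrightarrow> c < e"
  shows "emeasure (distr expo borel g) {x::real<..} = ennreal (exp (- c))"
proof -
  have g: "g -` {x<..} \<in> sets borel" by (rule measurable_sets_borel[OF assms(1)]) simp
  have "emeasure (distr expo borel g) {x<..} = emeasure expo (g -` {x<..})"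
    by (subst emeasure_distr) auto
  also have "\<dots> = emeasure expo {c<..}"
    using assms g by (intro emeasure_expo_cong) auto
  finally show ?thesis using assms emeasure_expo_greaterThan by simp
qed

text \<open>The inverse of the cumulative hazard \<open>hazard r\<close> below: along
  \<open>r + s\<close> the jump rate integrates to
  \<open>((r + s)\<^sup>2 - (max r 0)\<^sup>2) / 2\<close> once \<open>r + s\<close> is nonnegative,
  and setting this equal to an exponential variable \<open>e\<close> and solving for
  \<open>s\<close> gives the formula.\<close>

definition wait_time :: "real \<Rightarrow> real \<Rightarrow> real" where
  "wait_time r e = sqrt ((max r 0)\<^sup>2 + 2 * e) - r"

lemma measurable_wait_time [measurable (raw)]:
  assumes [measurable]: "f \<in> borel_measurable L" "g \<in> borel_measurable L"
  shows "(\<lambda>x. wait_time (f x) (g x)) \<in> borel_measurable L"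
  unfolding wait_time_def by measurable

lemma wait_time_pos: "0 < e \<Longrightarrow> 0 < wait_time r e"
proof -
  assume e: "0 < e"
  have "r \<le> max r 0" by simp
  also have "max r 0 = sqrt ((max r 0)\<^sup>2)" by simp
  also have "\<dots> < sqrt ((max r 0)\<^sup>2 + 2 * e)" using e by (intro real_sqrt_less_mono) simp
  finally show ?thesis by (simp add: wait_time_def)
qed

definition hazard :: "real \<Rightarrow> real \<Rightarrow> real" where
  "hazard r s = ((max (r + s) 0)\<^sup>2 - (max r 0)\<^sup>2) / 2"

text \<open>The squared positive part is differentiable at 0 as well, so the fundamental theorem of
  calculus applies to the rate without a case distinction at its kink.\<close>

lemma DERIV_max_power2: "((\<lambda>x::real. (max x 0)\<^sup>2) has_real_derivative 2 * max x 0) (at x)"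
proof -
  consider "0 < x" | "x < 0" | "x = 0" by linarith
  then show ?thesis
  proof cases
    case 1
    have "((\<lambda>x::real. x\<^sup>2) has_real_derivative 2 * max x 0) (at x)"
      using 1 by (auto intro!: derivative_eq_intros)
    moreover have "\<forall>\<^sub>F y in nhds x. y\<^sup>2 = (max y 0)\<^sup>2"
      using eventually_nhds_in_open[OF open_greaterThan[of 0], of x] 1
      by (auto elim!: eventually_mono)
    ultimately show ?thesis by (subst (asm) DERIV_cong_ev) auto
  next
    case 2
    have "((\<lambda>x::real. 0) has_real_derivative 2 * max x 0) (at x)"
      using 2 by auto
    moreover have "\<forall>\<^sub>F y in nhds x. 0 = (max y 0)\<^sup>2"
      using eventually_nhds_in_open[OF open_lessThan[of 0], of x] 2
      by (auto elim!: eventually_mono)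
    ultimately show ?thesis by (subst (asm) DERIV_cong_ev) auto
  next
    case 3
    have "((\<lambda>h::real. (max h 0)\<^sup>2 / h) \<longlongrightarrow> 0) (at 0)"
    proof (rule tendsto_0_le[where K = 1])
      show "((\<lambda>h::real. h) \<longlongrightarrow> 0) (at 0)" by (rule tendsto_ident_at)
    qed (auto simp: eventually_at_filter max_def power2_eq_square intro!: always_eventually)
    then show ?thesis using 3 by (simp add: DERIV_def)
  qed
qed

lemma DERIV_hazard: "(hazard r has_real_derivative max (r + s) 0) (at s)"
proof -
  have "((\<lambda>s. (max (r + s) 0)\<^sup>2) has_real_derivative 2 * max (r + s) 0 * 1) (at s)"
    by (rule DERIV_chain2[OF DERIV_max_power2]) (auto intro!: derivative_eq_intros)
  from DERIV_cdivide[OF DERIV_diff[OF this DERIV_const[of "(max r 0)\<^sup>2"]], of 2]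
  show ?thesis unfolding hazard_def by (simp add: fun_eq_iff)
qed

lemma hazard_nonneg: "0 \<le> s \<Longrightarrow> 0 \<le> hazard r s"
  unfolding hazard_def by (auto intro!: power_mono)

lemma integral_rate: "0 \<le> s \<Longrightarrow> (LINT u:{0..s}|lborel. max (r + u) 0) = hazard r s"
  unfolding set_lebesgue_integral_def
  using integral_FTC_Icc_nonneg[of "\<lambda>u. max (r + u) 0" 0 s "hazard r"] DERIV_hazard[of r]
  by (simp add: hazard_def mult.commute)

lemma measurable_hazard [measurable (raw)]:
  assumes [measurable]: "f \<in> borel_measurable L" "g \<in> borel_measurable L"
  shows "(\<lambda>x. hazard (f x) (g x)) \<in> borel_measurable L"
  unfolding hazard_def by measurable

lemma less_wait_time_iff:
  assumes "0 \<le> x" "0 < e"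
  shows "x < wait_time r e \<longleftrightarrow> hazard r x < e"
proof (cases "0 \<le> r + x")
  case True
  then have "x < wait_time r e \<longleftrightarrow> sqrt ((r + x)\<^sup>2) < sqrt ((max r 0)\<^sup>2 + 2 * e)"
    by (auto simp: wait_time_def)
  also have "\<dots> \<longleftrightarrow> hazard r x < e"
    using True unfolding real_sqrt_less_iff hazard_def by auto
  finally show ?thesis .
next
  case False
  \<comment> \<open>The rate vanishes up to time \<open>-r\<close>, so no hazard has accumulated by
    time \<open>x\<close> and the waiting time is still longer.\<close>
  then have "hazard r x = 0" using assms by (simp add: hazard_def)
  moreover have "0 \<le> sqrt ((max r 0)\<^sup>2 + 2 * e)" using assms by simp
  then have "x < wait_time r e" using False unfolding wait_time_def by linarith
  ultimately show ?thesis using assms by simp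
qed

lemma emeasure_wait_time_greaterThan:
  "0 \<le> x \<Longrightarrow> emeasure (distr expo borel (wait_time r)) {x<..} = ennreal (exp (- hazard r x))"
  using less_wait_time_iff hazard_nonneg by (intro emeasure_distr_expo) measurable

lemma hazard_at_top: "filterlim (hazard r) at_top at_top"
proof -
  have "filterlim (\<lambda>s. (r + s)\<^sup>2) at_top at_top"
    by (intro filterlim_pow_at_top filterlim_tendsto_add_at_top[OF tendsto_const] filterlim_ident) simp
  then have "filterlim (\<lambda>s. 1 / 2 * (- (max r 0)\<^sup>2 + (r + s)\<^sup>2)) at_top at_top"
    by (intro filterlim_tendsto_pos_mult_at_top[OF tendsto_const] filterlim_tendsto_add_at_top[OF tendsto_const]) auto
  moreover have "\<forall>\<^sub>F s in at_top. 1 / 2 * (- (max r 0)\<^sup>2 + (r + s)\<^sup>2) = hazard r s"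
    using eventually_ge_at_top[of "- r"] by eventually_elim (auto simp: hazard_def)
  ultimately show ?thesis by (rule filterlim_mono_eventually[OF _ order_refl order_refl])
qed

text \<open>Both sides have tail \<open>exp (- hazard r x)\<close> at \<open>x \<ge> 0\<close>: on
  the left by inverting the hazard, on the right because \<open>- exp (- hazard r x)\<close> is an
  antiderivative of the density that tends to 0, the total hazard being infinite.\<close>

lemma distr_wait_time:
  "distr expo borel (wait_time r) =
    density lborel (\<lambda>s. ennreal (max (r + s) 0 * exp (- hazard r s)) * indicator {0..} s)"
    (is "?L = ?R")
proof (rule measure_eqI_lessThan)
  interpret E: prob_space expo by (rule prob_space_expo)
  interpret L: prob_space ?L by (rule E.prob_space_distr) simp
  have R: "emeasure ?R {x<..} = ennreal (exp (- hazard r x))" if x: "0 \<le> x" for x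
  proof -
    have "emeasure ?R {x<..} = (\<integral>\<^sup>+s. (ennreal (max (r + s) 0 * exp (- hazard r s)) * indicator {0..} s) * indicator {x<..} s \<partial>lborel)"
      by (subst emeasure_density) auto
    also have "\<dots> = (\<integral>\<^sup>+s. ennreal (max (r + s) 0 * exp (- hazard r s)) * indicator {x..} s \<partial>lborel)"
      unfolding nn_integral_greaterThan_eq using x
      by (intro nn_integral_cong) (auto split: split_indicator)
    also have "\<dots> = 0 - (- exp (- hazard r x))"
    proof (rule nn_integral_FTC_atLeast)
      show "((\<lambda>x. - exp (- hazard r x)) \<longlongrightarrow> 0) at_top"
        using tendsto_minus[OF filterlim_compose[OF exp_at_bot
          filterlim_compose[OF filterlim_uminus_at_bot_at_top hazard_at_top[of r]]]] by simp
      show "((\<lambda>x. - exp (- hazard r x)) has_real_derivative max (r + y) 0 * exp (- hazard r y)) (at y)" for y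
        by (rule derivative_eq_intros DERIV_hazard refl)+ simp
    qed auto
    finally show ?thesis by simp
  qed
  fix x :: real
  have "emeasure ?L {x<..} = emeasure ?R {x<..}"
  proof (cases "0 \<le> x")
    case True
    then show ?thesis using R emeasure_wait_time_greaterThan by simp
  next
    case False
    have "emeasure ?R {x<..} = emeasure ?R {0<..}"
      unfolding emeasure_density[OF _, simplified] using False AE_lborel_singleton[of 0]
      by (subst (1 2) emeasure_density) (auto intro!: nn_integral_cong_AE elim!: eventually_mono split: split_indicator)
    also have "\<dots> = 1" using R[of 0] by (simp add: hazard_def)
    also have "1 = emeasure ?L {x<..}"
    proof -
      have "x < wait_time r e" if "0 < e" for e
        using wait_time_pos[OF that, of r] False by simp
      then have "emeasure expo (wait_time r -` {x<..}) = 1"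
        using measurable_sets_borel[of "wait_time r" borel "{x<..}"]
        by (intro emeasure_expo_full) auto
      then show ?thesis by (subst emeasure_distr) auto
    qed
    finally show ?thesis by simp
  qed
  then show "emeasure ?L {x<..} = emeasure ?R {x<..}" .
  show "emeasure ?L {x<..} < \<infinity>" using L.emeasure_finite[of "{x<..}"] by (simp add: less_top[symmetric])
qed simp_all

lemma nn_integral_wait_time:
  assumes [measurable]: "\<psi> \<in> borel_measurable borel"
  shows "(\<integral>\<^sup>+e. \<psi> (wait_time r e) \<partial>expo) =
    (\<integral>\<^sup>+s. ennreal (max (r + s) 0 * exp (- hazard r s)) * indicator {0..} s * \<psi> s \<partial>lborel)"
proof -
  have "(\<integral>\<^sup>+e. \<psi> (wait_time r e) \<partial>expo) = (\<integral>\<^sup>+s. \<psi> s \<partial>distr expo borel (wait_time r))"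
    by (subst nn_integral_distr) auto
  also have "\<dots> = (\<integral>\<^sup>+s. ennreal (max (r + s) 0 * exp (- hazard r s)) * indicator {0..} s * \<psi> s \<partial>lborel)"
    unfolding distr_wait_time by (subst nn_integral_density) auto
  finally show ?thesis .
qed

text \<open>The compensator formula for a single jump. By Fubini the indicator that the jump has not
  yet occurred at time \<open>s\<close> integrates to the survival probability
  \<open>exp (- hazard r s)\<close>, which together with the rate is the density of the waiting
  time.\<close>

lemma nn_integral_wait_time_hazard:
  assumes [measurable]: "\<psi> \<in> borel_measurable borel"
  shows "(\<integral>\<^sup>+e. \<psi> (wait_time r e) \<partial>expo) =
    (\<integral>\<^sup>+e. (\<integral>\<^sup>+s. ennreal (max (r + s) 0) * indicator {0..<wait_time r e} s * \<psi> s \<partial>lborel) \<partial>expo)"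
proof -
  interpret E: prob_space expo by (rule prob_space_expo)
  interpret P: pair_sigma_finite expo lborel ..
  have "(\<lambda>(e, s). (if 0 \<le> s \<and> s < wait_time r e then 1 else 0) :: ennreal) \<in> borel_measurable (expo \<Otimes>\<^sub>M lborel)"
    by measurable
  then have [measurable]: "(\<lambda>(e, s). indicator {0..<wait_time r e} s :: ennreal) \<in> borel_measurable (expo \<Otimes>\<^sub>M lborel)"
    by (rule measurable_cong[THEN iffD1, rotated]) (auto split: split_indicator)
  have "(\<integral>\<^sup>+e. (\<integral>\<^sup>+s. ennreal (max (r + s) 0) * indicator {0..<wait_time r e} s * \<psi> s \<partial>lborel) \<partial>expo)
      = (\<integral>\<^sup>+s. (\<integral>\<^sup>+e. ennreal (max (r + s) 0) * indicator {0..<wait_time r e} s * \<psi> s \<partial>expo) \<partial>lborel)"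
    by (rule P.Fubini'[symmetric]) (simp add: split_beta', measurable)
  also have "\<dots> = (\<integral>\<^sup>+s. ennreal (max (r + s) 0 * exp (- hazard r s)) * indicator {0..} s * \<psi> s \<partial>lborel)"
  proof (rule nn_integral_cong)
    fix s :: real
    have "(\<integral>\<^sup>+e. ennreal (max (r + s) 0) * indicator {0..<wait_time r e} s * \<psi> s \<partial>expo)
       = ennreal (max (r + s) 0) * \<psi> s * indicator {0..} s * (\<integral>\<^sup>+e. indicator {s<..} (wait_time r e) \<partial>expo)"
      by (subst nn_integral_cmult[symmetric]) (auto intro!: nn_integral_cong split: split_indicator)
    also have "(\<integral>\<^sup>+e. indicator {s<..} (wait_time r e) \<partial>expo) = emeasure (distr expo borel (wait_time r)) {s<..}"
      using nn_integral_distr[of "wait_time r" expo borel "indicator {s<..}"] by simp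
    also have "ennreal (max (r + s) 0) * \<psi> s * indicator {0..} s * emeasure (distr expo borel (wait_time r)) {s<..}
       = ennreal (max (r + s) 0 * exp (- hazard r s)) * indicator {0..} s * \<psi> s"
      by (auto simp: emeasure_wait_time_greaterThan ennreal_mult ac_simps split: split_indicator)
    finally show "(\<integral>\<^sup>+e. ennreal (max (r + s) 0) * indicator {0..<wait_time r e} s * \<psi> s \<partial>expo) = \<dots>" .
  qed
  finally show ?thesis unfolding nn_integral_wait_time[OF assms] by simp
qed

section \<open>Rayleigh and radial laws as images of the exponential law\<close>

lemma rayleigh_eq: "rayleigh = distr expo borel (\<lambda>e. sqrt (2 * e))"
proof -
  \<comment> \<open>With \<open>r = 0\<close> the rate at time \<open>s\<close> is \<open>s\<close>
    and the hazard is \<open>s\<^sup>2 / 2\<close>: a Rayleigh variable is a waiting time started at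
    0.\<close>
  have "distr expo borel (\<lambda>e. sqrt (2 * e)) = distr expo borel (wait_time 0)"
    by (intro distr_cong) (simp_all add: wait_time_def)
  also have "\<dots> = rayleigh"
    unfolding distr_wait_time rayleigh_def
    by (intro density_cong) (auto simp: hazard_def max_def split: split_indicator)
  finally show ?thesis by simp
qed

text \<open>The radial density has tail \<open>(1 - x\<^sup>2) powr ((d - 1) / 2)\<close> on the
  unit interval. Equating the tail with \<open>exp (- e)\<close> and solving for \<open>x\<close>
  gives this expression.\<close>

definition radial_quantile :: "nat \<Rightarrow> real \<Rightarrow> real" where
  "radial_quantile d e = sqrt (1 - exp (- (2 * e / (real d - 1))))"

lemma measurable_radial_quantile [measurable (raw)]:
  assumes [measurable]: "g \<in> borel_measurable L"
  shows "(\<lambda>x. radial_quantile d (g x)) \<in> borel_measurable L"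
  unfolding radial_quantile_def by measurable

lemma radial_quantile_bounds:
  assumes "2 \<le> d" "0 \<le> e" shows "0 \<le> radial_quantile d e" "radial_quantile d e < 1"
  using assms by (auto simp: radial_quantile_def real_sqrt_lt_1_iff)

lemma less_radial_quantile_iff:
  assumes d: "2 \<le> d" and x: "0 \<le> x" "x < 1" and e: "0 < e"
  shows "x < radial_quantile d e \<longleftrightarrow> - ((real d - 1) / 2 * ln (1 - x\<^sup>2)) < e"
proof -
  have pos: "0 < 1 - x\<^sup>2" using x by (simp add: abs_square_less_1)
  have d1: "0 < real d - 1" using d by simp
  have "x < radial_quantile d e \<longleftrightarrow> sqrt (x\<^sup>2) < sqrt (1 - exp (- (2 * e / (real d - 1))))"
    using x by (simp add: radial_quantile_def)
  also have "\<dots> \<longleftrightarrow> exp (- (2 * e / (real d - 1))) < 1 - x\<^sup>2"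
    unfolding real_sqrt_less_iff by auto
  also have "\<dots> \<longleftrightarrow> - (2 * e / (real d - 1)) < ln (1 - x\<^sup>2)"
    using pos by (metis exp_less_mono exp_ln exp_less_cancel_iff)
  also have "\<dots> \<longleftrightarrow> - ((real d - 1) / 2 * ln (1 - x\<^sup>2)) < e"
    using d1 by (auto simp: field_simps)
  finally show ?thesis .
qed

lemma radial_law_eq:
  assumes d: "2 \<le> d"
  shows "radial_law d = distr expo borel (radial_quantile d)" (is "?L = ?R")
proof (rule measure_eqI_lessThan)
  interpret E: prob_space expo by (rule prob_space_expo)
  interpret R: prob_space ?R by (rule E.prob_space_distr) simp
  define f where "f w = (real d - 1) * w * (1 - w\<^sup>2) powr ((real d - 3) / 2)" for w
  have [measurable]: "f \<in> borel_measurable borel" unfolding f_def by measurable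
  have d1: "0 < real d - 1" using d by simp
  have L: "emeasure ?L {x<..} = ennreal ((1 - x\<^sup>2) powr ((real d - 1) / 2))" if x: "0 \<le> x" "x < 1" for x
  proof -
    have fnn: "0 \<le> f w" if "x < w" for w using that x d1 by (simp add: f_def)
    have "emeasure ?L {x<..} = (\<integral>\<^sup>+w. ennreal (f w * indicator {0<..<1} w) * indicator {x<..} w \<partial>lborel)"
      unfolding radial_law_def f_def by (subst emeasure_density) auto
    also have "\<dots> = (\<integral>\<^sup>+w. ennreal (indicator {x<..<1} w *\<^sub>R f w) \<partial>lborel)"
      using x by (intro nn_integral_cong) (auto split: split_indicator)
    also have "\<dots> = ennreal ((1 - x\<^sup>2) powr ((real d - 1) / 2))"
    proof -
      \<comment> \<open>For \<open>d = 2\<close> the density is unbounded near 1, so the fundamental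
        theorem is used on the open interval, with one-sided limits of the antiderivative at both
        ends.\<close>
      define F where "F w = - ((1 - w\<^sup>2) powr ((real d - 1) / 2))" for w
      have pos: "0 < 1 - w\<^sup>2" if "x < w" "w < 1" for w
        using that x by (simp add: abs_square_less_1)
      have der: "(F has_real_derivative f w) (at w)" if "x < w" "w < 1" for w
      proof -
        have "((real d - 1) / 2) - 1 = (real d - 3) / 2" by (simp add: field_simps)
        then show ?thesis
          unfolding f_def F_def using pos[OF that]
          by (auto intro!: derivative_eq_intros simp: divide_simps powr_diff)
      qed
      have "(F \<longlongrightarrow> F x) (at_right x)"
        using x unfolding F_def by (intro tendsto_intros) (auto simp: power2_eq_1_iff)
      moreover have "(F \<longlongrightarrow> F 1) (at_left 1)"
      proof -
        have "\<forall>\<^sub>F w in at_left (1::real). 0 \<le> 1 - w\<^sup>2"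
          using eventually_at_left_real[OF x(2)] by (rule eventually_mono) (use pos in \<open>force intro: less_imp_le\<close>)
        then show ?thesis
          unfolding F_def using d1 by (intro tendsto_intros) auto
      qed
      ultimately have lim: "(F \<longlongrightarrow> F x) (at_right x)" "(F \<longlongrightarrow> F 1) (at_left 1)" by blast+
      have int: "set_integrable lborel (einterval (ereal x) (ereal 1)) f"
        "(LBINT x=ereal x..ereal 1. f x) = F 1 - F x"
      proof -
        note FTC = interval_integral_FTC_nonneg[of "ereal x" "ereal 1" F f "F x" "F 1"]
        have 1: "isCont f w" if "ereal x < ereal w" "ereal w < ereal 1" for w
          unfolding f_def using pos[of w] that by (intro continuous_intros) auto
        have 2: "((F \<circ> real_of_ereal) \<longlongrightarrow> F x) (at_right (ereal x))" "((F \<circ> real_of_ereal) \<longlongrightarrow> F 1) (at_left (ereal 1))"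
          using lim by (simp_all only: ereal_tendsto_simps1)
        show "set_integrable lborel (einterval (ereal x) (ereal 1)) f"
          "(LBINT x=ereal x..ereal 1. f x) = F 1 - F x"
          using FTC x der 1 2 fnn by auto
      qed
      have "(\<integral>w. indicator {x<..<1} w *\<^sub>R f w \<partial>lborel) = F 1 - F x"
        using int(2) x by (simp add: interval_lebesgue_integral_def set_lebesgue_integral_def)
      moreover have "(\<integral>\<^sup>+w. ennreal (indicator {x<..<1} w *\<^sub>R f w) \<partial>lborel) =
          ennreal (\<integral>w. indicator {x<..<1} w *\<^sub>R f w \<partial>lborel)"
        using int(1) fnn by (intro nn_integral_eq_integral)
          (auto simp: set_integrable_def split: split_indicator)
      ultimately show ?thesis by (simp add: F_def)
    qed
    finally show ?thesis .
  qed
  fix x :: real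
  consider "1 \<le> x" | "0 \<le> x" "x < 1" | "x < 0" by linarith
  then have "emeasure ?L {x<..} = emeasure ?R {x<..}"
  proof cases
    case 1
    have "radial_quantile d e \<le> x" if "0 < e" for e
      using radial_quantile_bounds(2)[OF d, of e] that 1 by simp
    then have "emeasure expo (radial_quantile d -` {x<..}) = emeasure expo {}"
      using measurable_sets_borel[of "radial_quantile d" borel "{x<..}"]
      by (intro emeasure_expo_cong) (auto simp: not_less)
    then have "emeasure ?R {x<..} = 0" by (subst emeasure_distr) auto
    moreover have "emeasure ?L {x<..} = (\<integral>\<^sup>+w. ennreal (f w * indicator {0<..<1} w) * indicator {x<..} w \<partial>lborel)"
      unfolding radial_law_def f_def by (subst emeasure_density) auto
    moreover have "\<dots> = (\<integral>\<^sup>+w. 0 \<partial>(lborel :: real measure))"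
      using 1 by (intro nn_integral_cong) (auto split: split_indicator)
    ultimately show ?thesis by simp
  next
    case 2
    have "0 < 1 - x\<^sup>2" "1 - x\<^sup>2 \<le> 1" using 2 by (simp_all add: abs_square_less_1)
    then have "ln (1 - x\<^sup>2) \<le> 0" by simp
    then have "0 \<le> - ((real d - 1) / 2 * ln (1 - x\<^sup>2))"
      using d1 by (simp add: mult_nonneg_nonpos)
    then have "emeasure ?R {x<..} = ennreal (exp (- (- ((real d - 1) / 2 * ln (1 - x\<^sup>2)))))"
      using less_radial_quantile_iff[OF d 2] by (intro emeasure_distr_expo) measurable
    then show ?thesis using L[OF 2] \<open>0 < 1 - x\<^sup>2\<close> by (simp add: powr_def)
  next
    case 3
    have "emeasure ?L {x<..} = emeasure ?L {0<..}"
      unfolding radial_law_def using 3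
      by (subst (1 2) emeasure_density) (auto intro!: nn_integral_cong split: split_indicator)
    also have "\<dots> = 1" using L[of 0] by simp
    also have "1 = emeasure ?R {x<..}"
    proof -
      have "x < radial_quantile d e" if "0 < e" for e
        using radial_quantile_bounds(1)[OF d, of e] that 3 by simp
      then have "emeasure expo (radial_quantile d -` {x<..}) = 1"
        using measurable_sets_borel[of "radial_quantile d" borel "{x<..}"]
        by (intro emeasure_expo_full) auto
      then show ?thesis by (subst emeasure_distr) auto
    qed
    finally show ?thesis .
  qed
  then show eq: "emeasure ?L {x<..} = emeasure ?R {x<..}" .
  show "emeasure ?L {x<..} < \<infinity>"
    unfolding eq using R.emeasure_finite[of "{x<..}"] by (simp add: less_top[symmetric])
qed (simp_all add: radial_law_def)

section \<open>Driving noise and Markov chains\<close>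

text \<open>Coordinate 0 is the initial value of the limit process. Step \<open>n\<close> of a
  driven chain uses coordinate \<open>2 * n + 1\<close> for the waiting time and
  \<open>2 * n + 2\<close> for the jump.\<close>

definition noise :: "(nat \<Rightarrow> real) measure" where
  "noise = PiM UNIV (\<lambda>i. if i = 0 then density lborel std_normal_density else expo)"

lemma product_prob_space_noise:
  "product_prob_space (\<lambda>i::nat. if i = 0 then density lborel std_normal_density else expo)"
  by (intro product_prob_spaceI) (auto intro: prob_space_expo prob_space_normal_density)

interpretation noise: product_prob_space "\<lambda>i::nat. if i = 0 then density lborel std_normal_density else expo" UNIV
  rewrites "PiM UNIV (\<lambda>i::nat. if i = 0 then density lborel std_normal_density else expo) = noise"
  by (rule product_prob_space_noise) (simp add: noise_def)

lemma sets_noise [measurable_cong]: "sets noise = sets (PiM UNIV (\<lambda>_. borel))"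
  unfolding noise_def by (intro sets_PiM_cong) auto

lemma space_noise [simp]: "space noise = UNIV"
  unfolding noise_def by (auto simp: space_PiM)

section \<open>Independence of past and fresh coordinates\<close>

definition splice_at :: "nat \<Rightarrow> (nat \<Rightarrow> 'a) \<Rightarrow> (nat \<Rightarrow> 'a) \<Rightarrow> nat \<Rightarrow> 'a" where
  "splice_at k \<omega> \<omega>' = (\<lambda>i. if i < k then \<omega> i else \<omega>' i)"

lemma measurable_splice_at [measurable]:
  "(\<lambda>(\<omega>, \<omega>'). splice_at k \<omega> \<omega>') \<in> noise \<Otimes>\<^sub>M noise \<rightarrow>\<^sub>M noise"
proof -
  have "(\<lambda>p i. if i < k then fst p i else snd p i) \<in> noise \<Otimes>\<^sub>M noise \<rightarrow>\<^sub>M PiM UNIV (\<lambda>_. borel)"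
    by (intro measurable_PiM_single') (auto simp: space_pair_measure)
  then show ?thesis
    unfolding splice_at_def split_beta' using sets_noise by (simp cong: measurable_cong_sets)
qed

text \<open>Resampling all coordinates from \<open>k\<close> on leaves the law unchanged: a cylinder
  splits into conditions on the coordinates below \<open>k\<close>, taken from one copy, and the
  remaining ones, taken from the other. This expresses the independence of past and future without
  splitting the infinite product.\<close>

lemma distr_splice_noise:
  "distr (noise \<Otimes>\<^sub>M noise) noise (\<lambda>(\<omega>, \<omega>'). splice_at k \<omega> \<omega>') = noise" (is "?D = _")
proof (rule noise.PiM_eq)
  let ?M = "\<lambda>i::nat. if i = 0 then density lborel std_normal_density else expo"
  show "sets ?D = sets noise" by simp
  interpret P: pair_prob_space noise noise ..
  fix J :: "nat set" and E assume J: "finite J" and E: "\<And>j. j \<in> J \<Longrightarrow> E j \<in> sets (?M j)"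
  have emb: "prod_emb UNIV ?M I (Pi\<^sub>E I E) = {\<omega>. \<forall>i\<in>I. \<omega> i \<in> E i}" for I
    by (auto simp: prod_emb_def PiE_iff space_PiM)
  have sets: "{\<omega>. \<forall>i\<in>I. \<omega> i \<in> E i} \<in> sets noise" if "I \<subseteq> J" for I
    unfolding emb[symmetric] noise_def using J that finite_subset[of I J]
    by (intro sets_PiM_I) (use E in blast)+
  have prod: "emeasure noise {\<omega>. \<forall>i\<in>I. \<omega> i \<in> E i} = (\<Prod>i\<in>I. emeasure (?M i) (E i))" if "I \<subseteq> J" for I
    unfolding emb[symmetric] using J E that finite_subset[of I J]
    by (intro noise.emeasure_PiM_emb) (use E in blast)+
  let ?A = "J \<inter> {..<k}" and ?B = "J - {..<k}"
  have "emeasure ?D {\<omega>. \<forall>i\<in>J. \<omega> i \<in> E i} =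
      emeasure (noise \<Otimes>\<^sub>M noise) ({\<omega>. \<forall>i\<in>?A. \<omega> i \<in> E i} \<times> {\<omega>. \<forall>i\<in>?B. \<omega> i \<in> E i})"
    using sets[of J]
    by (subst emeasure_distr) (auto intro!: arg_cong2[where f = emeasure] simp: splice_at_def space_pair_measure if_split_mem1)
  also have "\<dots> = (\<Prod>i\<in>?A. emeasure (?M i) (E i)) * (\<Prod>i\<in>?B. emeasure (?M i) (E i))"
    using sets prod by (subst noise.emeasure_pair_measure_Times) auto
  also have "\<dots> = (\<Prod>i\<in>J. emeasure (?M i) (E i))"
    using J by (subst prod.union_disjoint[symmetric]) (auto intro!: prod.cong)
  finally show "emeasure ?D (prod_emb UNIV ?M J (Pi\<^sub>E J E)) = (\<Prod>j\<in>J. emeasure (?M j) (E j))"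
    unfolding emb .
qed

lemma distr_noise_pair:
  assumes "1 \<le> k"
  shows "distr noise (borel \<Otimes>\<^sub>M borel) (\<lambda>\<omega>. (\<omega> k, \<omega> (Suc k))) = expo \<Otimes>\<^sub>M expo"
proof (rule pair_measure_eqI[symmetric])
  interpret E: prob_space expo by (rule prob_space_expo)
  show "sigma_finite_measure expo" "sigma_finite_measure expo" by unfold_locales
  fix A B assume AB: "A \<in> sets expo" "B \<in> sets expo"
  have "emeasure (distr noise (borel \<Otimes>\<^sub>M borel) (\<lambda>\<omega>. (\<omega> k, \<omega> (Suc k)))) (A \<times> B)
     = emeasure noise {\<omega>. \<forall>i\<in>{k, Suc k}. \<omega> i \<in> (if i = k then A else B)}"
    using AB by (subst emeasure_distr) (auto intro!: arg_cong2[where f = emeasure])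
  also have "\<dots> = emeasure noise (prod_emb UNIV (\<lambda>i::nat. if i = 0 then density lborel std_normal_density else expo)
      {k, Suc k} (\<Pi>\<^sub>E i\<in>{k, Suc k}. if i = k then A else B))"
    by (auto intro!: arg_cong2[where f = emeasure] simp: prod_emb_def PiE_iff space_PiM)
  also have "\<dots> = emeasure expo A * emeasure expo B"
    using AB assms by (subst noise.emeasure_PiM_emb) (auto split: if_splits)
  finally show "emeasure expo A * emeasure expo B = emeasure (distr noise (borel \<Otimes>\<^sub>M borel) (\<lambda>\<omega>. (\<omega> k, \<omega> (Suc k)))) (A \<times> B)" ..
qed (simp cong: sets_pair_measure_cong)

text \<open>After splicing, \<open>f\<close> reads its first argument from one copy of the noise,
  because it depends only on coordinates below \<open>k\<close>, and the pair at \<open>k\<close>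
  from an independent copy. Fubini then separates them. The bound \<open>1 \<le> k\<close> keeps the
  Gaussian coordinate out of the pair.\<close>

lemma nn_integral_noise_fresh:
  assumes f [measurable]: "(\<lambda>(\<omega>, p). f \<omega> p) \<in> borel_measurable (noise \<Otimes>\<^sub>M (borel \<Otimes>\<^sub>M borel))"
    and cong: "\<And>\<omega> \<omega>' p. (\<And>i. i < k \<Longrightarrow> \<omega> i = \<omega>' i) \<Longrightarrow> f \<omega> p = f \<omega>' p"
    and k: "1 \<le> k"
  shows "(\<integral>\<^sup>+\<omega>. f \<omega> (\<omega> k, \<omega> (Suc k)) \<partial>noise) = (\<integral>\<^sup>+\<omega>. (\<integral>\<^sup>+p. f \<omega> p \<partial>(expo \<Otimes>\<^sub>M expo)) \<partial>noise)"
proof -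
  interpret P: pair_prob_space noise noise ..
  have [measurable]: "(\<lambda>\<omega>. f \<omega> (\<omega> k, \<omega> (Suc k))) \<in> borel_measurable noise" by measurable
  have "(\<integral>\<^sup>+\<omega>. f \<omega> (\<omega> k, \<omega> (Suc k)) \<partial>noise)
     = (\<integral>\<^sup>+\<omega>. f \<omega> (\<omega> k, \<omega> (Suc k)) \<partial>distr (noise \<Otimes>\<^sub>M noise) noise (\<lambda>(\<omega>, \<omega>'). splice_at k \<omega> \<omega>'))"
    unfolding distr_splice_noise ..
  also have "\<dots> = (\<integral>\<^sup>+q. f (splice_at k (fst q) (snd q)) (splice_at k (fst q) (snd q) k, splice_at k (fst q) (snd q) (Suc k)) \<partial>(noise \<Otimes>\<^sub>M noise))"
    by (subst nn_integral_distr) (auto simp: split_beta')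
  also have "\<dots> = (\<integral>\<^sup>+q. f (fst q) (snd q k, snd q (Suc k)) \<partial>(noise \<Otimes>\<^sub>M noise))"
  proof (rule nn_integral_cong)
    fix q
    have "f (splice_at k (fst q) (snd q)) p = f (fst q) p" for p
      by (rule cong) (simp add: splice_at_def)
    then show "f (splice_at k (fst q) (snd q)) (splice_at k (fst q) (snd q) k, splice_at k (fst q) (snd q) (Suc k)) =
        f (fst q) (snd q k, snd q (Suc k))"
      by (simp add: splice_at_def)
  qed
  also have "\<dots> = (\<integral>\<^sup>+\<omega>. (\<integral>\<^sup>+\<omega>'. f \<omega> (\<omega>' k, \<omega>' (Suc k)) \<partial>noise) \<partial>noise)"
    by (subst noise.nn_integral_fst[symmetric]) auto
  also have "\<dots> = (\<integral>\<^sup>+\<omega>. (\<integral>\<^sup>+p. f \<omega> p \<partial>distr noise (borel \<Otimes>\<^sub>M borel) (\<lambda>\<omega>. (\<omega> k, \<omega> (Suc k)))) \<partial>noise)"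
    by (intro nn_integral_cong, subst nn_integral_distr) auto
  finally show ?thesis unfolding distr_noise_pair[OF k] .
qed

lemma AE_noise_pos: "AE \<omega> in noise. \<forall>i. 0 < \<omega> (Suc i)"
proof -
  have "AE \<omega> in noise. 0 < \<omega> (Suc i)" for i
    using noise.AE_component[of "Suc i" "\<lambda>x. 0 < x"] AE_expo by simp
  then show ?thesis by (simp add: AE_all_countable)
qed

text \<open>Prevents jump times from accumulating. That \<open>j\<close> consecutive waiting
  variables all stay below 1 has probability \<open>q ^ j\<close> with \<open>q < 1\<close>, for
  every \<open>j\<close>.\<close>

lemma AE_noise_large: "AE \<omega> in noise. \<forall>m. \<exists>n\<ge>m. 1 \<le> \<omega> (2 * n + 1)"
proof -
  interpret E: prob_space expo by (rule prob_space_expo)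
  define q where "q = measure expo {..<1}"
  have "0 < emeasure expo {1<..}" using emeasure_expo_greaterThan[of 1] by simp
  also have "\<dots> \<le> emeasure expo (- {..<1})" by (intro emeasure_mono) auto
  finally have "0 < measure expo (- {..<1})" by (simp add: E.emeasure_eq_measure)
  moreover have "measure expo (- {..<1}) = 1 - q"
    using E.prob_compl[of "{..<1}"] by (simp add: q_def Compl_eq_Diff_UNIV)
  ultimately have q: "q < 1" "0 \<le> q" by (auto simp: q_def)
  have "AE \<omega> in noise. \<exists>n\<ge>m. 1 \<le> \<omega> (2 * n + 1)" for m
  proof -
    define N where "N = {\<omega> :: nat \<Rightarrow> real. \<forall>n\<ge>m. \<omega> (2 * n + 1) < 1}"
    have [measurable]: "N \<in> sets noise"
    proof -
      have "{\<omega> \<in> space noise. \<forall>n\<in>{m..}. \<omega> (2 * n + 1) < 1} \<in> sets noise" by measurable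
      also have "{\<omega> \<in> space noise. \<forall>n\<in>{m..}. \<omega> (2 * n + 1) < 1} = N" by (auto simp: N_def)
      finally show ?thesis .
    qed
    have le: "measure noise N \<le> q ^ j" for j
    proof -
      let ?J = "(\<lambda>n. 2 * n + 1) ` {m..<m + j}"
      let ?E = "prod_emb UNIV (\<lambda>i::nat. if i = 0 then density lborel std_normal_density else expo)
          ?J (\<Pi>\<^sub>E i\<in>?J. {..<1})"
      have "?E \<in> sets noise" unfolding noise_def by (rule sets_PiM_I) auto
      moreover have "N \<subseteq> ?E" by (auto simp: N_def prod_emb_def PiE_iff space_PiM)
      ultimately have "measure noise N \<le> measure noise ?E" by (intro noise.P.finite_measure_mono)
      also have "\<dots> = (\<Prod>i\<in>?J. measure (if i = 0 then density lborel std_normal_density else expo) {..<1})"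
        by (rule noise.measure_PiM_emb) auto
      also have "\<dots> = (\<Prod>i\<in>?J. q)"
        by (rule prod.cong) (auto simp: q_def)
      also have "\<dots> = q ^ j" by (simp add: card_image inj_on_def)
      finally show ?thesis .
    qed
    have "measure noise N \<le> 0"
      by (rule LIMSEQ_le_const[OF LIMSEQ_power_zero[of q]]) (use le q in auto)
    then have "measure noise N = 0" by (simp add: measure_le_0_iff)
    then have "N \<in> null_sets noise" by (auto simp: noise.P.emeasure_eq_measure)
    from AE_not_in[OF this] show ?thesis
      by eventually_elim (auto simp: N_def not_less)
  qed
  then show ?thesis by (simp add: AE_all_countable)
qed

text \<open>The Markov property is tested on products of indicators of the history and a nonnegative
  function of the next state. In this form it follows both from the jump clause of
  \<open>pdmp\<close> and from fresh noise, and it is ready for induction over cylinders.\<close>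

definition markov_chain ::
  "'w measure \<Rightarrow> 's measure \<Rightarrow> 'e measure \<Rightarrow> ('s \<Rightarrow> 'e \<Rightarrow> 's) \<Rightarrow> (nat \<Rightarrow> 'w \<Rightarrow> 's) \<Rightarrow> bool" where
  "markov_chain M S \<mu> step Z \<longleftrightarrow> prob_space M \<and> (\<forall>n. Z n \<in> M \<rightarrow>\<^sub>M S) \<and>
     (\<forall>n A u. (\<forall>i\<le>n. A i \<in> sets S) \<and> u \<in> borel_measurable S \<longrightarrow>
       (\<integral>\<^sup>+\<omega>. (\<Prod>i\<le>n. indicator (A i) (Z i \<omega>)) * u (Z (Suc n) \<omega>) \<partial>M) =
       (\<integral>\<^sup>+\<omega>. (\<Prod>i\<le>n. indicator (A i) (Z i \<omega>)) * (\<integral>\<^sup>+p. u (step (Z n \<omega>) p) \<partial>\<mu>) \<partial>M))"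

lemma markov_chain_integral:
  assumes "markov_chain M S \<mu> step Z" "\<And>i. A i \<in> sets S" "u \<in> borel_measurable S"
  shows "(\<integral>\<^sup>+\<omega>. (\<Prod>i\<le>n. indicator (A i) (Z i \<omega>)) * u (Z (Suc n) \<omega>) \<partial>M) =
    (\<integral>\<^sup>+\<omega>. (\<Prod>i\<le>n. indicator (A i) (Z i \<omega>)) * (\<integral>\<^sup>+p. u (step (Z n \<omega>) p) \<partial>\<mu>) \<partial>M)"
  using assms unfolding markov_chain_def by blast

text \<open>This is what replaces a coupling: step function, noise law and initial law determine the
  law of the whole sequence. By induction on the length of the cylinder, the last state is
  integrated out and the test function is replaced by its image under the transition.\<close>

lemma markov_chain_law_eq:
  fixes S :: "'s measure" and \<mu> :: "'e measure"
  assumes Z: "markov_chain M S \<mu> step Z" and Z': "markov_chain M' S \<mu> step Z'"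
    and init: "distr M S (Z 0) = distr M' S (Z' 0)"
    and step [measurable]: "(\<lambda>(z, p). step z p) \<in> S \<Otimes>\<^sub>M \<mu> \<rightarrow>\<^sub>M S" and \<mu>: "sigma_finite_measure \<mu>"
  shows "distr M (PiM UNIV (\<lambda>_. S)) (\<lambda>\<omega> n. Z n \<omega>) = distr M' (PiM UNIV (\<lambda>_. S)) (\<lambda>\<omega> n. Z' n \<omega>)"
proof (rule measure_eqI_PiM_infinite)
  interpret \<mu>: sigma_finite_measure \<mu> by (rule \<mu>)
  interpret M: prob_space M using Z by (simp add: markov_chain_def)
  interpret M': prob_space M' using Z' by (simp add: markov_chain_def)
  have [measurable]: "Z n \<in> M \<rightarrow>\<^sub>M S" "Z' n \<in> M' \<rightarrow>\<^sub>M S" for n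
    using Z Z' by (simp_all add: markov_chain_def)
  have seq [measurable]: "(\<lambda>\<omega> n. Z n \<omega>) \<in> M \<rightarrow>\<^sub>M PiM UNIV (\<lambda>_. S)" "(\<lambda>\<omega> n. Z' n \<omega>) \<in> M' \<rightarrow>\<^sub>M PiM UNIV (\<lambda>_. S)"
    by (auto intro!: measurable_PiM_single' measurable_space[of "Z _"] measurable_space[of "Z' _"])
  have eq: "(\<integral>\<^sup>+\<omega>. (\<Prod>i\<le>n. indicator (A i) (Z i \<omega>)) * u (Z n \<omega>) \<partial>M) =
      (\<integral>\<^sup>+\<omega>. (\<Prod>i\<le>n. indicator (A i) (Z' i \<omega>)) * u (Z' n \<omega>) \<partial>M')"
    if A: "\<And>i. A i \<in> sets S" and u: "u \<in> borel_measurable S" for n A u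
    using u
  proof (induction n arbitrary: u)
    case 0
    note [measurable] = A 0
    have "(\<integral>\<^sup>+z. indicator (A 0) z * u z \<partial>distr M S (Z 0)) = (\<integral>\<^sup>+z. indicator (A 0) z * u z \<partial>distr M' S (Z' 0))"
      unfolding init ..
    then show ?case by (simp add: nn_integral_distr)
  next
    case (Suc n)
    note [measurable] = A Suc.prems
    \<comment> \<open>The indicator of the last coordinate is absorbed into the test function, so
      that the cylinder becomes one step shorter.\<close>
    let ?u = "\<lambda>z. indicator (A (Suc n)) z * u z"
    have m: "(\<lambda>z. \<integral>\<^sup>+p. ?u (step z p) \<partial>\<mu>) \<in> borel_measurable S" by measurable
    have "(\<integral>\<^sup>+\<omega>. (\<Prod>i\<le>Suc n. indicator (A i) (Z i \<omega>)) * u (Z (Suc n) \<omega>) \<partial>M)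
        = (\<integral>\<^sup>+\<omega>. (\<Prod>i\<le>n. indicator (A i) (Z i \<omega>)) * ?u (Z (Suc n) \<omega>) \<partial>M)"
      by (simp add: mult.assoc)
    also have "\<dots> = (\<integral>\<^sup>+\<omega>. (\<Prod>i\<le>n. indicator (A i) (Z i \<omega>)) * (\<integral>\<^sup>+p. ?u (step (Z n \<omega>) p) \<partial>\<mu>) \<partial>M)"
      by (rule markov_chain_integral[OF Z A]) measurable
    also have "\<dots> = (\<integral>\<^sup>+\<omega>. (\<Prod>i\<le>n. indicator (A i) (Z' i \<omega>)) * (\<integral>\<^sup>+p. ?u (step (Z' n \<omega>) p) \<partial>\<mu>) \<partial>M')"
      by (rule Suc.IH[OF m])
    also have "\<dots> = (\<integral>\<^sup>+\<omega>. (\<Prod>i\<le>n. indicator (A i) (Z' i \<omega>)) * ?u (Z' (Suc n) \<omega>) \<partial>M')"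
      by (rule markov_chain_integral[OF Z' A, symmetric]) measurable
    also have "\<dots> = (\<integral>\<^sup>+\<omega>. (\<Prod>i\<le>Suc n. indicator (A i) (Z' i \<omega>)) * u (Z' (Suc n) \<omega>) \<partial>M')"
      by (simp add: mult.assoc)
    finally show ?case .
  qed
  show "finite_measure (distr M (PiM UNIV (\<lambda>_. S)) (\<lambda>\<omega> n. Z n \<omega>))"
    by (intro prob_space.finite_measure M.prob_space_distr) simp
  fix A :: "nat \<Rightarrow> 's set" and J :: "nat set"
  assume J: "finite J" and A: "\<And>i. i \<in> J \<Longrightarrow> A i \<in> sets S"
  obtain n where n: "J \<subseteq> {..n}" using J by (meson finite_nat_iff_bounded_le)
  \<comment> \<open>Filling the coordinates outside \<open>J\<close> with the whole space turns the
    cylinder into a rectangle over an initial segment.\<close>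
  define B where "B i = (if i \<in> J then A i else space S)" for i
  have B: "B i \<in> sets S" for i using A by (auto simp: B_def)
  have rect: "emeasure (distr L (PiM UNIV (\<lambda>_. S)) (\<lambda>\<omega> n. W n \<omega>)) (prod_emb UNIV (\<lambda>_. S) J (Pi\<^sub>E J A)) =
      (\<integral>\<^sup>+\<omega>. (\<Prod>i\<le>n. indicator (B i) (W i \<omega>)) * 1 \<partial>L)"
    if W [measurable]: "\<And>n. W n \<in> L \<rightarrow>\<^sub>M S" for L :: "'z measure" and W
  proof -
    have seq [measurable]: "(\<lambda>\<omega> n. W n \<omega>) \<in> L \<rightarrow>\<^sub>M PiM UNIV (\<lambda>_. S)"
      by (auto intro!: measurable_PiM_single' dest: measurable_space[OF W])
    have emb: "prod_emb UNIV (\<lambda>_. S) J (Pi\<^sub>E J A) \<in> sets (PiM UNIV (\<lambda>_. S))"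
      using J A by (intro sets_PiM_I) auto
    have "emeasure (distr L (PiM UNIV (\<lambda>_. S)) (\<lambda>\<omega> n. W n \<omega>)) (prod_emb UNIV (\<lambda>_. S) J (Pi\<^sub>E J A)) =
        emeasure L ((\<lambda>\<omega> n. W n \<omega>) -` prod_emb UNIV (\<lambda>_. S) J (Pi\<^sub>E J A) \<inter> space L)"
      using emb by (subst emeasure_distr) auto
    also have "\<dots> = (\<integral>\<^sup>+\<omega>. indicator ((\<lambda>\<omega> n. W n \<omega>) -` prod_emb UNIV (\<lambda>_. S) J (Pi\<^sub>E J A) \<inter> space L) \<omega> \<partial>L)"
      using measurable_sets[OF seq emb] by simp
    also have "\<dots> = (\<integral>\<^sup>+\<omega>. (\<Prod>i\<le>n. indicator (B i) (W i \<omega>)) * 1 \<partial>L)"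
    proof (rule nn_integral_cong)
      fix \<omega> assume \<omega>: "\<omega> \<in> space L"
      then have W': "W i \<omega> \<in> space S" for i using W by (rule measurable_space[rotated])
      have "(\<Prod>i\<le>n. indicator (B i) (W i \<omega>) :: ennreal) = (if \<forall>i\<le>n. W i \<omega> \<in> B i then 1 else 0)"
        by (auto intro!: prod.neutral simp: indicator_def)
      also have "(\<forall>i\<le>n. W i \<omega> \<in> B i) \<longleftrightarrow> (\<forall>i\<in>J. W i \<omega> \<in> A i)"
        using n W' by (auto simp: B_def)
      also have "\<dots> \<longleftrightarrow> (\<lambda>n. W n \<omega>) \<in> prod_emb UNIV (\<lambda>_. S) J (Pi\<^sub>E J A)"
        using W' by (auto simp: prod_emb_def PiE_iff)
      finally show "indicator ((\<lambda>\<omega> n. W n \<omega>) -` prod_emb UNIV (\<lambda>_. S) J (Pi\<^sub>E J A) \<inter> space L) \<omega> =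
          (\<Prod>i\<le>n. indicator (B i) (W i \<omega>)) * (1 :: ennreal)"
        using \<omega> by (simp add: indicator_def)
    qed
    finally show ?thesis .
  qed
  show "emeasure (distr M (PiM UNIV (\<lambda>_. S)) (\<lambda>\<omega> n. Z n \<omega>)) (prod_emb UNIV (\<lambda>_. S) J (Pi\<^sub>E J A)) =
      emeasure (distr M' (PiM UNIV (\<lambda>_. S)) (\<lambda>\<omega> n. Z' n \<omega>)) (prod_emb UNIV (\<lambda>_. S) J (Pi\<^sub>E J A))"
    using eq[of B "\<lambda>_. 1" n] B by (simp add: rect)
qed simp_all

abbreviation "chain_space \<equiv> (borel :: real measure) \<Otimes>\<^sub>M ((borel :: real measure) \<Otimes>\<^sub>M (borel :: real measure))"

section \<open>The driven chain\<close>

text \<open>A state consists of the last waiting time, the value of the process after the jump and the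
  squared radius divided by the dimension.\<close>

definition chain_step :: "(real \<Rightarrow> real) \<Rightarrow> real \<Rightarrow> real \<times> real \<times> real \<Rightarrow> real \<times> real \<Rightarrow> real \<times> real \<times> real" where
  "chain_step \<theta> \<epsilon> z p = (let s = wait_time (fst (snd z)) (fst p);
     a = snd (snd z) + \<epsilon> * (2 * fst (snd z) * s + s\<^sup>2)
   in (s, - (\<theta> (snd p) * sqrt (max a 0)), a))"

text \<open>One recursion serves for all processes: \<open>radial_scale d\<close> with
  \<open>\<epsilon> = 1 / real d\<close> in dimension \<open>d\<close>, and
  \<open>rayleigh_quantile\<close> with \<open>\<epsilon> = 0\<close> in the limit, where the third
  component stays constant.\<close>

primrec chain :: "(real \<Rightarrow> real) \<Rightarrow> real \<Rightarrow> real \<times> real \<times> real \<Rightarrow> (nat \<Rightarrow> real) \<Rightarrow> nat \<Rightarrow> real \<times> real \<times> real" where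
  "chain \<theta> \<epsilon> z \<omega> 0 = z"
| "chain \<theta> \<epsilon> z \<omega> (Suc n) = chain_step \<theta> \<epsilon> (chain \<theta> \<epsilon> z \<omega> n) (\<omega> (2 * n + 1), \<omega> (Suc (2 * n + 1)))"

lemma measurable_chain_step [measurable (raw)]:
  assumes [measurable]: "\<theta> \<in> borel_measurable borel" "f \<in> L \<rightarrow>\<^sub>M chain_space" "g \<in> L \<rightarrow>\<^sub>M borel \<Otimes>\<^sub>M borel"
  shows "(\<lambda>x. chain_step \<theta> \<epsilon> (f x) (g x)) \<in> L \<rightarrow>\<^sub>M chain_space"
  unfolding chain_step_def Let_def by measurable

lemma measurable_noise_component [measurable]: "(\<lambda>\<omega>. \<omega> i) \<in> borel_measurable noise"
  by measurable

lemma measurable_chain [measurable (raw)]: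
  assumes [measurable]: "\<theta> \<in> borel_measurable borel" "f \<in> L \<rightarrow>\<^sub>M chain_space" "g \<in> L \<rightarrow>\<^sub>M noise"
  shows "(\<lambda>x. chain \<theta> \<epsilon> (f x) (g x) n) \<in> L \<rightarrow>\<^sub>M chain_space"
proof -
  have [measurable]: "(\<lambda>x. g x i) \<in> borel_measurable L" for i
    by (rule measurable_compose[OF assms(3) measurable_noise_component])
  show ?thesis by (induction n) simp_all
qed

lemma chain_cong:
  "(\<And>i. 0 < i \<Longrightarrow> i < 2 * n + 1 \<Longrightarrow> \<omega> i = \<omega>' i) \<Longrightarrow> chain \<theta> \<epsilon> z \<omega> n = chain \<theta> \<epsilon> z \<omega>' n"
  by (induction n) simp_all

text \<open>The first \<open>n\<close> steps use no coordinate beyond \<open>2 * n\<close>, so the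
  two coordinates driving the next step are fresh.\<close>

lemma nn_integral_chain_step:
  fixes \<epsilon> :: real
  assumes [measurable]: "\<theta> \<in> borel_measurable borel" and g [measurable]: "g \<in> borel \<rightarrow>\<^sub>M chain_space"
    and A [measurable]: "\<And>i. A i \<in> sets chain_space" and u [measurable]: "u \<in> borel_measurable chain_space"
  defines "Z \<equiv> \<lambda>n \<omega>. chain \<theta> \<epsilon> (g (\<omega> 0)) \<omega> n"
  shows "(\<integral>\<^sup>+\<omega>. (\<Prod>i\<le>n. indicator (A i) (Z i \<omega>)) * u (Z (Suc n) \<omega>) \<partial>noise) =
    (\<integral>\<^sup>+\<omega>. (\<Prod>i\<le>n. indicator (A i) (Z i \<omega>)) * (\<integral>\<^sup>+p. u (chain_step \<theta> \<epsilon> (Z n \<omega>) p) \<partial>(expo \<Otimes>\<^sub>M expo)) \<partial>noise)"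
proof -
  let ?f = "\<lambda>\<omega> p. (\<Prod>i\<le>n. indicator (A i) (Z i \<omega>)) * u (chain_step \<theta> \<epsilon> (Z n \<omega>) p)"
  have Z [measurable]: "(\<lambda>x. Z i (f x)) \<in> L \<rightarrow>\<^sub>M chain_space" if f [measurable]: "f \<in> L \<rightarrow>\<^sub>M noise" for i f L
  proof -
    have [measurable]: "(\<lambda>x. f x 0) \<in> borel_measurable L"
      by (rule measurable_compose[OF f measurable_noise_component])
    show ?thesis unfolding Z_def by measurable
  qed
  have "(\<integral>\<^sup>+\<omega>. (\<Prod>i\<le>n. indicator (A i) (Z i \<omega>)) * u (Z (Suc n) \<omega>) \<partial>noise)
      = (\<integral>\<^sup>+\<omega>. ?f \<omega> (\<omega> (2 * n + 1), \<omega> (Suc (2 * n + 1))) \<partial>noise)"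
    by (simp add: Z_def)
  also have "\<dots> = (\<integral>\<^sup>+\<omega>. (\<integral>\<^sup>+p. ?f \<omega> p \<partial>(expo \<Otimes>\<^sub>M expo)) \<partial>noise)"
  proof (rule nn_integral_noise_fresh)
    fix \<omega> \<omega>' :: "nat \<Rightarrow> real" and p assume *: "\<And>i. i < 2 * n + 1 \<Longrightarrow> \<omega> i = \<omega>' i"
    have "chain \<theta> \<epsilon> z \<omega> i = chain \<theta> \<epsilon> z \<omega>' i" if "i \<le> n" for i z
      by (rule chain_cong) (use * that in auto)
    then have "Z i \<omega> = Z i \<omega>'" if "i \<le> n" for i using *[of 0] that by (simp add: Z_def)
    then show "?f \<omega> p = ?f \<omega>' p" by simp
  qed simp_all
  also have "\<dots> = (\<integral>\<^sup>+\<omega>. (\<Prod>i\<le>n. indicator (A i) (Z i \<omega>)) * (\<integral>\<^sup>+p. u (chain_step \<theta> \<epsilon> (Z n \<omega>) p) \<partial>(expo \<Otimes>\<^sub>M expo)) \<partial>noise)"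
    by (intro nn_integral_cong nn_integral_cmult) simp
  finally show ?thesis .
qed

lemma markov_chain_noise:
  assumes [measurable]: "\<theta> \<in> borel_measurable borel" "g \<in> borel \<rightarrow>\<^sub>M chain_space"
  shows "markov_chain noise chain_space (expo \<Otimes>\<^sub>M expo) (chain_step \<theta> \<epsilon>) (\<lambda>n \<omega>. chain \<theta> \<epsilon> (g (\<omega> 0)) \<omega> n)"
  unfolding markov_chain_def
proof (intro conjI allI impI, goal_cases)
  case (3 n A u)
  \<comment> \<open>Nothing is known about \<open>A i\<close> beyond \<open>n\<close>. The
    replacement makes every member of the family measurable and leaves the product
    unchanged.\<close>
  define B where "B i = (if i \<le> n then A i else {})" for i
  have "B i \<in> sets chain_space" for i using 3 by (auto simp: B_def)
  then have "(\<integral>\<^sup>+\<omega>. (\<Prod>i\<le>n. indicator (B i) (chain \<theta> \<epsilon> (g (\<omega> 0)) \<omega> i)) * u (chain \<theta> \<epsilon> (g (\<omega> 0)) \<omega> (Suc n)) \<partial>noise) =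
    (\<integral>\<^sup>+\<omega>. (\<Prod>i\<le>n. indicator (B i) (chain \<theta> \<epsilon> (g (\<omega> 0)) \<omega> i)) *
      (\<integral>\<^sup>+p. u (chain_step \<theta> \<epsilon> (chain \<theta> \<epsilon> (g (\<omega> 0)) \<omega> n) p) \<partial>(expo \<Otimes>\<^sub>M expo)) \<partial>noise)"
    using 3 by (intro nn_integral_chain_step assms) auto
  then show ?case by (simp add: B_def del: chain.simps)
qed (auto intro: noise.P.prob_space_axioms)

text \<open>For each fixed initial state this is the one-step identity for the noise; integrating it
  over an independent initial state gives the chain with initial law
  \<open>\<Lambda>\<close>.\<close>

lemma markov_chain_pair_noise:
  assumes [measurable]: "\<theta> \<in> borel_measurable borel"
    and law: "prob_space \<Lambda>" "sets \<Lambda> = sets chain_space"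
  shows "markov_chain (\<Lambda> \<Otimes>\<^sub>M noise) chain_space (expo \<Otimes>\<^sub>M expo) (chain_step \<theta> \<epsilon>) (\<lambda>n p. chain \<theta> \<epsilon> (fst p) (snd p) n)"
  unfolding markov_chain_def
proof (intro conjI allI impI, goal_cases)
  interpret L: prob_space \<Lambda> by fact
  interpret P: pair_prob_space \<Lambda> noise ..
  note [measurable_cong] = law(2)
  {
    case 1 show ?case by unfold_locales
  next
    case 2 show ?case by measurable
  next
    case (3 n A u)
    interpret E: prob_space expo by (rule prob_space_expo)
    interpret EE: pair_prob_space expo expo ..
    define B where "B i = (if i \<le> n then A i else {})" for i
    have B [measurable]: "B i \<in> sets chain_space" for i using 3 by (auto simp: B_def)
    have [measurable]: "u \<in> borel_measurable chain_space" using 3 by simp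
    have [measurable]: "(\<lambda>z. \<integral>\<^sup>+p. u (chain_step \<theta> \<epsilon> z p) \<partial>(expo \<Otimes>\<^sub>M expo)) \<in> borel_measurable chain_space"
      by measurable
    have "(\<integral>\<^sup>+\<omega>. (\<Prod>i\<le>n. indicator (B i) (chain \<theta> \<epsilon> (fst \<omega>) (snd \<omega>) i)) * u (chain \<theta> \<epsilon> (fst \<omega>) (snd \<omega>) (Suc n)) \<partial>(\<Lambda> \<Otimes>\<^sub>M noise)) =
      (\<integral>\<^sup>+z. (\<integral>\<^sup>+\<omega>. (\<Prod>i\<le>n. indicator (B i) (chain \<theta> \<epsilon> z \<omega> i)) * u (chain \<theta> \<epsilon> z \<omega> (Suc n)) \<partial>noise) \<partial>\<Lambda>)"
      by (subst noise.nn_integral_fst[symmetric]) (simp_all del: chain.simps)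
    also have "\<dots> = (\<integral>\<^sup>+z. (\<integral>\<^sup>+\<omega>. (\<Prod>i\<le>n. indicator (B i) (chain \<theta> \<epsilon> z \<omega> i)) *
        (\<integral>\<^sup>+p. u (chain_step \<theta> \<epsilon> (chain \<theta> \<epsilon> z \<omega> n) p) \<partial>(expo \<Otimes>\<^sub>M expo)) \<partial>noise) \<partial>\<Lambda>)"
    proof (rule nn_integral_cong)
      fix z
      show "(\<integral>\<^sup>+\<omega>. (\<Prod>i\<le>n. indicator (B i) (chain \<theta> \<epsilon> z \<omega> i)) * u (chain \<theta> \<epsilon> z \<omega> (Suc n)) \<partial>noise) =
        (\<integral>\<^sup>+\<omega>. (\<Prod>i\<le>n. indicator (B i) (chain \<theta> \<epsilon> z \<omega> i)) *
          (\<integral>\<^sup>+p. u (chain_step \<theta> \<epsilon> (chain \<theta> \<epsilon> z \<omega> n) p) \<partial>(expo \<Otimes>\<^sub>M expo)) \<partial>noise)"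
        by (rule nn_integral_chain_step[where g = "\<lambda>_. z"]) (auto simp: space_pair_measure)
    qed
    also have "\<dots> = (\<integral>\<^sup>+\<omega>. (\<Prod>i\<le>n. indicator (B i) (chain \<theta> \<epsilon> (fst \<omega>) (snd \<omega>) i)) *
        (\<integral>\<^sup>+p. u (chain_step \<theta> \<epsilon> (chain \<theta> \<epsilon> (fst \<omega>) (snd \<omega>) n) p) \<partial>(expo \<Otimes>\<^sub>M expo)) \<partial>(\<Lambda> \<Otimes>\<^sub>M noise))"
      by (subst noise.nn_integral_fst[symmetric]) (simp_all del: chain.simps)
    finally show ?case by (simp add: B_def del: chain.simps)
  }
qed

text \<open>The waiting time before a jump is stored in the state after it, hence the shift of the
  summation index.\<close>

definition chain_data :: "(nat \<Rightarrow> real \<times> real \<times> real) \<Rightarrow> nat \<Rightarrow> real \<times> real" where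
  "chain_data z n = (\<Sum>i<n. fst (z (Suc i)), fst (snd (z n)))"

lemma measurable_chain_data [measurable]:
  "chain_data \<in> PiM UNIV (\<lambda>_. chain_space) \<rightarrow>\<^sub>M PiM UNIV (\<lambda>_. borel)"
proof -
  have "(\<lambda>z n. (\<Sum>i<n. fst (z (Suc i)), fst (snd (z n)))) \<in> PiM UNIV (\<lambda>_. chain_space) \<rightarrow>\<^sub>M PiM UNIV (\<lambda>_. borel \<Otimes>\<^sub>M borel)"
    by (intro measurable_PiM_single') (auto simp: space_pair_measure)
  then show ?thesis by (simp add: borel_prod chain_data_def[abs_def])
qed

definition good_noise :: "(nat \<Rightarrow> real) set" where
  "good_noise = {\<omega>. (\<forall>i. 0 < \<omega> (Suc i)) \<and> (\<forall>m. \<exists>n\<ge>m. 1 \<le> \<omega> (2 * n + 1))}"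

lemma AE_good_noise: "AE \<omega> in noise. \<omega> \<in> good_noise"
  using AE_noise_pos AE_noise_large by eventually_elim (simp add: good_noise_def)

lemma chain_nonpos:
  assumes "\<omega> \<in> good_noise" "\<And>e. 0 < e \<Longrightarrow> 0 \<le> \<theta> e"
  shows "fst (snd (chain \<theta> \<epsilon> z \<omega> (Suc n))) \<le> 0"
  using assms by (simp add: chain_step_def Let_def good_noise_def)

text \<open>Values after a jump are nonpositive, so the next waiting time is at least
  \<open>sqrt (2 * e)\<close>, hence at least 1 whenever the exponential variable \<open>e\<close>
  is. On good noise this happens infinitely often, whatever the jump sizes are.\<close>

lemma chain_data_jump_data:
  assumes \<omega>: "\<omega> \<in> good_noise" and \<theta>: "\<And>e. 0 < e \<Longrightarrow> 0 \<le> \<theta> e"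
  shows "chain_data (chain \<theta> \<epsilon> z \<omega>) \<in> jump_data"
proof -
  define T where "T n = (\<Sum>i<n. fst (chain \<theta> \<epsilon> z \<omega> (Suc i)))" for n
  have wait: "fst (chain \<theta> \<epsilon> z \<omega> (Suc n)) = wait_time (fst (snd (chain \<theta> \<epsilon> z \<omega> n))) (\<omega> (2 * n + 1))" for n
    by (simp add: chain_step_def Let_def)
  have inc: "T n < T (Suc n)" for n
  proof -
    have "0 < \<omega> (2 * n + 1)" using \<omega> by (simp add: good_noise_def)
    from wait_time_pos[OF this] have "0 < fst (chain \<theta> \<epsilon> z \<omega> (Suc n))" unfolding wait .
    then show ?thesis by (simp add: T_def del: chain.simps)
  qed
  then have mono: "T m \<le> T n" if "m \<le> n" for m n
    by (rule lift_Suc_mono_le[OF less_imp_le that])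
  have "\<exists>n. real m \<le> T n" for m :: nat
  proof (induction m)
    case 0
    then show ?case by (auto simp: T_def intro: exI[of _ 0])
  next
    case (Suc m)
    then obtain n where n: "real m \<le> T n" by blast
    \<comment> \<open>The index has to be at least 1: the initial value may be positive, and only
      later values are known to be nonpositive.\<close>
    obtain k where k: "Suc n \<le> k" "1 \<le> \<omega> (2 * k + 1)" using \<omega> by (auto simp: good_noise_def)
    then obtain l where l: "k = Suc l" by (cases k) auto
    have "1 \<le> sqrt (2 * \<omega> (2 * k + 1))" using k by (intro real_le_rsqrt) simp
    also have "\<dots> \<le> fst (chain \<theta> \<epsilon> z \<omega> (Suc k))"
      unfolding wait using chain_nonpos[OF \<omega>, of \<theta> \<epsilon> z l] \<theta> by (simp add: wait_time_def l del: chain.simps)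
    finally have "1 + T k \<le> T (Suc k)" by (simp add: T_def del: chain.simps)
    then show ?case using n mono[of n k] k by (intro exI[of _ "Suc k"]) simp
  qed
  then show ?thesis using inc by (auto simp: jump_data_iff chain_data_def T_def simp del: chain.simps)
qed

lemma tendsto_chain:
  assumes \<theta>: "\<And>e. 0 < e \<Longrightarrow> (\<lambda>j. \<theta> j e) \<longlonglongrightarrow> \<theta>' e" and \<epsilon>: "\<epsilon> \<longlonglongrightarrow> \<epsilon>'" and z: "z \<longlonglongrightarrow> z'"
    and \<omega>: "\<And>i. 0 < \<omega> (Suc i)"
  shows "(\<lambda>j. chain (\<theta> j) (\<epsilon> j) (z j) \<omega> n) \<longlonglongrightarrow> chain \<theta>' \<epsilon>' z' \<omega> n"
proof (induction n)
  case (Suc n)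
  have \<theta>': "(\<lambda>j. \<theta> j (\<omega> (Suc (2 * n + 1)))) \<longlonglongrightarrow> \<theta>' (\<omega> (Suc (2 * n + 1)))"
    by (rule \<theta>[OF \<omega>])
  show ?case
    unfolding chain.simps chain_step_def Let_def wait_time_def fst_conv snd_conv
    by (intro tendsto_intros tendsto_max Suc.IH \<theta>' \<epsilon>)
qed (simp add: z)

lemma tendsto_chain_data:
  assumes "\<And>n. (\<lambda>j. z j n) \<longlonglongrightarrow> z' n"
  shows "(\<lambda>j. chain_data (z j) n) \<longlonglongrightarrow> chain_data z' n"
  unfolding chain_data_def by (intro tendsto_intros assms)

text \<open>The factor \<open>sqrt (real d)\<close> comes from the normalisation of the third
  component of the chain: the norm of \<open>x\<close> is this factor times the root of the squared
  norm divided by \<open>d\<close>.\<close>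

definition radial_scale :: "nat \<Rightarrow> real \<Rightarrow> real" where
  "radial_scale d e = sqrt (real d) * radial_quantile d e"

definition rayleigh_quantile :: "real \<Rightarrow> real" where
  "rayleigh_quantile e = sqrt (2 * e)"

text \<open>The square is \<open>d * (1 - exp h)\<close> with \<open>h = - 2 * e / (d - 1)\<close>.
  The difference quotient of \<open>exp\<close> at 0 and
  \<open>d / (d - 1) = 1 + 1 / (d - 1)\<close> give the limit \<open>2 * e\<close>.\<close>

lemma radial_scale_tendsto:
  assumes e: "0 < e"
  shows "(\<lambda>d. radial_scale d e) \<longlonglongrightarrow> rayleigh_quantile e"
proof -
  define h where "h d = - (2 * e / (real d - 1))" for d
  have d1: "filterlim (\<lambda>d. real d - 1) at_top sequentially"
    using filterlim_tendsto_add_at_top[OF tendsto_const[of "- 1"] filterlim_real_sequentially] by simp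
  have h0: "h \<longlonglongrightarrow> 0"
    unfolding h_def using tendsto_minus[OF tendsto_divide_0[OF tendsto_const filterlim_at_top_imp_at_infinity[OF d1]], of "2 * e"] by simp
  have hn: "\<forall>\<^sub>F d in sequentially. h d \<noteq> 0"
    using eventually_gt_at_top[of 1] by eventually_elim (use e in \<open>simp add: h_def\<close>)
  have "((\<lambda>h. (exp h - 1) / h) \<longlongrightarrow> (1::real)) (at 0)"
    using DERIV_exp[of 0] by (simp add: DERIV_def)
  moreover have "filterlim h (at 0) sequentially"
    using h0 hn by (simp add: filterlim_at)
  ultimately have 1: "(\<lambda>d. (exp (h d) - 1) / h d) \<longlonglongrightarrow> 1" by (rule filterlim_compose)
  have "(\<lambda>d. 1 + 1 / (real d - 1)) \<longlonglongrightarrow> 1 + 0"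
    by (intro tendsto_add tendsto_const tendsto_divide_0[OF tendsto_const filterlim_at_top_imp_at_infinity[OF d1]])
  then have 2: "(\<lambda>d. 2 * e * (1 + 1 / (real d - 1)) * ((exp (h d) - 1) / h d)) \<longlonglongrightarrow> 2 * e * (1 + 0) * 1"
    using 1 by (intro tendsto_mult tendsto_const) auto
  have "(\<lambda>d. sqrt (2 * e * (1 + 1 / (real d - 1)) * ((exp (h d) - 1) / h d))) \<longlonglongrightarrow> sqrt (2 * e)"
    using tendsto_real_sqrt[OF 2] by simp
  moreover have "\<forall>\<^sub>F d in sequentially. sqrt (2 * e * (1 + 1 / (real d - 1)) * ((exp (h d) - 1) / h d)) = radial_scale d e"
    using eventually_gt_at_top[of 1]
  proof eventually_elim
    case (elim d)
    have "2 * e * (1 + 1 / (real d - 1)) * ((exp (h d) - 1) / h d) = real d * (1 - exp (h d))"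
      using elim e unfolding h_def by (simp add: field_simps)
    then show ?case by (simp add: radial_scale_def radial_quantile_def h_def real_sqrt_mult)
  qed
  ultimately show ?thesis
    unfolding rayleigh_quantile_def by (rule Lim_transform_eventually)
qed

text \<open>Stated for every \<open>d\<close>, since the limit lemmas below ask for it along whole
  sequences: for \<open>d = 0\<close> the first factor vanishes, and for \<open>d = 1\<close>
  division by zero makes the quantile 0.\<close>

lemma radial_scale_nonneg: "0 < e \<Longrightarrow> 0 \<le> radial_scale d e"
  unfolding radial_scale_def radial_quantile_def
  by (cases "d = 0") (auto intro!: mult_nonneg_nonneg simp: field_simps)

lemma rayleigh_quantile_nonneg: "0 < e \<Longrightarrow> 0 \<le> rayleigh_quantile e"
  by (simp add: rayleigh_quantile_def)

lemma measurable_radial_scale [measurable]: "radial_scale d \<in> borel_measurable borel"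
  unfolding radial_scale_def by measurable

lemma measurable_rayleigh_quantile [measurable]: "rayleigh_quantile \<in> borel_measurable borel"
  unfolding rayleigh_quantile_def by measurable

section \<open>The jump chain of the FECMC process\<close>

text \<open>The jump clause of \<open>pdmp\<close> describes the joint law of waiting time and next
  state only on sets \<open>{..t} \<times> C\<close>. These are stable under intersection and
  generate the product sigma-algebra.\<close>

lemma measure_eqI_atMost_times:
  fixes M N :: "(real \<times> 'b) measure" and S :: "'b measure"
  assumes sets: "sets M = sets (borel \<Otimes>\<^sub>M S)" "sets N = sets (borel \<Otimes>\<^sub>M S)"
    and fin: "finite_measure M"
    and eq: "\<And>t C. C \<in> sets S \<Longrightarrow> emeasure M ({..t} \<times> C) = emeasure N ({..t} \<times> C)"
  shows "M = N"
proof (rule measure_eqI_generator_eq)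
  let ?E = "{a \<times> b | a b. a \<in> range (atMost :: real \<Rightarrow> real set) \<and> b \<in> sets S}"
  interpret finite_measure M by fact
  have "sets (borel \<Otimes>\<^sub>M S) = sets (sigma (space borel \<times> space S) ?E)"
  proof (rule sets_pair_eq)
    show "sets borel = sigma_sets (space (borel :: real measure)) (range atMost)"
      by (subst borel_eq_atMost) simp
    show "sets S = sigma_sets (space S) (sets S)" by (rule sets.sigma_sets_eq[symmetric])
    show "countable (range (\<lambda>n::nat. {..real n}))" "countable {space S}" by auto
    show "(\<Union>(range (\<lambda>n::nat. {..real n}))) = space borel"
      using real_arch_simple by auto
  qed (use sets.sets_into_space in auto)
  then have *: "sets (borel \<Otimes>\<^sub>M S) = sigma_sets (UNIV \<times> space S) ?E"
    by (subst (asm) sets_measure_of) (use sets.sets_into_space in auto)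
  then show "sets M = sigma_sets (UNIV \<times> space S) ?E" "sets N = sigma_sets (UNIV \<times> space S) ?E"
    using sets by simp_all
  show "Int_stable ?E"
  proof (rule Int_stableI)
    fix a b assume "a \<in> ?E" "b \<in> ?E"
    then obtain s t A B where "a = {..s} \<times> A" "b = {..t} \<times> B" "A \<in> sets S" "B \<in> sets S" by blast
    then have "a \<inter> b = {..min s t} \<times> (A \<inter> B)" "A \<inter> B \<in> sets S" by auto
    then show "a \<inter> b \<in> ?E" by blast
  qed
  show "?E \<subseteq> Pow (UNIV \<times> space S)" using sets.sets_into_space by auto
  show "emeasure M X = emeasure N X" if "X \<in> ?E" for X using that eq by auto
  show "range (\<lambda>n::nat. {..real n} \<times> space S) \<subseteq> ?E" by auto
  show "(\<Union>n::nat. {..real n} \<times> space S) = UNIV \<times> space S" using real_arch_simple by auto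
  show "emeasure M ({..real n} \<times> space S) \<noteq> \<infinity>" for n by simp
qed

section \<open>Scalar products along the flow and at a jump\<close>

lemma vnorm_power2: "(vnorm d x)\<^sup>2 = vinner d x x"
  by (simp add: L2_set_def vinner_def sum_nonneg power2_eq_square)

lemma vinner_self_nonneg: "0 \<le> vinner d x x"
  by (simp add: vinner_def sum_nonneg)

lemma vinner_commute: "vinner d x y = vinner d y x"
  by (simp add: vinner_def mult.commute)

lemma vinner_flow_right:
  "vinner d (\<lambda>i\<in>{..<d}. x i + s * v i) y = vinner d x y + s * vinner d v y"
  by (simp add: vinner_def sum.distrib sum_distrib_left algebra_simps)

lemma vinner_flow_self:
  "vinner d (\<lambda>i\<in>{..<d}. x i + s * v i) (\<lambda>i\<in>{..<d}. x i + s * v i) =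
    vinner d x x + (2 * vinner d x v * s + s\<^sup>2 * vinner d v v)"
  unfolding vinner_flow_right vinner_commute[of d _ "\<lambda>i\<in>{..<d}. x i + s * v i"]
  by (simp add: vinner_commute[of d v x] power2_eq_square algebra_simps)

lemma vinner_vdir: "vinner d x (vdir d x) = vnorm d x"
proof -
  have "vinner d x (vdir d x) = vinner d x x / vnorm d x"
    by (simp add: vinner_def vdir_def sum_divide_distrib)
  also have "\<dots> = vnorm d x" unfolding vnorm_power2[symmetric] by (simp add: power2_eq_square)
  finally show ?thesis .
qed

lemma vdir_scale: "vnorm d x \<noteq> 0 \<Longrightarrow> vinner d x y = vnorm d x * vinner d y (vdir d x)"
  by (simp add: vinner_def vdir_def sum_distrib_left mult.commute)

text \<open>The rotated component stays perpendicular to \<open>x\<close>, so neither the rotation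
  nor the old velocity contributes. For vanishing norm both sides are 0 and nothing is asked of
  \<open>A\<close>.\<close>

lemma vinner_new_velocity:
  assumes A: "vnorm d x \<noteq> 0 \<Longrightarrow> orthogonal_on_hyperplane d x A"
  shows "vinner d x (new_velocity d x v w A) = - w * vnorm d x"
proof (cases "vnorm d x = 0")
  case True
  then have "\<forall>i<d. x i = 0" by (simp add: L2_set_eq_0_iff)
  then show ?thesis using True by (simp add: vinner_def)
next
  case False
  let ?u = "vperp d x v"
  have dir: "vinner d (vdir d x) (vdir d x) = 1"
    using vinner_vdir[of d x] False vdir_scale[OF False, of "vdir d x"] by simp
  have "vinner d ?u (vdir d x) = vinner d v (vdir d x) - vinner d v (vdir d x) * vinner d (vdir d x) (vdir d x)"
    by (simp add: vinner_def vperp_def sum_subtractf sum_distrib_left algebra_simps)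
  then have "vinner d (mat_vec d A ?u) (vdir d x) = 0"
    using A[OF False] dir by (simp add: orthogonal_on_hyperplane_def)
  then have 0: "vinner d x (mat_vec d A ?u) = 0" using vdir_scale[OF False] by simp
  have "vinner d x (new_velocity d x v w A) =
      (\<Sum>i<d. - w * (x i * vdir d x i) + sqrt (1 - w\<^sup>2) / vnorm d ?u * (x i * mat_vec d A ?u i))"
    unfolding vinner_def new_velocity_def by (intro sum.cong) (auto simp: algebra_simps)
  also have "\<dots> = - w * vinner d x (vdir d x) + sqrt (1 - w\<^sup>2) / vnorm d ?u * vinner d x (mat_vec d A ?u)"
    by (simp only: vinner_def sum.distrib sum_distrib_left)
  finally have "vinner d x (new_velocity d x v w A) =
      - w * vinner d x (vdir d x) + sqrt (1 - w\<^sup>2) / vnorm d ?u * vinner d x (mat_vec d A ?u)" .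
  then show ?thesis using 0 vinner_vdir by simp
qed

lemma measurable_vec_component: "i < d \<Longrightarrow> (\<lambda>x. x i) \<in> borel_measurable (vec_space d)"
  unfolding vec_space_def by simp

lemma measurable_vinner [measurable (raw)]:
  assumes "f \<in> L \<rightarrow>\<^sub>M vec_space d" "g \<in> L \<rightarrow>\<^sub>M vec_space d"
  shows "(\<lambda>x. vinner d (f x) (g x)) \<in> borel_measurable L"
proof -
  have [measurable]: "(\<lambda>x. f x i) \<in> borel_measurable L" "(\<lambda>x. g x i) \<in> borel_measurable L" if "i < d" for i
    using measurable_compose[OF assms(1) measurable_vec_component[OF that]]
      measurable_compose[OF assms(2) measurable_vec_component[OF that]] by simp_all
  show ?thesis unfolding vinner_def by (intro borel_measurable_sum) simp
qed

lemma measurable_new_velocity [measurable]: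
  "(\<lambda>(w, A). new_velocity d x v w A) \<in> borel \<Otimes>\<^sub>M mat_space d \<rightarrow>\<^sub>M vec_space d"
proof -
  have [measurable]: "(\<lambda>A. A (i, j)) \<in> borel_measurable (mat_space d)" if "i < d" "j < d" for i j
    unfolding mat_space_def using that by simp
  have [measurable]: "(\<lambda>p. mat_vec d (snd p) u i) \<in> borel_measurable (borel \<Otimes>\<^sub>M mat_space d)" if "i < d" for u i
    unfolding mat_vec_def using that by simp
  show ?thesis
    unfolding new_velocity_def vec_space_def split_beta' by (intro measurable_restrict) simp
qed

definition state_value :: "nat \<Rightarrow> vec \<times> vec \<Rightarrow> real" where
  "state_value d y = vinner d (fst y) (snd y)"

definition state_radius :: "nat \<Rightarrow> vec \<times> vec \<Rightarrow> real" where
  "state_radius d y = vinner d (fst y) (fst y) / real d"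

abbreviation "state_space d \<equiv> vec_space d \<Otimes>\<^sub>M vec_space d"

lemma measurable_state [measurable]:
  "state_value d \<in> borel_measurable (state_space d)" "state_radius d \<in> borel_measurable (state_space d)"
  unfolding state_value_def state_radius_def by measurable

text \<open>An event in terms of value and radius sees the new velocity only through its scalar
  product with \<open>x\<close>, which almost surely does not depend on the rotation. The kernel
  \<open>\<nu>\<close> therefore integrates out with total mass 1, and the radial variable is
  written as a quantile.\<close>

lemma emeasure_fecmc_jump:
  assumes d: "2 \<le> d" and \<nu>: "hyperplane_kernel d \<nu>" and x: "x \<in> space (vec_space d)"
    and v: "v \<in> space (vec_space d)" and C [measurable]: "C \<in> sets (borel \<Otimes>\<^sub>M borel)"
  shows "emeasure (fecmc_jump d \<nu> (x, v)) {y \<in> space (state_space d). (state_value d y, state_radius d y) \<in> C} =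
    (\<integral>\<^sup>+e. indicator C (- (radial_scale d e * sqrt (vinner d x x / real d)), vinner d x x / real d) \<partial>expo)"
proof -
  have \<nu>_meas: "\<nu> \<in> vec_space d \<rightarrow>\<^sub>M prob_algebra (mat_space d)" using \<nu> by (simp add: hyperplane_kernel_def)
  have "\<nu> x \<in> space (prob_algebra (mat_space d))" using measurable_space[OF \<nu>_meas x] .
  then have prob: "prob_space (\<nu> x)" and sets [measurable_cong]: "sets (\<nu> x) = sets (mat_space d)"
    by (auto simp: space_prob_algebra)
  interpret N: prob_space "\<nu> x" by (rule prob)
  have [measurable_cong]: "sets (radial_law d) = sets borel" by (simp add: radial_law_def)
  let ?C = "{y \<in> space (state_space d). (state_value d y, state_radius d y) \<in> C}"
  let ?g = "\<lambda>w. indicator C (- w * vnorm d x, vinner d x x / real d) :: ennreal"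
  have meas: "(\<lambda>(w, A). (x, new_velocity d x v w A)) \<in> radial_law d \<Otimes>\<^sub>M \<nu> x \<rightarrow>\<^sub>M state_space d"
    using x by measurable
  have "emeasure (fecmc_jump d \<nu> (x, v)) ?C = (\<integral>\<^sup>+y. indicator ?C y \<partial>fecmc_jump d \<nu> (x, v))"
    by (subst nn_integral_indicator) (auto simp: fecmc_jump_def)
  also have "\<dots> = (\<integral>\<^sup>+p. indicator ?C (x, new_velocity d x v (fst p) (snd p)) \<partial>(radial_law d \<Otimes>\<^sub>M \<nu> x))"
    unfolding fecmc_jump_def prod.case by (subst nn_integral_distr[OF meas]) (auto simp: split_beta')
  also have "\<dots> = (\<integral>\<^sup>+w. (\<integral>\<^sup>+A. indicator ?C (x, new_velocity d x v w A) \<partial>\<nu> x) \<partial>radial_law d)"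
    using measurable_compose[OF meas, of "indicator ?C" borel]
    by (subst N.nn_integral_fst[symmetric]) (auto simp: split_beta')
  also have "\<dots> = (\<integral>\<^sup>+w. ?g w \<partial>radial_law d)"
  proof (rule nn_integral_cong)
    fix w
    have "AE A in \<nu> x. vnorm d x \<noteq> 0 \<longrightarrow> orthogonal_on_hyperplane d x A"
      using \<nu> x by (cases "vnorm d x = 0") (auto simp: hyperplane_kernel_def)
    then have "AE A in \<nu> x. indicator ?C (x, new_velocity d x v w A) = ?g w"
      using AE_space
    proof eventually_elim
      case (elim A)
      have "A \<in> space (mat_space d)" using elim sets_eq_imp_space_eq[OF sets] by simp
      then have "new_velocity d x v w A \<in> space (vec_space d)"
        using measurable_space[OF measurable_new_velocity, of "(w, A)"] by (simp add: space_pair_measure)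
      then show ?case
        using vinner_new_velocity[where d = d and x = x and A = A and v = v and w = w] elim x
        by (auto simp: indicator_def state_value_def state_radius_def space_pair_measure)
    qed
    then have "(\<integral>\<^sup>+A. indicator ?C (x, new_velocity d x v w A) \<partial>\<nu> x) = (\<integral>\<^sup>+A. ?g w \<partial>\<nu> x)"
      by (rule nn_integral_cong_AE)
    then show "(\<integral>\<^sup>+A. indicator ?C (x, new_velocity d x v w A) \<partial>\<nu> x) = ?g w"
      by (simp add: N.emeasure_space_1)
  qed
  also have "\<dots> = (\<integral>\<^sup>+e. ?g (radial_quantile d e) \<partial>expo)"
    unfolding radial_law_eq[OF d] by (subst nn_integral_distr[OF measurable_radial_quantile[OF measurable_ident_sets]]) auto
  also have "\<dots> = (\<integral>\<^sup>+e. indicator C (- (radial_scale d e * sqrt (vinner d x x / real d)), vinner d x x / real d) \<partial>expo)"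
  proof (rule nn_integral_cong)
    fix e
    have "vnorm d x = sqrt (vinner d x x)"
      unfolding vnorm_power2[symmetric] by (simp add: L2_set_def sum_nonneg)
    also have "\<dots> = sqrt (real d) * sqrt (vinner d x x / real d)"
      using d by (simp add: real_sqrt_mult[symmetric])
    finally have "radial_quantile d e * vnorm d x = radial_scale d e * sqrt (vinner d x x / real d)"
      by (simp add: radial_scale_def)
    then show "?g (radial_quantile d e) = indicator C (- (radial_scale d e * sqrt (vinner d x x / real d)), vinner d x x / real d)"
      by simp
  qed
  finally show ?thesis .
qed

text \<open>Brings an integral over the two driving variables into the shape of the jump clause of
  \<open>pdmp\<close>: hazard rate times survival probability at time \<open>s\<close>, multiplied
  by the mean over the jump taken at that time.\<close>

lemma emeasure_atMost_wait_time:
  assumes [measurable]: "(\<lambda>(s, e). K s e) \<in> borel_measurable (borel \<Otimes>\<^sub>M borel)"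
  shows "(\<integral>\<^sup>+p. indicator {..t} (wait_time r (fst p)) * K (wait_time r (fst p)) (snd p) \<partial>(expo \<Otimes>\<^sub>M expo)) =
    (\<integral>\<^sup>+s\<in>{0..t}. ennreal (max (r + s) 0 * exp (- (LINT u:{0..s}|lborel. max (r + u) 0))) *
      (\<integral>\<^sup>+e. K s e \<partial>expo) \<partial>lborel)"
proof -
  interpret E: prob_space expo by (rule prob_space_expo)
  have sect [measurable]: "K s \<in> borel_measurable borel" for s
    using measurable_compose[OF measurable_Pair1'[of s borel borel] assms] by simp
  have sect' [measurable]: "K s \<in> borel_measurable expo" for s
    using sect[of s] by (simp cong: measurable_cong_sets)
  have K [measurable]: "(\<lambda>s. \<integral>\<^sup>+e. K s e \<partial>expo) \<in> borel_measurable borel" by measurable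
  have "(\<integral>\<^sup>+p. indicator {..t} (wait_time r (fst p)) * K (wait_time r (fst p)) (snd p) \<partial>(expo \<Otimes>\<^sub>M expo))
      = (\<integral>\<^sup>+e. (\<integral>\<^sup>+e'. indicator {..t} (wait_time r e) * K (wait_time r e) e' \<partial>expo) \<partial>expo)"
    by (subst E.nn_integral_fst[symmetric]) simp_all
  also have "\<dots> = (\<integral>\<^sup>+e. indicator {..t} (wait_time r e) * (\<integral>\<^sup>+e'. K (wait_time r e) e' \<partial>expo) \<partial>expo)"
    by (intro nn_integral_cong nn_integral_cmult) simp
  also have "\<dots> = (\<integral>\<^sup>+s. ennreal (max (r + s) 0 * exp (- hazard r s)) * indicator {0..} s *
      (indicator {..t} s * (\<integral>\<^sup>+e. K s e \<partial>expo)) \<partial>lborel)"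
    by (rule nn_integral_wait_time) measurable
  also have "\<dots> = (\<integral>\<^sup>+s\<in>{0..t}. ennreal (max (r + s) 0 * exp (- (LINT u:{0..s}|lborel. max (r + u) 0))) *
      (\<integral>\<^sup>+e. K s e \<partial>expo) \<partial>lborel)"
    by (intro nn_integral_cong) (auto simp: integral_rate split: split_indicator)
  finally show ?thesis .
qed

text \<open>Natural subtraction gives \<open>0 - 1 = 0\<close>, so the waiting time entry of the
  initial state is 0, as in the driven chain.\<close>

definition jump_chain :: "nat \<Rightarrow> (nat \<Rightarrow> 'w \<Rightarrow> real) \<Rightarrow> (nat \<Rightarrow> 'w \<Rightarrow> vec \<times> vec) \<Rightarrow> nat \<Rightarrow> 'w \<Rightarrow> real \<times> real \<times> real" where
  "jump_chain d T Y n \<omega> = (T n \<omega> - T (n - 1) \<omega>, state_value d (Y n \<omega>), state_radius d (Y n \<omega>))"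

lemma jump_chain_event:
  assumes T: "\<And>n. T n \<in> borel_measurable M" and Y: "\<And>n. Y n \<in> M \<rightarrow>\<^sub>M state_space d"
    and A [measurable]: "\<And>i. i \<le> n \<Longrightarrow> A i \<in> sets chain_space"
  shows "{\<omega> \<in> space M. \<forall>i\<le>n. jump_chain d T Y i \<omega> \<in> A i} \<in> sets (jump_history M (state_space d) T Y n)"
proof -
  let ?P = "PiM {..n} (\<lambda>_. borel \<Otimes>\<^sub>M state_space d)"
  let ?h = "\<lambda>\<omega>. \<lambda>i\<in>{..n}. (T i \<omega>, Y i \<omega>)"
  let ?\<zeta> = "\<lambda>i h. (fst (h i) - fst (h (i - 1)), state_value d (snd (h i)), state_radius d (snd (h i)))"
  have comp [measurable]: "(\<lambda>h. h i) \<in> ?P \<rightarrow>\<^sub>M borel \<Otimes>\<^sub>M state_space d" if "i \<le> n" for i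
    using that by simp
  have "?\<zeta> i \<in> ?P \<rightarrow>\<^sub>M chain_space" if "i \<le> n" for i
  proof -
    have [measurable]: "(\<lambda>h. h i) \<in> ?P \<rightarrow>\<^sub>M borel \<Otimes>\<^sub>M state_space d" "(\<lambda>h. h (i - 1)) \<in> ?P \<rightarrow>\<^sub>M borel \<Otimes>\<^sub>M state_space d"
      using that by (auto intro!: comp)
    show ?thesis by measurable
  qed
  then have "{h \<in> space ?P. \<forall>i\<in>{..n}. ?\<zeta> i h \<in> A i} \<in> sets ?P"
    by (intro sets.sets_Collect_finite_All) (auto intro!: measurable_sets_Collect[of _ _ chain_space] A)
  then have "?h -` {h \<in> space ?P. \<forall>i\<in>{..n}. ?\<zeta> i h \<in> A i} \<inter> space M \<in> sets (jump_history M (state_space d) T Y n)"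
    unfolding jump_history_def by (rule in_vimage_algebra)
  also have "?h -` {h \<in> space ?P. \<forall>i\<in>{..n}. ?\<zeta> i h \<in> A i} \<inter> space M =
      {\<omega> \<in> space M. \<forall>i\<le>n. jump_chain d T Y i \<omega> \<in> A i}"
    using measurable_space[OF Y] by (auto simp: space_PiM space_pair_measure jump_chain_def)
  finally show ?thesis .
qed

lemma sets_jump_history_subset:
  assumes [measurable]: "\<And>n. T n \<in> borel_measurable M" "\<And>n. Y n \<in> M \<rightarrow>\<^sub>M S"
  shows "sets (jump_history M S T Y n) \<subseteq> sets M"
proof -
  let ?h = "\<lambda>\<omega>. \<lambda>i\<in>{..n}. (T i \<omega>, Y i \<omega>)" and ?P = "PiM {..n} (\<lambda>_. borel \<Otimes>\<^sub>M S)"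
  have h: "?h \<in> M \<rightarrow>\<^sub>M ?P"
    by (intro measurable_restrict measurable_Pair assms)
  have "sets (jump_history M S T Y n) = {?h -` B \<inter> space M | B. B \<in> sets ?P}"
    unfolding jump_history_def by (rule sets_vimage_algebra2) (use measurable_space[OF h] in blast)
  then show ?thesis using measurable_sets[OF h] by auto
qed

text \<open>The reduced state evolves by itself because both the jump rate and the projected jump
  kernel are functions of value and radius alone, velocities having norm 1. The two integrals are
  taken with respect to finite measures on the reduced state space, which are compared on the sets
  provided by the jump clause.\<close>

lemma jump_chain_integral:
  fixes T :: "nat \<Rightarrow> 'w \<Rightarrow> real"
  assumes d: "2 \<le> d" and \<nu>: "hyperplane_kernel d \<nu>" and M: "prob_space M"
    and T [measurable]: "\<And>n. T n \<in> borel_measurable M" and Y [measurable]: "\<And>n. Y n \<in> M \<rightarrow>\<^sub>M state_space d"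
    and T_less: "\<And>\<omega>. \<omega> \<in> space M \<Longrightarrow> T n \<omega> < T (Suc n) \<omega>"
    and unit: "\<And>\<omega>. \<omega> \<in> space M \<Longrightarrow> vinner d (snd (Y n \<omega>)) (snd (Y n \<omega>)) = 1"
    and A: "A \<in> sets (jump_history M (state_space d) T Y n)"
    and law: "\<And>t C. 0 \<le> t \<Longrightarrow> C \<in> sets (state_space d) \<Longrightarrow>
        emeasure M {\<omega>\<in>A. T (Suc n) \<omega> - T n \<omega> \<le> t \<and> Y (Suc n) \<omega> \<in> C} =
        (\<integral>\<^sup>+\<omega>\<in>A. (\<integral>\<^sup>+s\<in>{0..t}.
            ennreal (fecmc_rate d (fecmc_flow d s (Y n \<omega>)) * exp (- (LINT u:{0..s}|lborel. fecmc_rate d (fecmc_flow d u (Y n \<omega>))))) *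
            emeasure (fecmc_jump d \<nu> (fecmc_flow d s (Y n \<omega>))) C \<partial>lborel) \<partial>M)"
    and u [measurable]: "u \<in> borel_measurable chain_space"
  shows "(\<integral>\<^sup>+\<omega>\<in>A. u (jump_chain d T Y (Suc n) \<omega>) \<partial>M) =
    (\<integral>\<^sup>+\<omega>\<in>A. (\<integral>\<^sup>+p. u (chain_step (radial_scale d) (1 / real d) (jump_chain d T Y n \<omega>) p) \<partial>(expo \<Otimes>\<^sub>M expo)) \<partial>M)"
proof -
  interpret M: prob_space M by fact
  interpret E: prob_space expo by (rule prob_space_expo)
  interpret EE: pair_prob_space expo expo ..
  let ?step = "chain_step (radial_scale d) (1 / real d)"
  have A' [measurable]: "A \<in> sets M" by (rule sets_jump_history_subset[OF T Y, THEN subsetD, OF A])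
  have A_space: "A \<subseteq> space M" using sets.sets_into_space[OF A'] .
  have [measurable]: "jump_chain d T Y i \<in> M \<rightarrow>\<^sub>M chain_space" for i unfolding jump_chain_def by measurable
  \<comment> \<open>Restricting the measure to the history event \<open>A\<close> makes the
    conditional statement an identity of two image measures.\<close>
  let ?D = "density M (indicator A)"
  interpret D: finite_measure ?D
    by (intro finite_measureI) (auto simp: emeasure_density)
  interpret DE: pair_sigma_finite ?D "expo \<Otimes>\<^sub>M expo" ..
  let ?\<mu>1 = "distr ?D chain_space (jump_chain d T Y (Suc n))"
  let ?\<mu>2 = "distr (?D \<Otimes>\<^sub>M (expo \<Otimes>\<^sub>M expo)) chain_space (\<lambda>q. ?step (jump_chain d T Y n (fst q)) (snd q))"
  have "?\<mu>1 = ?\<mu>2"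
  proof (rule measure_eqI_atMost_times)
    show "finite_measure ?\<mu>1" by (intro D.finite_measure_distr) simp
    fix t :: real and C :: "(real \<times> real) set" assume C [measurable]: "C \<in> sets (borel \<Otimes>\<^sub>M borel)"
    let ?C = "{y \<in> space (state_space d). (state_value d y, state_radius d y) \<in> C}"
    have C' [measurable]: "?C \<in> sets (state_space d)" by measurable
    let ?a = "\<lambda>\<omega> s. state_radius d (Y n \<omega>) + (1 / real d) * (2 * state_value d (Y n \<omega>) * s + s\<^sup>2)"
    let ?K = "\<lambda>\<omega> s e. indicator C (- (radial_scale d e * sqrt (max (?a \<omega> s) 0)), ?a \<omega> s) :: ennreal"
    have "emeasure ?\<mu>1 ({..t} \<times> C) = emeasure M {\<omega>\<in>A. T (Suc n) \<omega> - T n \<omega> \<le> t \<and> Y (Suc n) \<omega> \<in> ?C}"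
    proof -
      have "emeasure ?\<mu>1 ({..t} \<times> C) = emeasure M (A \<inter> (jump_chain d T Y (Suc n) -` ({..t} \<times> C) \<inter> space M))"
        by (subst emeasure_distr) (auto intro!: emeasure_restricted)
      also have "A \<inter> (jump_chain d T Y (Suc n) -` ({..t} \<times> C) \<inter> space M) =
          {\<omega>\<in>A. T (Suc n) \<omega> - T n \<omega> \<le> t \<and> Y (Suc n) \<omega> \<in> ?C}"
        using A_space measurable_space[OF Y] by (auto simp: jump_chain_def)
      finally show ?thesis .
    qed
    also have "\<dots> = (\<integral>\<^sup>+\<omega>\<in>A. (\<integral>\<^sup>+p. indicator ({..t} \<times> C) (?step (jump_chain d T Y n \<omega>) p) \<partial>(expo \<Otimes>\<^sub>M expo)) \<partial>M)"
    proof -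
      have inner: "(\<integral>\<^sup>+p. indicator ({..t} \<times> C) (?step (jump_chain d T Y n \<omega>) p) \<partial>(expo \<Otimes>\<^sub>M expo)) =
         (\<integral>\<^sup>+s\<in>{0..t}. ennreal (max (state_value d (Y n \<omega>) + s) 0 *
            exp (- (LINT u:{0..s}|lborel. max (state_value d (Y n \<omega>) + u) 0))) * (\<integral>\<^sup>+e. ?K \<omega> s e \<partial>expo) \<partial>lborel)" for \<omega>
      proof -
        have "(\<integral>\<^sup>+p. indicator ({..t} \<times> C) (?step (jump_chain d T Y n \<omega>) p) \<partial>(expo \<Otimes>\<^sub>M expo)) =
          (\<integral>\<^sup>+p. indicator {..t} (wait_time (state_value d (Y n \<omega>)) (fst p)) *
            ?K \<omega> (wait_time (state_value d (Y n \<omega>)) (fst p)) (snd p) \<partial>(expo \<Otimes>\<^sub>M expo))"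
          by (intro nn_integral_cong) (simp add: chain_step_def Let_def jump_chain_def indicator_times)
        also have "\<dots> = (\<integral>\<^sup>+s\<in>{0..t}. ennreal (max (state_value d (Y n \<omega>) + s) 0 *
            exp (- (LINT u:{0..s}|lborel. max (state_value d (Y n \<omega>) + u) 0))) * (\<integral>\<^sup>+e. ?K \<omega> s e \<partial>expo) \<partial>lborel)"
          by (rule emeasure_atMost_wait_time) measurable
        finally show ?thesis .
      qed
      have rate: "fecmc_rate d (fecmc_flow d s (Y n \<omega>)) = max (state_value d (Y n \<omega>) + s) 0" if "\<omega> \<in> space M" for \<omega> s
      proof -
        let ?x' = "\<lambda>i\<in>{..<d}. fst (Y n \<omega>) i + s * snd (Y n \<omega>) i"
        have "vinner d (snd (Y n \<omega>)) ?x' = vinner d ?x' (snd (Y n \<omega>))" by (rule vinner_commute)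
        also have "\<dots> = state_value d (Y n \<omega>) + s"
          unfolding vinner_flow_right unit[OF that] by (simp add: state_value_def)
        finally show ?thesis by (simp add: fecmc_rate_def fecmc_flow_def split_beta')
      qed
      have jump: "emeasure (fecmc_jump d \<nu> (fecmc_flow d s (Y n \<omega>))) ?C = (\<integral>\<^sup>+e. ?K \<omega> s e \<partial>expo)" if "\<omega> \<in> space M" for \<omega> s
      proof -
        obtain x v where y: "Y n \<omega> = (x, v)" by fastforce
        have xv: "x \<in> space (vec_space d)" "v \<in> space (vec_space d)"
          using measurable_space[OF Y that, of n] y by (auto simp: space_pair_measure)
        have x': "(\<lambda>i\<in>{..<d}. x i + s * v i) \<in> space (vec_space d)"
          by (simp add: vec_space_def space_PiM)
        have a: "vinner d (\<lambda>i\<in>{..<d}. x i + s * v i) (\<lambda>i\<in>{..<d}. x i + s * v i) / real d = ?a \<omega> s"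
          unfolding vinner_flow_self using unit[OF that] d
          by (simp add: y state_radius_def state_value_def field_simps)
        \<comment> \<open>A squared norm divided by \<open>d\<close>, hence equal to its truncation
          that enters \<open>chain_step\<close>.\<close>
        have "0 \<le> ?a \<omega> s" unfolding a[symmetric] by (simp add: vinner_self_nonneg)
        then have "max (?a \<omega> s) 0 = ?a \<omega> s" by simp
        moreover have "fecmc_flow d s (Y n \<omega>) = ((\<lambda>i\<in>{..<d}. x i + s * v i), v)"
          by (simp add: y fecmc_flow_def)
        ultimately show ?thesis
          using emeasure_fecmc_jump[OF d \<nu> x' xv(2) C] unfolding a by simp
      qed
      show ?thesis
      proof (cases "0 \<le> t")
        case True
        show ?thesis
          unfolding law[OF True C'] using A_space
          by (intro nn_integral_cong) (auto simp: inner rate jump split: split_indicator)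
      next
        case False
        \<comment> \<open>The jump clause covers nonnegative \<open>t\<close> only. For negative
          \<open>t\<close> both sides are 0, as waiting times are positive and the interval of
          integration is empty.\<close>
        then have empty: "{\<omega>\<in>A. T (Suc n) \<omega> - T n \<omega> \<le> t \<and> Y (Suc n) \<omega> \<in> ?C} = {}"
          using T_less A_space by force
        show ?thesis unfolding empty using False by (simp add: inner)
      qed
    qed
    also have "\<dots> = emeasure ?\<mu>2 ({..t} \<times> C)"
    proof -
      have "emeasure ?\<mu>2 ({..t} \<times> C) = (\<integral>\<^sup>+z. indicator ({..t} \<times> C) z \<partial>?\<mu>2)"
        by (subst nn_integral_indicator) auto
      also have "\<dots> = (\<integral>\<^sup>+q. indicator ({..t} \<times> C) (?step (jump_chain d T Y n (fst q)) (snd q)) \<partial>(?D \<Otimes>\<^sub>M (expo \<Otimes>\<^sub>M expo)))"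
        by (subst nn_integral_distr) auto
      also have "\<dots> = (\<integral>\<^sup>+\<omega>. (\<integral>\<^sup>+p. indicator ({..t} \<times> C) (?step (jump_chain d T Y n \<omega>) p) \<partial>(expo \<Otimes>\<^sub>M expo)) \<partial>?D)"
        by (subst EE.nn_integral_fst[symmetric]) auto
      finally show ?thesis
        by (subst (asm) nn_integral_density) (auto simp: mult.commute)
    qed
    finally show "emeasure ?\<mu>1 ({..t} \<times> C) = emeasure ?\<mu>2 ({..t} \<times> C)" .
  qed simp_all
  then have "(\<integral>\<^sup>+z. u z \<partial>?\<mu>1) = (\<integral>\<^sup>+z. u z \<partial>?\<mu>2)" by simp
  also have "(\<integral>\<^sup>+z. u z \<partial>?\<mu>1) = (\<integral>\<^sup>+\<omega>\<in>A. u (jump_chain d T Y (Suc n) \<omega>) \<partial>M)"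
    by (simp add: nn_integral_distr nn_integral_density mult.commute)
  also have "(\<integral>\<^sup>+z. u z \<partial>?\<mu>2) = (\<integral>\<^sup>+q. u (?step (jump_chain d T Y n (fst q)) (snd q)) \<partial>(?D \<Otimes>\<^sub>M (expo \<Otimes>\<^sub>M expo)))"
    by (subst nn_integral_distr) auto
  also have "\<dots> = (\<integral>\<^sup>+\<omega>. (\<integral>\<^sup>+p. u (?step (jump_chain d T Y n \<omega>) p) \<partial>(expo \<Otimes>\<^sub>M expo)) \<partial>?D)"
    by (subst EE.nn_integral_fst[symmetric]) auto
  finally show ?thesis
    by (subst (asm) nn_integral_density) (auto simp: mult.commute)
qed

lemma fecmc_jump_chain:
  fixes M :: "'w measure"
  assumes fecmc: "fecmc_process d \<nu> M X V" and d: "2 \<le> d"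
  obtains Z where "markov_chain M chain_space (expo \<Otimes>\<^sub>M expo) (chain_step (radial_scale d) (1 / real d)) Z"
    and "\<And>\<omega>. \<omega> \<in> space M \<Longrightarrow> chain_data (\<lambda>n. Z n \<omega>) \<in> jump_data"
    and "\<And>\<omega>. \<omega> \<in> space M \<Longrightarrow>
      data_path (chain_data (\<lambda>n. Z n \<omega>)) = path_of (\<lambda>t \<omega>. vinner d (X t \<omega>) (V t \<omega>)) \<omega>"
    and "\<And>\<omega>. \<omega> \<in> space M \<Longrightarrow> Z 0 \<omega> = (0, vinner d (X 0 \<omega>) (V 0 \<omega>), vinner d (X 0 \<omega>) (X 0 \<omega>) / real d)"
    and "\<And>\<omega>. \<omega> \<in> space M \<Longrightarrow> vinner d (V 0 \<omega>) (V 0 \<omega>) = 1"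
    and "(\<lambda>\<omega>. (X 0 \<omega>, V 0 \<omega>)) \<in> M \<rightarrow>\<^sub>M state_space d"
proof -
  have \<nu>: "hyperplane_kernel d \<nu>" and unit: "\<And>t \<omega>. 0 \<le> t \<Longrightarrow> \<omega> \<in> space M \<Longrightarrow> vnorm d (V t \<omega>) = 1"
    and pdmp: "pdmp M (state_space d) (fecmc_flow d) (fecmc_rate d) (fecmc_jump d \<nu>) (\<lambda>t \<omega>. (X t \<omega>, V t \<omega>))"
    using fecmc by (simp_all add: fecmc_process_def)
  have M: "prob_space M" using pdmp by (simp add: pdmp_def)
  obtain T Y where 1: "\<forall>n. T n \<in> borel_measurable M" and 2: "\<forall>n. Y n \<in> M \<rightarrow>\<^sub>M state_space d"
    and 3: "\<forall>\<omega>\<in>space M. T 0 \<omega> = 0 \<and> strict_mono (\<lambda>n. T n \<omega>) \<and>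
        filterlim (\<lambda>n. T n \<omega>) at_top sequentially \<and>
        (\<forall>n. \<forall>t\<in>{T n \<omega>..<T (Suc n) \<omega>}. (X t \<omega>, V t \<omega>) = fecmc_flow d (t - T n \<omega>) (Y n \<omega>))"
    and 4: "\<forall>n. \<forall>A\<in>sets (jump_history M (state_space d) T Y n). \<forall>t\<ge>0. \<forall>C\<in>sets (state_space d).
        emeasure M {\<omega>\<in>A. T (Suc n) \<omega> - T n \<omega> \<le> t \<and> Y (Suc n) \<omega> \<in> C} =
        (\<integral>\<^sup>+\<omega>\<in>A. (\<integral>\<^sup>+s\<in>{0..t}.
            ennreal (fecmc_rate d (fecmc_flow d s (Y n \<omega>)) * exp (- (LINT u:{0..s}|lborel. fecmc_rate d (fecmc_flow d u (Y n \<omega>))))) *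
            emeasure (fecmc_jump d \<nu> (fecmc_flow d s (Y n \<omega>))) C \<partial>lborel) \<partial>M)"
    using pdmp unfolding pdmp_def by (elim conjE exE)
  have T [measurable]: "T n \<in> borel_measurable M" and Y [measurable]: "Y n \<in> M \<rightarrow>\<^sub>M state_space d" for n
    using 1 2 by blast+
  have times: "jump_times (\<lambda>n. T n \<omega>)" if "\<omega> \<in> space M" for \<omega>
    using 3 that by (simp add: jump_times_def)
  have flow: "(X t \<omega>, V t \<omega>) = fecmc_flow d (t - T n \<omega>) (Y n \<omega>)"
    if "\<omega> \<in> space M" "T n \<omega> \<le> t" "t < T (Suc n) \<omega>" for \<omega> n t
    using 3 that by simp
  note law = 4[rule_format]
  let ?Z = "jump_chain d T Y"
  have less: "T n \<omega> < T (Suc n) \<omega>" if "\<omega> \<in> space M" for n \<omega>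
    using jump_times_less[OF times[OF that]] .
  have T0: "T 0 \<omega> = 0" if "\<omega> \<in> space M" for \<omega> using times[OF that] by (simp add: jump_times_def)
  \<comment> \<open>At a jump time the flow has run for time 0, so the velocity after the jump is
    one attained by the process and has norm 1.\<close>
  have snd_Y: "snd (Y n \<omega>) = V (T n \<omega>) \<omega>" if "\<omega> \<in> space M" for n \<omega>
    using flow[OF that order_refl less[OF that], of n] by (simp add: fecmc_flow_def split_beta')
  have unit': "vinner d (snd (Y n \<omega>)) (snd (Y n \<omega>)) = 1" if "\<omega> \<in> space M" for n \<omega>
    using unit[OF jump_times_nonneg[OF times[OF that]] that, of n]
    unfolding snd_Y[OF that] vnorm_power2[symmetric] by simp
  have data: "chain_data (\<lambda>n. ?Z n \<omega>) = (\<lambda>n. (T n \<omega>, state_value d (Y n \<omega>)))" if "\<omega> \<in> space M" for \<omega>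
    using T0[OF that] sum_lessThan_telescope[of "\<lambda>n. T n \<omega>"] by (auto simp: chain_data_def jump_chain_def)
  have "markov_chain M chain_space (expo \<Otimes>\<^sub>M expo) (chain_step (radial_scale d) (1 / real d)) ?Z"
    unfolding markov_chain_def
  proof (intro conjI allI impI)
    show "prob_space M" by (rule M)
    show "?Z n \<in> M \<rightarrow>\<^sub>M chain_space" for n unfolding jump_chain_def by measurable
    fix n :: nat and A :: "nat \<Rightarrow> (real \<times> real \<times> real) set" and u :: "real \<times> real \<times> real \<Rightarrow> ennreal"
    assume *: "(\<forall>i\<le>n. A i \<in> sets chain_space) \<and> u \<in> borel_measurable chain_space"
    define B where "B = {\<omega> \<in> space M. \<forall>i\<le>n. ?Z i \<omega> \<in> A i}"
    have B: "B \<in> sets (jump_history M (state_space d) T Y n)"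
      unfolding B_def using * by (intro jump_chain_event) auto
    have ind: "(\<Prod>i\<le>n. indicator (A i) (?Z i \<omega>)) = (indicator B \<omega> :: ennreal)" if w: "\<omega> \<in> space M" for \<omega>
    proof (cases "\<omega> \<in> B")
      case True
      then show ?thesis by (simp add: B_def)
    next
      case False
      then obtain i where "i \<le> n" "?Z i \<omega> \<notin> A i" using w by (auto simp: B_def)
      then show ?thesis using False by (auto intro!: prod_zero bexI[of _ i])
    qed
    have "(\<integral>\<^sup>+\<omega>\<in>B. u (?Z (Suc n) \<omega>) \<partial>M) =
      (\<integral>\<^sup>+\<omega>\<in>B. (\<integral>\<^sup>+p. u (chain_step (radial_scale d) (1 / real d) (?Z n \<omega>) p) \<partial>(expo \<Otimes>\<^sub>M expo)) \<partial>M)"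
      using * by (intro jump_chain_integral[OF d \<nu> M T Y less unit' B law[OF B]]) auto
    then show "(\<integral>\<^sup>+\<omega>. (\<Prod>i\<le>n. indicator (A i) (?Z i \<omega>)) * u (?Z (Suc n) \<omega>) \<partial>M) =
      (\<integral>\<^sup>+\<omega>. (\<Prod>i\<le>n. indicator (A i) (?Z i \<omega>)) *
        (\<integral>\<^sup>+p. u (chain_step (radial_scale d) (1 / real d) (?Z n \<omega>) p) \<partial>(expo \<Otimes>\<^sub>M expo)) \<partial>M)"
      by (simp add: ind mult.commute cong: nn_integral_cong)
  qed
  moreover have "chain_data (\<lambda>n. ?Z n \<omega>) \<in> jump_data" if "\<omega> \<in> space M" for \<omega>
    unfolding data[OF that] using times[OF that] by (simp add: jump_data_def comp_def)
  moreover have "data_path (chain_data (\<lambda>n. ?Z n \<omega>)) = path_of (\<lambda>t \<omega>. vinner d (X t \<omega>) (V t \<omega>)) \<omega>" if \<omega>: "\<omega> \<in> space M" for \<omega>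
    unfolding data[OF \<omega>] data_path_def path_of_def
  proof (rule restrict_ext)
    fix t :: real assume "t \<in> {0..}"
    then have "0 \<le> t" by simp
    obtain n where n: "T n \<omega> \<le> t" "t < T (Suc n) \<omega>"
      using jump_interval_cases[OF times[OF \<omega>] \<open>0 \<le> t\<close>] by blast
    have "vinner d (X t \<omega>) (V t \<omega>) = state_value d (Y n \<omega>) + (t - T n \<omega>)"
      using flow[OF \<omega> n] vinner_flow_right[of d "fst (Y n \<omega>)" "t - T n \<omega>" "snd (Y n \<omega>)" "snd (Y n \<omega>)"] unit'[OF \<omega>, of n]
      by (simp add: fecmc_flow_def split_beta' state_value_def)
    then show "sawtooth (fst \<circ> (\<lambda>n. (T n \<omega>, state_value d (Y n \<omega>)))) (snd \<circ> (\<lambda>n. (T n \<omega>, state_value d (Y n \<omega>)))) t =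
        vinner d (X t \<omega>) (V t \<omega>)"
      using sawtooth_eq[OF times[OF \<omega>] n] by (simp add: comp_def)
  qed
  moreover have "?Z 0 \<omega> = (0, vinner d (X 0 \<omega>) (V 0 \<omega>), vinner d (X 0 \<omega>) (X 0 \<omega>) / real d)" if \<omega>: "\<omega> \<in> space M" for \<omega>
    using flow[OF \<omega>, of 0 0] T0[OF \<omega>] less[OF \<omega>, of 0]
    by (simp add: jump_chain_def state_value_def state_radius_def fecmc_flow_def split_beta' vinner_def)
  moreover have "vinner d (V 0 \<omega>) (V 0 \<omega>) = 1" if \<omega>: "\<omega> \<in> space M" for \<omega>
    using unit[OF order_refl \<omega>] unfolding vnorm_power2[symmetric] by simp
  moreover have "(\<lambda>\<omega>. (X 0 \<omega>, V 0 \<omega>)) \<in> M \<rightarrow>\<^sub>M state_space d"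
  proof (rule measurable_cong[THEN iffD1, OF _ Y[of 0]])
    fix \<omega> assume \<omega>: "\<omega> \<in> space M"
    then have "fst (Y 0 \<omega>) \<in> extensional {..<d}"
      using measurable_space[OF Y \<omega>, of 0]
      by (simp add: space_pair_measure mem_Times_iff vec_space_def space_PiM PiE_def)
    \<comment> \<open>The flow restricts vectors to \<open>{..<d}\<close>, and extensionality of the
      state makes it the identity at time 0. Thus the initial state of the process is the random
      variable \<open>Y 0\<close>, which is measurable.\<close>
    then have "(\<lambda>i\<in>{..<d}. fst (Y 0 \<omega>) i) = fst (Y 0 \<omega>)" by (rule extensional_restrict)
    then have "fecmc_flow d 0 (Y 0 \<omega>) = Y 0 \<omega>" by (simp add: fecmc_flow_def split_beta')
    moreover have "(X 0 \<omega>, V 0 \<omega>) = fecmc_flow d (0 - T 0 \<omega>) (Y 0 \<omega>)"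
      by (rule flow[OF \<omega>]) (use T0[OF \<omega>] less[OF \<omega>, of 0] in simp_all)
    ultimately show "Y 0 \<omega> = (X 0 \<omega>, V 0 \<omega>)" using T0[OF \<omega>] by simp
  qed
  ultimately show ?thesis by (rule that)
qed

section \<open>The initial law\<close>

lemma real_distribution_std_normal: "real_distribution std_normal_distribution"
  by (rule real_dist_normal_dist)

lemma product_prob_space_std_normal: "product_prob_space (\<lambda>_::nat. std_normal_distribution)"
  by (intro product_prob_spaceI prob_space_normal_density) simp

lemma prob_space_std_gaussian: "prob_space (std_gaussian d)"
  unfolding std_gaussian_def by (intro prob_space_PiM prob_space_normal_density) simp

lemma sets_std_gaussian [measurable_cong, simp]: "sets (std_gaussian d) = sets (vec_space d)"
  unfolding std_gaussian_def vec_space_def by (intro sets_PiM_cong) auto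

text \<open>By independence the characteristic function is the product of
  \<open>exp (- (t * v i)\<^sup>2 / 2)\<close>, and the squares of the \<open>v i\<close> sum to
  1.\<close>

lemma distr_vinner_std_gaussian:
  assumes v: "vinner d v v = 1"
  shows "distr (std_gaussian d) borel (\<lambda>x. vinner d x v) = std_normal_distribution"
proof (rule Levy_uniqueness)
  interpret G: prob_space "std_gaussian d" by (rule prob_space_std_gaussian)
  interpret N: product_prob_space "\<lambda>_::nat. std_normal_distribution" by (rule product_prob_space_std_normal)
  have comp [measurable]: "(\<lambda>x. vinner d x v) \<in> borel_measurable (std_gaussian d)"
    unfolding vinner_def
    by (intro borel_measurable_sum borel_measurable_times borel_measurable_const)
      (simp add: measurable_vec_component cong: measurable_cong_sets)
  then show "real_distribution (distr (std_gaussian d) borel (\<lambda>x. vinner d x v))"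
    by (rule G.real_distribution_distr)
  show "real_distribution std_normal_distribution" by (rule real_distribution_std_normal)
  show "char (distr (std_gaussian d) borel (\<lambda>x. vinner d x v)) = char std_normal_distribution"
  proof
    fix t
    have "char (distr (std_gaussian d) borel (\<lambda>x. vinner d x v)) t =
        (CLINT x|std_gaussian d. iexp (t * vinner d x v))"
      unfolding char_def by (subst integral_distr) auto
    also have "\<dots> = (CLINT x|PiM {..<d} (\<lambda>_. std_normal_distribution). (\<Prod>i<d. iexp ((t * v i) * x i)))"
      unfolding std_gaussian_def vinner_def
      by (simp add: exp_sum[symmetric] sum_distrib_left sum_distrib_right mult_ac)
    also have "\<dots> = (\<Prod>i<d. CLINT x|std_normal_distribution. iexp ((t * v i) * x))"
      by (intro N.product_integral_prod finite_lessThan N.M.integrable_const_bound[where B = 1]) auto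
    also have "\<dots> = (\<Prod>i<d. char std_normal_distribution (t * v i))"
      by (simp add: char_def)
    also have "\<dots> = exp (\<Sum>i<d. complex_of_real (- ((t * v i)\<^sup>2 / 2)))"
      by (simp add: char_std_normal_distribution exp_sum exp_of_real[symmetric])
    also have "(\<Sum>i<d. complex_of_real (- ((t * v i)\<^sup>2 / 2))) = complex_of_real (- (t\<^sup>2 / 2) * vinner d v v)"
      by (simp add: vinner_def sum_distrib_left power2_eq_square mult_ac sum_negf)
    finally show "char (distr (std_gaussian d) borel (\<lambda>x. vinner d x v)) t = char std_normal_distribution t"
      by (simp add: v char_std_normal_distribution exp_of_real[symmetric])
  qed
qed

section \<open>Concentration of the radius\<close>

lemma std_normal_centred_square:
  "integrable std_normal_distribution (\<lambda>x. x\<^sup>2 - 1)"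
  "integrable std_normal_distribution (\<lambda>x. (x\<^sup>2 - 1)\<^sup>2)"
  "(\<integral>x. x\<^sup>2 - 1 \<partial>std_normal_distribution) = 0"
  "(\<integral>x. (x\<^sup>2 - 1)\<^sup>2 \<partial>std_normal_distribution) = 2"
proof -
  have m0: "has_bochner_integral lborel std_normal_density 1"
    using std_normal_moment_even[of 0] by simp
  have m2: "has_bochner_integral lborel (\<lambda>x. std_normal_density x * x ^ 2) 1"
    using std_normal_moment_even[of 1] by (simp add: fact_numeral)
  have m4: "has_bochner_integral lborel (\<lambda>x. std_normal_density x * x ^ 4) 3"
    using std_normal_moment_even[of 2] by (simp add: fact_numeral)
  have m2': "has_bochner_integral lborel (\<lambda>x. 2 * (std_normal_density x * x ^ 2)) (2 * 1)"
    by (intro has_bochner_integral_mult_right m2)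
  have 1: "has_bochner_integral lborel (\<lambda>x. std_normal_density x * (x\<^sup>2 - 1)) (1 - 1)"
    using has_bochner_integral_diff[OF m2 m0] by (simp add: algebra_simps)
  have 2: "has_bochner_integral lborel (\<lambda>x. std_normal_density x * (x\<^sup>2 - 1)\<^sup>2) ((3 - 2 * 1) + 1)"
    using has_bochner_integral_add[OF has_bochner_integral_diff[OF m4 m2'] m0]
    by (rule has_bochner_integral_cong[THEN iffD1, rotated -1]) (auto simp: power2_eq_square power4_eq_xxxx algebra_simps)
  show "integrable std_normal_distribution (\<lambda>x. x\<^sup>2 - 1)"
    "integrable std_normal_distribution (\<lambda>x. (x\<^sup>2 - 1)\<^sup>2)"
    using 1 2 by (auto simp: integrable_density has_bochner_integral_iff)
  show "(\<integral>x. x\<^sup>2 - 1 \<partial>std_normal_distribution) = 0"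
    "(\<integral>x. (x\<^sup>2 - 1)\<^sup>2 \<partial>std_normal_distribution) = 2"
    using 1 2 by (auto simp: integral_density has_bochner_integral_iff)
qed

lemma std_gaussian_square_deviation:
  "integrable (std_gaussian d) (\<lambda>x. (\<Sum>i<d. (x i)\<^sup>2 - 1)\<^sup>2)"
  "(\<integral>x. (\<Sum>i<d. (x i)\<^sup>2 - 1)\<^sup>2 \<partial>std_gaussian d) = 2 * real d"
proof -
  interpret N: product_prob_space "\<lambda>_::nat. std_normal_distribution" by (rule product_prob_space_std_normal)
  define y where "y x = x\<^sup>2 - 1" for x :: real
  \<comment> \<open>Writing the product of two coordinate functions as a product over all
    coordinates lets the product formula for integrals cover diagonal and mixed terms at once. A
    mixed term has a factor with mean 0; a diagonal term has the factor
    \<open>3 - 2 + 1 = 2\<close>.\<close>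
  define h where "h i j k x = (if k = i then y x else 1) * (if k = j then y x else 1)" for i j k :: nat and x
  have hint: "integrable std_normal_distribution (h i j k)" for i j k
  proof -
    have "integrable std_normal_distribution y" "integrable std_normal_distribution (\<lambda>x. y x * y x)"
      using std_normal_centred_square(1,2) by (simp_all add: y_def[abs_def] power2_eq_square)
    then show ?thesis unfolding h_def by (cases "k = i"; cases "k = j") simp_all
  qed
  have prod: "y (x i) * y (x j) = (\<Prod>k<d. h i j k (x k))" if "i < d" "j < d" for i j x
    using that by (simp add: h_def prod.distrib)
  have int: "integrable (std_gaussian d) (\<lambda>x. y (x i) * y (x j))"
    and val: "(\<integral>x. y (x i) * y (x j) \<partial>std_gaussian d) = (if i = j then 2 else 0)"
    if "i < d" "j < d" for i j
  proof -
    show "integrable (std_gaussian d) (\<lambda>x. y (x i) * y (x j))"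
      unfolding prod[OF that] std_gaussian_def by (intro N.product_integrable_prod hint) auto
    have "(\<integral>x. y (x i) * y (x j) \<partial>std_gaussian d) = (\<Prod>k<d. \<integral>x. h i j k x \<partial>std_normal_distribution)"
      unfolding prod[OF that] std_gaussian_def by (intro N.product_integral_prod hint) auto
    also have "\<dots> = (if i = j then 2 else 0)"
    proof (cases "i = j")
      case True
      then have "(\<integral>x. h i j k x \<partial>std_normal_distribution) = (if k = i then 2 else 1)" for k
        using std_normal_centred_square(4) N.M.prob_space by (simp add: h_def y_def power2_eq_square)
      then show ?thesis using True that by simp
    next
      case False
      then have "(\<integral>x. h i j i x \<partial>std_normal_distribution) = 0"
        using std_normal_centred_square(3) by (simp add: h_def y_def)
      then show ?thesis using False that by (auto intro!: prod_zero bexI[of _ i])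
    qed
    finally show "(\<integral>x. y (x i) * y (x j) \<partial>std_gaussian d) = (if i = j then 2 else 0)" .
  qed
  have sq: "(\<Sum>i<d. (x i)\<^sup>2 - 1)\<^sup>2 = (\<Sum>i<d. \<Sum>j<d. y (x i) * y (x j))" for x
    by (simp add: y_def power2_eq_square sum_product)
  show "integrable (std_gaussian d) (\<lambda>x. (\<Sum>i<d. (x i)\<^sup>2 - 1)\<^sup>2)"
    unfolding sq using int by (intro Bochner_Integration.integrable_sum) auto
  have "(\<integral>x. (\<Sum>i<d. (x i)\<^sup>2 - 1)\<^sup>2 \<partial>std_gaussian d) = (\<Sum>i<d. \<Sum>j<d. \<integral>x. y (x i) * y (x j) \<partial>std_gaussian d)"
    unfolding sq using int
    by (subst Bochner_Integration.integral_sum)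
      (auto intro!: Bochner_Integration.integrable_sum sum.cong Bochner_Integration.integral_sum)
  also have "\<dots> = 2 * real d" by (simp add: val)
  finally show "(\<integral>x. (\<Sum>i<d. (x i)\<^sup>2 - 1)\<^sup>2 \<partial>std_gaussian d) = 2 * real d" .
qed

text \<open>Chebyshev's inequality: the squared deviation of the sum has mean
  \<open>2 * real d\<close> and is compared with \<open>(\<delta> * real d)\<^sup>2\<close>.\<close>

lemma std_gaussian_radius_concentration:
  assumes d: "0 < d" and \<delta>: "0 < \<delta>"
  shows "measure (std_gaussian d) {x \<in> space (std_gaussian d). \<delta> \<le> \<bar>vinner d x x / real d - 1\<bar>} \<le> 2 / (\<delta>\<^sup>2 * real d)"
proof -
  interpret G: prob_space "std_gaussian d" by (rule prob_space_std_gaussian)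
  let ?u = "\<lambda>x::vec. (\<Sum>i<d. (x i)\<^sup>2 - 1)\<^sup>2"
  have "\<delta> \<le> \<bar>vinner d x x / real d - 1\<bar> \<longleftrightarrow> (\<delta> * real d)\<^sup>2 \<le> ?u x" for x
  proof -
    have "vinner d x x / real d - 1 = (\<Sum>i<d. (x i)\<^sup>2 - 1) / real d"
      using d by (simp add: vinner_def sum_subtractf power2_eq_square diff_divide_distrib)
    then have "\<delta> \<le> \<bar>vinner d x x / real d - 1\<bar> \<longleftrightarrow> \<bar>\<delta> * real d\<bar> \<le> \<bar>\<Sum>i<d. (x i)\<^sup>2 - 1\<bar>"
      using d \<delta> by (simp add: abs_divide abs_mult field_simps)
    then show ?thesis by (simp only: abs_le_square_iff)
  qed
  then have "measure (std_gaussian d) {x \<in> space (std_gaussian d). \<delta> \<le> \<bar>vinner d x x / real d - 1\<bar>} =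
      measure (std_gaussian d) {x \<in> space (std_gaussian d). (\<delta> * real d)\<^sup>2 \<le> ?u x}" by simp
  also have "\<dots> \<le> (\<integral>x. ?u x \<partial>std_gaussian d) / (\<delta> * real d)\<^sup>2"
    using d \<delta> by (intro integral_Markov_inequality_measure[of _ _ "{}"] std_gaussian_square_deviation) auto
  also have "\<dots> = 2 / (\<delta>\<^sup>2 * real d)"
    using d unfolding std_gaussian_square_deviation(2) by (simp add: power2_eq_square)
  finally show ?thesis .
qed

text \<open>Finiteness comes from \<open>a / a \<le> 1\<close> in the extended nonnegative reals,
  without computing the volume of the ball. Total mass 1 is deduced in \<open>initial_law\<close>
  from the law of the process.\<close>

lemma finite_sphere_uniform: "finite_measure (sphere_uniform d)"
proof -
  let ?L = "PiM {..<d} (\<lambda>_. lborel :: real measure)" and ?B = "{x \<in> space (vec_space d). vnorm d x \<le> 1}"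
  have "emeasure (uniform_measure ?L ?B) (space (uniform_measure ?L ?B)) \<noteq> \<infinity>"
  proof (cases "?B \<in> sets ?L")
    case True
    have le: "a / a \<le> 1" for a :: ennreal by (cases "a = 0 \<or> a = top") (auto simp: less_top)
    have "emeasure (uniform_measure ?L ?B) (space ?L) \<le> 1"
      using True le sets.sets_into_space[OF True] by (subst emeasure_uniform_measure) (auto simp: Int_absorb2)
    then show ?thesis by (auto simp: top_unique)
  next
    case False
    have "vec_space d = PiM {..<d} (\<lambda>_. borel)" by (simp add: vec_space_def)
    moreover have "?B \<in> sets (vec_space d)"
      unfolding L2_set_def vec_space_def by measurable
    ultimately have "?B \<in> sets ?L" by (simp cong: sets_PiM_cong)
    with False show ?thesis by blast
  qed
  then have "finite_measure (uniform_measure ?L ?B)" by (rule finite_measureI)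
  then interpret U: finite_measure "uniform_measure ?L ?B" .
  show ?thesis
    unfolding sphere_uniform_def
  proof (rule U.finite_measure_distr)
    have "vdir d \<in> vec_space d \<rightarrow>\<^sub>M vec_space d"
      unfolding vdir_def L2_set_def vec_space_def by measurable
    moreover have "sets (uniform_measure ?L ?B) = sets (vec_space d)"
      unfolding vec_space_def by (auto intro!: sets_PiM_cong)
    ultimately show "vdir d \<in> uniform_measure ?L ?B \<rightarrow>\<^sub>M vec_space d" by (simp cong: measurable_cong_sets)
  qed
qed

lemma sets_sphere_uniform [measurable_cong, simp]: "sets (sphere_uniform d) = sets (vec_space d)"
  by (simp add: sphere_uniform_def)

text \<open>Given the velocity, the scalar product is standard normal by rotation invariance.\<close>

lemma initial_law:
  fixes M :: "'w measure"
  assumes M: "prob_space M" and XV: "(\<lambda>\<omega>. (X \<omega>, V \<omega>)) \<in> M \<rightarrow>\<^sub>M state_space d"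
    and law: "distr M (state_space d) (\<lambda>\<omega>. (X \<omega>, V \<omega>)) = std_gaussian d \<Otimes>\<^sub>M sphere_uniform d"
    and unit: "\<And>\<omega>. \<omega> \<in> space M \<Longrightarrow> vinner d (V \<omega>) (V \<omega>) = 1"
  shows "distr M borel (\<lambda>\<omega>. vinner d (X \<omega>) (V \<omega>)) = std_normal_distribution"
    and "distr M (vec_space d) X = std_gaussian d"
proof -
  interpret M: prob_space M by fact
  interpret G: prob_space "std_gaussian d" by (rule prob_space_std_gaussian)
  interpret S: finite_measure "sphere_uniform d" by (rule finite_sphere_uniform)
  interpret P: pair_sigma_finite "std_gaussian d" "sphere_uniform d" ..
  interpret L: prob_space "std_gaussian d \<Otimes>\<^sub>M sphere_uniform d"
    unfolding law[symmetric] by (rule M.prob_space_distr[OF XV])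
  have X [measurable]: "X \<in> M \<rightarrow>\<^sub>M vec_space d" and V [measurable]: "V \<in> M \<rightarrow>\<^sub>M vec_space d"
    using measurable_compose[OF XV measurable_fst] measurable_compose[OF XV measurable_snd] by simp_all
  \<comment> \<open>The product measure is the law of a random variable and its first factor is a
    probability measure, so the second factor has mass 1.\<close>
  have one: "emeasure (sphere_uniform d) (space (sphere_uniform d)) = 1"
  proof -
    have "1 = emeasure (std_gaussian d \<Otimes>\<^sub>M sphere_uniform d) (space (std_gaussian d) \<times> space (sphere_uniform d))"
      using L.emeasure_space_1 by (simp add: space_pair_measure)
    also have "\<dots> = emeasure (sphere_uniform d) (space (sphere_uniform d))"
      unfolding S.emeasure_pair_measure_Times[OF sets.top sets.top] by (simp add: G.emeasure_space_1)
    finally show ?thesis by simp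
  qed
  then interpret S: prob_space "sphere_uniform d" by (rule prob_spaceI)
  \<comment> \<open>That the sphere measure is carried by unit vectors is read off from the
    velocities of the process, through its law at time 0.\<close>
  have "AE \<omega> in M. vinner d (snd (X \<omega>, V \<omega>)) (snd (X \<omega>, V \<omega>)) = 1" using unit by simp
  then have "AE p in std_gaussian d \<Otimes>\<^sub>M sphere_uniform d. vinner d (snd p) (snd p) = 1"
    unfolding law[symmetric] by (subst AE_distr_iff[OF XV]) measurable
  then have "AE x in std_gaussian d. AE v in sphere_uniform d. vinner d (snd (x, v)) (snd (x, v)) = 1"
    by (rule P.AE_pair)
  then have unit_AE: "AE v in sphere_uniform d. vinner d v v = 1"
    using G.AE_const by simp
  have marginal: "emeasure M {\<omega> \<in> space M. (X \<omega>, V \<omega>) \<in> C} =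
      (\<integral>\<^sup>+v. (\<integral>\<^sup>+x. indicator C (x, v) \<partial>std_gaussian d) \<partial>sphere_uniform d)" if C [measurable]: "C \<in> sets (state_space d)" for C
  proof -
    have "emeasure M {\<omega> \<in> space M. (X \<omega>, V \<omega>) \<in> C} = emeasure (distr M (state_space d) (\<lambda>\<omega>. (X \<omega>, V \<omega>))) C"
      by (subst emeasure_distr[OF XV]) (auto intro!: arg_cong2[where f = emeasure])
    also have "\<dots> = (\<integral>\<^sup>+p. indicator C p \<partial>(std_gaussian d \<Otimes>\<^sub>M sphere_uniform d))"
      unfolding law by simp
    also have "\<dots> = (\<integral>\<^sup>+v. (\<integral>\<^sup>+x. indicator C (x, v) \<partial>std_gaussian d) \<partial>sphere_uniform d)"
      by (rule P.nn_integral_snd[symmetric]) simp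
    finally show ?thesis .
  qed
  show "distr M borel (\<lambda>\<omega>. vinner d (X \<omega>) (V \<omega>)) = std_normal_distribution"
  proof (rule measure_eqI)
    fix B assume "B \<in> sets (distr M borel (\<lambda>\<omega>. vinner d (X \<omega>) (V \<omega>)))"
    then have B [measurable]: "B \<in> sets borel" by simp
    let ?C = "{p \<in> space (state_space d). vinner d (fst p) (snd p) \<in> B}"
    have "emeasure (distr M borel (\<lambda>\<omega>. vinner d (X \<omega>) (V \<omega>))) B = emeasure M {\<omega> \<in> space M. (X \<omega>, V \<omega>) \<in> ?C}"
      using measurable_space[OF XV] by (subst emeasure_distr) (auto intro!: arg_cong2[where f = emeasure])
    also have "\<dots> = (\<integral>\<^sup>+v. (\<integral>\<^sup>+x. indicator ?C (x, v) \<partial>std_gaussian d) \<partial>sphere_uniform d)"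
      by (rule marginal) measurable
    also have "\<dots> = (\<integral>\<^sup>+v. emeasure std_normal_distribution B \<partial>sphere_uniform d)"
    proof (rule nn_integral_cong_AE)
      show "AE v in sphere_uniform d. (\<integral>\<^sup>+x. indicator ?C (x, v) \<partial>std_gaussian d) = emeasure std_normal_distribution B"
        using unit_AE AE_space
      proof eventually_elim
        case (elim v)
        then have v: "v \<in> space (vec_space d)" using sets_eq_imp_space_eq[OF sets_sphere_uniform] by simp
        have [measurable]: "(\<lambda>x. vinner d x v) \<in> borel_measurable (std_gaussian d)" using v by measurable
        have "(\<integral>\<^sup>+x. indicator ?C (x, v) \<partial>std_gaussian d) = (\<integral>\<^sup>+x. indicator B (vinner d x v) \<partial>std_gaussian d)"
          using v sets_eq_imp_space_eq[OF sets_std_gaussian]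
          by (intro nn_integral_cong) (auto simp: space_pair_measure split: split_indicator)
        also have "\<dots> = (\<integral>\<^sup>+y. indicator B y \<partial>distr (std_gaussian d) borel (\<lambda>x. vinner d x v))"
          by (subst nn_integral_distr) auto
        finally show ?case unfolding distr_vinner_std_gaussian[OF elim(1)] by simp
      qed
    qed
    finally show "emeasure (distr M borel (\<lambda>\<omega>. vinner d (X \<omega>) (V \<omega>))) B = emeasure std_normal_distribution B"
      by (simp add: S.emeasure_space_1)
  qed simp
  show "distr M (vec_space d) X = std_gaussian d"
  proof (rule measure_eqI)
    fix B assume "B \<in> sets (distr M (vec_space d) X)"
    then have B [measurable]: "B \<in> sets (vec_space d)" by simp
    have "emeasure (distr M (vec_space d) X) B = emeasure M {\<omega> \<in> space M. (X \<omega>, V \<omega>) \<in> B \<times> space (vec_space d)}"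
      using measurable_space[OF V] by (subst emeasure_distr) (auto intro!: arg_cong2[where f = emeasure])
    also have "\<dots> = (\<integral>\<^sup>+v. (\<integral>\<^sup>+x. indicator (B \<times> space (vec_space d)) (x, v) \<partial>std_gaussian d) \<partial>sphere_uniform d)"
      by (rule marginal) measurable
    also have "\<dots> = (\<integral>\<^sup>+v. emeasure (std_gaussian d) B \<partial>sphere_uniform d)"
      using sets_eq_imp_space_eq[OF sets_sphere_uniform]
      by (intro nn_integral_cong) (simp add: indicator_times)
    finally show "emeasure (distr M (vec_space d) X) B = emeasure (std_gaussian d) B"
      by (simp add: S.emeasure_space_1)
  qed simp
qed

section \<open>Weak convergence\<close>

definition path_functional :: "((real \<Rightarrow> real) \<Rightarrow> real) \<Rightarrow> (nat \<Rightarrow> real \<times> real) \<Rightarrow> real" where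
  "path_functional g x = (if x \<in> jump_data then g (data_path x) else 0)"

text \<open>The expectation of a path functional for the chain started in a fixed state. Processes
  on different spaces become comparable through this function of the initial state.\<close>

definition chain_mean :: "((real \<Rightarrow> real) \<Rightarrow> real) \<Rightarrow> (real \<Rightarrow> real) \<Rightarrow> real \<Rightarrow> real \<times> real \<times> real \<Rightarrow> real" where
  "chain_mean g \<theta> \<epsilon> z = (\<integral>\<omega>. path_functional g (chain_data (chain \<theta> \<epsilon> z \<omega>)) \<partial>noise)"

locale bounded_path_functional =
  fixes g :: "(real \<Rightarrow> real) \<Rightarrow> real" and B :: real
  assumes cont: "continuous_map skorokhod euclideanreal g"
    and bound: "\<And>y. y \<in> cadlag_paths \<Longrightarrow> \<bar>g y\<bar> \<le> B" and B_nonneg: "0 \<le> B"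
begin

lemma bound_functional: "\<bar>path_functional g x\<bar> \<le> B"
  using bound data_path_cadlag B_nonneg by (simp add: path_functional_def)

lemma measurable_functional [measurable]:
  "path_functional g \<in> borel_measurable (PiM UNIV (\<lambda>_. borel))"
  using measurable_path_functional[OF cont] by (simp add: path_functional_def[abs_def])

lemma measurable_functional_data:
  assumes "\<And>n. Z n \<in> L \<rightarrow>\<^sub>M chain_space"
  shows "(\<lambda>\<omega>. path_functional g (chain_data (\<lambda>n. Z n \<omega>))) \<in> borel_measurable L"
proof -
  have "(\<lambda>\<omega> n. Z n \<omega>) \<in> L \<rightarrow>\<^sub>M PiM UNIV (\<lambda>_. chain_space)"
    by (intro measurable_PiM_single') (use assms measurable_space[OF assms] in auto)
  from measurable_compose[OF measurable_compose[OF this measurable_chain_data] measurable_functional]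
  show ?thesis .
qed

lemma measurable_functional_chain [measurable]:
  assumes [measurable]: "\<theta> \<in> borel_measurable borel"
  shows "(\<lambda>\<omega>. path_functional g (chain_data (chain \<theta> \<epsilon> z \<omega>))) \<in> borel_measurable noise"
    and "(\<lambda>p. path_functional g (chain_data (chain \<theta> \<epsilon> (fst p) (snd p)))) \<in> borel_measurable (chain_space \<Otimes>\<^sub>M noise)"
  using measurable_functional_data[of "\<lambda>n \<omega>. chain \<theta> \<epsilon> z \<omega> n" noise]
    measurable_functional_data[of "\<lambda>n p. chain \<theta> \<epsilon> (fst p) (snd p) n" "chain_space \<Otimes>\<^sub>M noise"]
  by (simp_all add: space_pair_measure)

lemma bound_chain_mean:
  "\<bar>chain_mean g \<theta> \<epsilon> z\<bar> \<le> B"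
proof -
  have "\<bar>chain_mean g \<theta> \<epsilon> z\<bar> \<le> (\<integral>\<omega>. B \<partial>noise)"
    unfolding chain_mean_def using bound_functional
    by (intro integral_abs_bound[THEN order_trans] integral_mono_AE') (auto simp: B_nonneg)
  then show ?thesis using noise.P.prob_space by simp
qed

text \<open>Dominated convergence: for good noise the driven chains converge step by step, so their
  paths converge in the Skorokhod sense and \<open>g\<close> follows. Starting points may vary along
  the sequence, which gives convergence uniform on compact sets later on.\<close>

lemma tendsto_chain_mean:
  assumes [measurable]: "\<And>j. \<theta> j \<in> borel_measurable borel" "\<theta>' \<in> borel_measurable borel"
    and pos: "\<And>j e. 0 < e \<Longrightarrow> 0 \<le> \<theta> j e" "\<And>e. 0 < e \<Longrightarrow> 0 \<le> \<theta>' e"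
    and lim: "\<And>e. 0 < e \<Longrightarrow> (\<lambda>j. \<theta> j e) \<longlonglongrightarrow> \<theta>' e" "\<epsilon> \<longlonglongrightarrow> \<epsilon>'" "z \<longlonglongrightarrow> z'"
  shows "(\<lambda>j. chain_mean g (\<theta> j) (\<epsilon> j) (z j)) \<longlonglongrightarrow> chain_mean g \<theta>' \<epsilon>' z'"
  unfolding chain_mean_def
proof (rule integral_dominated_convergence[where w = "\<lambda>_. B"])
  show "AE \<omega> in noise. (\<lambda>j. path_functional g (chain_data (chain (\<theta> j) (\<epsilon> j) (z j) \<omega>)))
      \<longlonglongrightarrow> path_functional g (chain_data (chain \<theta>' \<epsilon>' z' \<omega>))"
    using AE_good_noise
  proof eventually_elim
    case (elim \<omega>)
    then have \<omega>: "0 < \<omega> (Suc i)" for i by (simp add: good_noise_def)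
    have data: "chain_data (chain \<theta>' \<epsilon>' z' \<omega>) \<in> jump_data" "chain_data (chain (\<theta> j) (\<epsilon> j) (z j) \<omega>) \<in> jump_data" for j
      using chain_data_jump_data[OF elim] pos by blast+
    moreover have "(\<lambda>j. chain (\<theta> j) (\<epsilon> j) (z j) \<omega> n) \<longlonglongrightarrow> chain \<theta>' \<epsilon>' z' \<omega> n" for n
      by (rule tendsto_chain) (use lim \<omega> in auto)
    ultimately have "(\<lambda>j. g (data_path (chain_data (chain (\<theta> j) (\<epsilon> j) (z j) \<omega>)))) \<longlonglongrightarrow>
        g (data_path (chain_data (chain \<theta>' \<epsilon>' z' \<omega>)))"
      by (intro continuous_map_data_path_tendsto[OF cont] tendsto_chain_data) auto
    then show ?case using data by (simp add: path_functional_def)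
  qed
qed (use bound_functional in auto)

text \<open>\<open>Z\<close> lives on an arbitrary space. Its law is that of the driven chain with
  the same initial law and independent noise, where Fubini integrates out the noise first.\<close>

lemma integral_markov_chain_functional:
  fixes M :: "'w measure"
  assumes [measurable]: "\<theta> \<in> borel_measurable borel"
    and Z: "markov_chain M chain_space (expo \<Otimes>\<^sub>M expo) (chain_step \<theta> \<epsilon>) Z"
  shows "(\<integral>\<omega>. path_functional g (chain_data (\<lambda>n. Z n \<omega>)) \<partial>M) = (\<integral>\<omega>. chain_mean g \<theta> \<epsilon> (Z 0 \<omega>) \<partial>M)"
proof -
  interpret M: prob_space M using Z by (simp add: markov_chain_def)
  have Zm [measurable]: "Z n \<in> M \<rightarrow>\<^sub>M chain_space" for n using Z by (simp add: markov_chain_def)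
  interpret E: prob_space expo by (rule prob_space_expo)
  interpret EE: pair_prob_space expo expo ..
  let ?\<Lambda> = "distr M chain_space (Z 0)" and ?S = "PiM UNIV (\<lambda>_::nat. chain_space)"
  interpret L: prob_space ?\<Lambda> by (rule M.prob_space_distr) simp
  interpret P: pair_prob_space ?\<Lambda> noise ..
  have seq: "(\<lambda>\<omega> n. Z n \<omega>) \<in> M \<rightarrow>\<^sub>M ?S"
    by (intro measurable_PiM_single') (use measurable_space[OF Zm] in auto)
  have seq': "(\<lambda>p n. chain \<theta> \<epsilon> (fst p) (snd p) n) \<in> ?\<Lambda> \<Otimes>\<^sub>M noise \<rightarrow>\<^sub>M ?S"
    by (intro measurable_PiM_single') (auto simp: space_pair_measure)
  have law: "distr M ?S (\<lambda>\<omega> n. Z n \<omega>) = distr (?\<Lambda> \<Otimes>\<^sub>M noise) ?S (\<lambda>p n. chain \<theta> \<epsilon> (fst p) (snd p) n)"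
  proof (rule markov_chain_law_eq[OF Z])
    show "markov_chain (?\<Lambda> \<Otimes>\<^sub>M noise) chain_space (expo \<Otimes>\<^sub>M expo) (chain_step \<theta> \<epsilon>) (\<lambda>n p. chain \<theta> \<epsilon> (fst p) (snd p) n)"
      by (rule markov_chain_pair_noise) (auto intro: L.prob_space_axioms)
    have "distr (?\<Lambda> \<Otimes>\<^sub>M noise) ?\<Lambda> fst = ?\<Lambda>"
      by (rule noise.P.distr_pair_fst)
    then show "distr M chain_space (Z 0) = distr (?\<Lambda> \<Otimes>\<^sub>M noise) chain_space (\<lambda>p. chain \<theta> \<epsilon> (fst p) (snd p) 0)"
      by (simp cong: distr_cong)
    show "sigma_finite_measure (expo \<Otimes>\<^sub>M expo)" by unfold_locales
    show "(\<lambda>(z, p). chain_step \<theta> \<epsilon> z p) \<in> chain_space \<Otimes>\<^sub>M (expo \<Otimes>\<^sub>M expo) \<rightarrow>\<^sub>M chain_space" by measurable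
  qed
  have F: "(\<lambda>z. path_functional g (chain_data z)) \<in> borel_measurable ?S"
    by (rule measurable_compose[OF measurable_chain_data measurable_functional])
  have "(\<integral>\<omega>. path_functional g (chain_data (\<lambda>n. Z n \<omega>)) \<partial>M) = (\<integral>z. path_functional g (chain_data z) \<partial>distr M ?S (\<lambda>\<omega> n. Z n \<omega>))"
    by (rule integral_distr[OF seq F, symmetric])
  also have "\<dots> = (\<integral>p. path_functional g (chain_data (chain \<theta> \<epsilon> (fst p) (snd p))) \<partial>(?\<Lambda> \<Otimes>\<^sub>M noise))"
    unfolding law by (subst integral_distr[OF seq' F]) simp
  also have "\<dots> = (\<integral>z. chain_mean g \<theta> \<epsilon> z \<partial>?\<Lambda>)"
    unfolding chain_mean_def
    by (subst P.integral_fst'[symmetric])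
      (auto intro!: P.integrable_const_bound[where B = B] simp: bound_functional)
  also have "\<dots> = (\<integral>\<omega>. chain_mean g \<theta> \<epsilon> (Z 0 \<omega>) \<partial>M)"
  proof (rule integral_distr)
    show "chain_mean g \<theta> \<epsilon> \<in> borel_measurable chain_space"
      unfolding chain_mean_def[abs_def]
      by (rule noise.borel_measurable_lebesgue_integral) (simp add: split_beta')
  qed simp
  finally show ?thesis .
qed

lemma measurable_chain_mean [measurable]:
  "\<theta> \<in> borel_measurable borel \<Longrightarrow> chain_mean g \<theta> \<epsilon> \<in> borel_measurable chain_space"
  unfolding chain_mean_def[abs_def]
  by (rule noise.borel_measurable_lebesgue_integral) (simp add: split_beta')

abbreviation "limit_mean r \<equiv> chain_mean g rayleigh_quantile 0 (0, r, 1)"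

text \<open>The convergence is continuous in the initial value, hence locally uniform.\<close>

lemma chain_mean_locally_uniform:
  assumes e: "0 < e"
  shows "\<exists>n. \<forall>d\<ge>n. \<forall>r a. \<bar>r\<bar> \<le> m \<longrightarrow> \<bar>a - 1\<bar> \<le> 1 / real (Suc n) \<longrightarrow>
    \<bar>chain_mean g (radial_scale d) (1 / real d) (0, r, a) - limit_mean r\<bar> \<le> e"
proof (rule ccontr)
  assume "\<not> ?thesis"
  then obtain d r a where d: "\<And>n. n \<le> d n" and r: "\<And>n. \<bar>r n\<bar> \<le> m" and a: "\<And>n. \<bar>a n - 1\<bar> \<le> 1 / real (Suc n)"
    and far: "\<And>n. e < \<bar>chain_mean g (radial_scale (d n)) (1 / real (d n)) (0, r n, a n) - limit_mean (r n)\<bar>"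
    unfolding not_ex not_all not_imp not_le by metis
  \<comment> \<open>Compactness of the range of initial values: along a subsequence both means tend
    to \<open>limit_mean l\<close>, which contradicts the gap \<open>e\<close>.\<close>
  have "bounded (range r)" using r by (auto simp: bounded_iff)
  then obtain s l where s: "strict_mono s" "(r \<circ> s) \<longlonglongrightarrow> l"
    using bounded_imp_convergent_subsequence by blast
  have dtop: "filterlim d at_top sequentially"
    by (rule filterlim_at_top_mono[OF filterlim_ident always_eventually]) (use d in auto)
  have ds: "filterlim (\<lambda>n. d (s n)) at_top sequentially"
    by (rule filterlim_compose[OF dtop filterlim_subseq[OF s(1)]])
  have "(\<lambda>n. a n - 1) \<longlonglongrightarrow> 0"
    by (rule Lim_null_comparison[OF _ LIMSEQ_Suc[OF lim_1_over_n]]) (use a in auto)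
  then have "a \<longlonglongrightarrow> 1" by (simp add: LIM_zero_iff)
  then have as: "(\<lambda>n. a (s n)) \<longlonglongrightarrow> 1" using LIMSEQ_subseq_LIMSEQ[OF _ s(1)] by (force simp: comp_def)
  have rs: "(\<lambda>n. r (s n)) \<longlonglongrightarrow> l" using s(2) by (simp add: comp_def)
  have "(\<lambda>n. chain_mean g (radial_scale (d (s n))) (1 / real (d (s n))) (0, r (s n), a (s n))) \<longlonglongrightarrow> limit_mean l"
  proof (rule tendsto_chain_mean)
    show "(\<lambda>n. radial_scale (d (s n)) e) \<longlonglongrightarrow> rayleigh_quantile e" if "0 < e" for e
      by (rule filterlim_compose[OF radial_scale_tendsto[OF that] ds])
    show "(\<lambda>n. 1 / real (d (s n))) \<longlonglongrightarrow> 0"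
      by (rule filterlim_compose[OF lim_1_over_n ds])
  qed (auto intro!: tendsto_intros rs as radial_scale_nonneg rayleigh_quantile_nonneg)
  moreover have "(\<lambda>n. limit_mean (r (s n))) \<longlonglongrightarrow> limit_mean l"
    by (rule tendsto_chain_mean) (auto intro!: tendsto_intros rs rayleigh_quantile_nonneg)
  ultimately have "(\<lambda>n. \<bar>chain_mean g (radial_scale (d (s n))) (1 / real (d (s n))) (0, r (s n), a (s n)) - limit_mean (r (s n))\<bar>) \<longlonglongrightarrow>
      \<bar>limit_mean l - limit_mean l\<bar>"
    by (intro tendsto_intros)
  then have "\<forall>\<^sub>F n in sequentially.
      \<bar>chain_mean g (radial_scale (d (s n))) (1 / real (d (s n))) (0, r (s n), a (s n)) - limit_mean (r (s n))\<bar> < e"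
    using e by (intro order_tendstoD(2)) auto
  then show False using far by (auto simp: eventually_sequentially dest: less_asym)
qed

text \<open>Marginal information suffices: \<open>\<rho> d\<close> has the same law for all
  \<open>d\<close>, which gives tightness and fixes the limiting integral, while
  \<open>\<alpha> d\<close> concentrates at 1. Outside two events of small probability the mean is
  replaced by \<open>limit_mean\<close> with a uniform error.\<close>

lemma weak_limit:
  fixes M :: "nat \<Rightarrow> 'w measure" and \<rho> \<alpha> :: "nat \<Rightarrow> 'w \<Rightarrow> real"
  assumes prob: "\<And>d. 2 \<le> d \<Longrightarrow> prob_space (M d)"
    and \<rho> [measurable]: "\<And>d. 2 \<le> d \<Longrightarrow> \<rho> d \<in> borel_measurable (M d)"
    and \<alpha> [measurable]: "\<And>d. 2 \<le> d \<Longrightarrow> \<alpha> d \<in> borel_measurable (M d)"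
    and normal: "\<And>d. 2 \<le> d \<Longrightarrow> distr (M d) borel (\<rho> d) = std_normal_distribution"
    and conc: "\<And>d \<delta>. 2 \<le> d \<Longrightarrow> 0 < \<delta> \<Longrightarrow>
      measure (M d) {\<omega> \<in> space (M d). \<delta> \<le> \<bar>\<alpha> d \<omega> - 1\<bar>} \<le> 2 / (\<delta>\<^sup>2 * real d)"
  shows "(\<lambda>d. \<integral>\<omega>. chain_mean g (radial_scale d) (1 / real d) (0, \<rho> d \<omega>, \<alpha> d \<omega>) \<partial>M d)
    \<longlonglongrightarrow> (\<integral>r. limit_mean r \<partial>std_normal_distribution)"
proof (rule LIMSEQ_I)
  fix e :: real assume e: "0 < e"
  interpret N: real_distribution std_normal_distribution by (rule real_distribution_std_normal)
  \<comment> \<open>The error is at most \<open>e'\<close> on the good event and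
    \<open>2 * B\<close> on a bad event of probability below \<open>2 * e'\<close>, together
    \<open>e' * (1 + 4 * B)\<close>. The 2 in the denominator makes the final inequality
    strict.\<close>
  define e' where "e' = e / (2 + 4 * B)"
  have e': "0 < e'" "e' * (1 + 4 * B) < e" using e B_nonneg by (auto simp: e'_def field_simps)
  have "(\<lambda>n. measure std_normal_distribution {- real n..real n}) \<longlonglongrightarrow> measure std_normal_distribution (\<Union>n. {- real n..real n})"
    by (rule N.finite_Lim_measure_incseq) (auto simp: incseq_def)
  moreover have "(\<Union>n. {- real n..real n}) = UNIV"
  proof -
    have "\<exists>n. x \<in> {- real n..real n}" for x
      using real_arch_simple[of "\<bar>x\<bar>"] by (force simp: abs_le_iff)
    then show ?thesis by blast
  qed
  ultimately have "(\<lambda>n. measure std_normal_distribution {- real n..real n}) \<longlonglongrightarrow> 1"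
    using N.prob_space by simp
  then have "\<forall>\<^sub>F n in sequentially. 1 - e' < measure std_normal_distribution {- real n..real n}"
    using e' by (intro order_tendstoD(1)) auto
  then obtain m where m: "1 - e' < measure std_normal_distribution {- real m..real m}"
    by (auto simp: eventually_sequentially)
  obtain n where n: "\<And>d r a. n \<le> d \<Longrightarrow> \<bar>r\<bar> \<le> real m \<Longrightarrow> \<bar>a - 1\<bar> \<le> 1 / real (Suc n) \<Longrightarrow>
      \<bar>chain_mean g (radial_scale d) (1 / real d) (0, r, a) - limit_mean r\<bar> \<le> e'"
    using chain_mean_locally_uniform[OF e'(1), of "real m"] by blast
  define \<delta> where "\<delta> = 1 / real (Suc n)"
  have \<delta>: "0 < \<delta>" by (simp add: \<delta>_def)
  have "(\<lambda>d. 2 / \<delta>\<^sup>2 * (1 / real d)) \<longlonglongrightarrow> 2 / \<delta>\<^sup>2 * 0"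
    by (intro tendsto_mult tendsto_const lim_1_over_n)
  then have "\<forall>\<^sub>F d in sequentially. 2 / \<delta>\<^sup>2 * (1 / real d) < e'"
    using e' by (intro order_tendstoD(2)) auto
  then have "\<forall>\<^sub>F d in sequentially. norm ((\<integral>\<omega>. chain_mean g (radial_scale d) (1 / real d) (0, \<rho> d \<omega>, \<alpha> d \<omega>) \<partial>M d)
      - (\<integral>r. limit_mean r \<partial>std_normal_distribution)) < e"
    using eventually_ge_at_top[of "max 2 n"]
  proof eventually_elim
    case (elim d)
    then have d: "2 \<le> d" "n \<le> d" by auto
    interpret M: prob_space "M d" by (rule prob[OF d(1)])
    note [measurable] = \<rho>[OF d(1)] \<alpha>[OF d(1)]
    let ?H = "\<lambda>\<omega>. chain_mean g (radial_scale d) (1 / real d) (0, \<rho> d \<omega>, \<alpha> d \<omega>)"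
    let ?L = "\<lambda>\<omega>. limit_mean (\<rho> d \<omega>)"
    let ?b1 = "{\<omega> \<in> space (M d). \<not> \<bar>\<rho> d \<omega>\<bar> \<le> real m}" and ?b2 = "{\<omega> \<in> space (M d). \<delta> \<le> \<bar>\<alpha> d \<omega> - 1\<bar>}"
    have Hm [measurable]: "?H \<in> borel_measurable (M d)"
      by (rule measurable_compose[OF _ measurable_chain_mean]) auto
    have Lm [measurable]: "?L \<in> borel_measurable (M d)"
      by (rule measurable_compose[OF _ measurable_chain_mean]) auto
    have int: "integrable (M d) ?H" "integrable (M d) ?L"
      by (rule M.integrable_const_bound[where B = B]; simp add: bound_chain_mean)+
    have "measure (M d) ?b1 < e'"
    proof -
      have "measure (M d) ?b1 = measure (distr (M d) borel (\<rho> d)) (- {- real m..real m})"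
        by (subst measure_distr) (auto intro!: arg_cong2[where f = measure] simp: abs_le_iff)
      also have "\<dots> = 1 - measure std_normal_distribution {- real m..real m}"
        unfolding normal[OF d(1)] using N.prob_compl[of "{- real m..real m}"] by (simp add: Compl_eq_Diff_UNIV)
      finally show ?thesis using m by simp
    qed
    moreover have "measure (M d) ?b2 < e'"
      using conc[OF d(1) \<delta>] elim(1) by (simp add: field_simps)
    ultimately have bad: "measure (M d) ?b1 + measure (M d) ?b2 < 2 * e'" by simp
    have "(\<integral>r. limit_mean r \<partial>std_normal_distribution) = (\<integral>\<omega>. ?L \<omega> \<partial>M d)"
      unfolding normal[OF d(1), symmetric]
      by (rule integral_distr) (auto intro!: measurable_compose[OF _ measurable_chain_mean])
    then have "norm ((\<integral>\<omega>. ?H \<omega> \<partial>M d) - (\<integral>r. limit_mean r \<partial>std_normal_distribution)) = \<bar>\<integral>\<omega>. ?H \<omega> - ?L \<omega> \<partial>M d\<bar>"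
      using int by simp
    also have "\<dots> \<le> (\<integral>\<omega>. \<bar>?H \<omega> - ?L \<omega>\<bar> \<partial>M d)" by (rule integral_abs_bound)
    also have "\<dots> \<le> (\<integral>\<omega>. e' + 2 * B * (indicator ?b1 \<omega> + indicator ?b2 \<omega>) \<partial>M d)"
    proof (rule integral_mono)
      show "integrable (M d) (\<lambda>\<omega>. \<bar>?H \<omega> - ?L \<omega>\<bar>)" using int by simp
      show "integrable (M d) (\<lambda>\<omega>. e' + 2 * B * (indicator ?b1 \<omega> + indicator ?b2 \<omega>))"
        by (intro Bochner_Integration.integrable_add integrable_mult_right M.integrable_const integrable_real_indicator)
          (auto simp: M.emeasure_eq_measure)
      fix \<omega> assume \<omega>: "\<omega> \<in> space (M d)"
      show "\<bar>?H \<omega> - ?L \<omega>\<bar> \<le> e' + 2 * B * (indicator ?b1 \<omega> + indicator ?b2 \<omega>)"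
      proof (cases "\<omega> \<in> ?b1 \<or> \<omega> \<in> ?b2")
        case True
        have "\<bar>?H \<omega> - ?L \<omega>\<bar> \<le> B + B"
          using bound_chain_mean by (intro abs_triangle_ineq4[THEN order_trans] add_mono)
        also have "\<dots> = 2 * B * 1" by simp
        also have "\<dots> \<le> 2 * B * (indicator ?b1 \<omega> + indicator ?b2 \<omega>)"
          using True B_nonneg by (intro mult_left_mono) (auto simp: indicator_def)
        finally show ?thesis using e' by simp
      next
        case False
        then have "\<bar>\<rho> d \<omega>\<bar> \<le> real m" "\<bar>\<alpha> d \<omega> - 1\<bar> \<le> 1 / real (Suc n)"
          using \<omega> by (auto simp: \<delta>_def)
        from n[OF d(2) this] show ?thesis using B_nonneg by (simp add: indicator_def)
      qed
    qed
    also have "\<dots> = e' + 2 * B * (measure (M d) ?b1 + measure (M d) ?b2)"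
      by (subst Bochner_Integration.integral_add)
        (auto simp: M.prob_space M.emeasure_eq_measure)
    also have "\<dots> \<le> e' + 2 * B * (2 * e')"
      using bad B_nonneg by (intro add_left_mono mult_left_mono) auto
    also have "\<dots> < e" using e' by (simp add: algebra_simps)
    finally show ?case .
  qed
  then show "\<exists>no. \<forall>d\<ge>no. norm ((\<integral>\<omega>. chain_mean g (radial_scale d) (1 / real d) (0, \<rho> d \<omega>, \<alpha> d \<omega>) \<partial>M d)
      - (\<integral>r. limit_mean r \<partial>std_normal_distribution)) < e"
    by (simp add: eventually_sequentially)
qed

end

section \<open>The limit process and its compensator\<close>

text \<open>A \<open>pdmp\<close> has to have increasing and divergent jump times for every sample
  point. Exceptional noise is therefore replaced by the constant sequence 1, which belongs to
  \<open>good_noise\<close>.\<close>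

definition tame :: "(nat \<Rightarrow> real) \<Rightarrow> nat \<Rightarrow> real" where
  "tame \<omega> = (if \<omega> \<in> good_noise then \<omega> else (\<lambda>_. 1))"

text \<open>With the radius frozen at 1, a value after a jump is a function of a single coordinate.
  The chain thus has the closed form of \<open>chain_limit\<close>, in which the dependence on
  coordinates is explicit.\<close>

definition jump_value :: "(nat \<Rightarrow> real) \<Rightarrow> nat \<Rightarrow> real" where
  "jump_value \<omega> n = (if n = 0 then \<omega> 0 else - rayleigh_quantile (\<omega> (2 * n)))"

definition jump_time :: "(nat \<Rightarrow> real) \<Rightarrow> nat \<Rightarrow> real" where
  "jump_time \<omega> n = (\<Sum>i<n. wait_time (jump_value \<omega> i) (\<omega> (2 * i + 1)))"

definition limit_path :: "real \<Rightarrow> (nat \<Rightarrow> real) \<Rightarrow> real" where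
  "limit_path t \<omega> = sawtooth (jump_time (tame \<omega>)) (jump_value (tame \<omega>)) t"

lemma tame_good: "tame \<omega> \<in> good_noise"
  by (auto simp: tame_def good_noise_def)

lemma tame_id: "\<omega> \<in> good_noise \<Longrightarrow> tame \<omega> = \<omega>"
  by (simp add: tame_def)

lemma good_noise_measurable [measurable]: "good_noise \<in> sets noise"
proof -
  have "{\<omega> \<in> space noise. (\<forall>i. 0 < \<omega> (Suc i)) \<and> (\<forall>m. \<exists>n\<in>{m..}. 1 \<le> \<omega> (2 * n + 1))} \<in> sets noise"
    by measurable
  also have "{\<omega> \<in> space noise. (\<forall>i. 0 < \<omega> (Suc i)) \<and> (\<forall>m. \<exists>n\<in>{m..}. 1 \<le> \<omega> (2 * n + 1))} = good_noise"
    by (auto simp: good_noise_def)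
  finally show ?thesis .
qed

lemma measurable_tame [measurable]: "tame \<in> noise \<rightarrow>\<^sub>M noise"
proof -
  have "(\<lambda>_. \<lambda>_. 1) \<in> noise \<rightarrow>\<^sub>M noise" by (rule measurable_const) simp
  then show ?thesis unfolding tame_def[abs_def] by measurable
qed

lemma AE_tame: "AE \<omega> in noise. tame \<omega> = \<omega>"
  using AE_good_noise by eventually_elim (rule tame_id)

lemma jump_time_Suc: "jump_time \<omega> (Suc n) = jump_time \<omega> n + wait_time (jump_value \<omega> n) (\<omega> (2 * n + 1))"
  by (simp add: jump_time_def)

lemma chain_limit:
  "chain rayleigh_quantile 0 (0, \<omega> 0, 1) \<omega> n =
    (if n = 0 then 0 else wait_time (jump_value \<omega> (n - 1)) (\<omega> (2 * (n - 1) + 1)), jump_value \<omega> n, 1)"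
  by (induction n) (simp_all add: chain_step_def Let_def jump_value_def)

lemma chain_data_limit:
  "chain_data (chain rayleigh_quantile 0 (0, \<omega> 0, 1) \<omega>) = (\<lambda>n. (jump_time \<omega> n, jump_value \<omega> n))"
  unfolding chain_data_def by (simp only: chain_limit) (simp add: jump_time_def)

lemma jump_times_good: "\<omega> \<in> good_noise \<Longrightarrow> jump_times (jump_time \<omega>)"
  using chain_data_jump_data[of \<omega> rayleigh_quantile 0 "(0, \<omega> 0, 1)"] rayleigh_quantile_nonneg
  unfolding chain_data_limit by (simp add: jump_data_def comp_def)

lemma path_of_limit_path:
  "path_of limit_path \<omega> = data_path (chain_data (chain rayleigh_quantile 0 (0, tame \<omega> 0, 1) (tame \<omega>)))"
  unfolding chain_data_limit path_of_def data_path_def limit_path_def by (simp add: comp_def)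

lemma limit_path_eq:
  "jump_time (tame \<omega>) n \<le> t \<Longrightarrow> t < jump_time (tame \<omega>) (Suc n) \<Longrightarrow>
    limit_path t \<omega> = jump_value (tame \<omega>) n + (t - jump_time (tame \<omega>) n)"
  unfolding limit_path_def by (rule sawtooth_eq[OF jump_times_good[OF tame_good]])

lemma measurable_jump_value [measurable]: "(\<lambda>\<omega>. jump_value \<omega> n) \<in> borel_measurable noise"
  unfolding jump_value_def by measurable

lemma measurable_jump_time [measurable]: "(\<lambda>\<omega>. jump_time \<omega> n) \<in> borel_measurable noise"
  unfolding jump_time_def by measurable

lemma measurable_tame_jumps [measurable]:
  "(\<lambda>\<omega>. jump_value (tame \<omega>) n) \<in> borel_measurable noise"
  "(\<lambda>\<omega>. jump_time (tame \<omega>) n) \<in> borel_measurable noise"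
  by (rule measurable_compose[OF measurable_tame measurable_jump_value])
    (rule measurable_compose[OF measurable_tame measurable_jump_time])

lemma measurable_limit_path [measurable]: "limit_path t \<in> borel_measurable noise"
proof -
  have "(\<lambda>\<omega>. jump_index (jump_time (tame \<omega>)) t) \<in> noise \<rightarrow>\<^sub>M count_space UNIV"
    unfolding jump_index_def by measurable
  then show ?thesis
    unfolding limit_path_def[abs_def] sawtooth_def
    by (rule measurable_compose_countable[rotated]) measurable
qed

section \<open>Events determined by finitely many jumps\<close>

lemma jump_value_cong: "\<omega> (2 * n) = \<omega>' (2 * n) \<Longrightarrow> jump_value \<omega> n = jump_value \<omega>' n"
  by (cases "n = 0") (simp_all add: jump_value_def)

lemma jumps_cong:
  assumes "\<And>i. i < 2 * n + 1 \<Longrightarrow> \<omega> i = \<omega>' i" "k \<le> n"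
  shows "jump_value \<omega> k = jump_value \<omega>' k" "jump_time \<omega> k = jump_time \<omega>' k"
proof -
  have *: "jump_value \<omega> i = jump_value \<omega>' i" if "i \<le> n" for i
    using assms(1)[of "2 * i"] that by (intro jump_value_cong) simp
  then show "jump_value \<omega> k = jump_value \<omega>' k" using assms(2) by simp
  show "jump_time \<omega> k = jump_time \<omega>' k"
    unfolding jump_time_def using assms * by (intro sum.cong) auto
qed

text \<open>Initial value and first \<open>n\<close> jumps involve the coordinates up to
  \<open>2 * n\<close>. The condition is imposed on the raw noise, since \<open>tame\<close> looks
  at all coordinates and would destroy it.\<close>

definition determined_by :: "nat \<Rightarrow> (nat \<Rightarrow> real) set \<Rightarrow> bool" where
  "determined_by n A \<longleftrightarrow> A \<in> sets noise \<and>
     (\<forall>\<omega> \<omega>'. (\<forall>i<2 * n + 1. \<omega> i = \<omega>' i) \<longrightarrow> (\<omega> \<in> A \<longleftrightarrow> \<omega>' \<in> A))"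

lemma nn_integral_determined:
  assumes A: "determined_by n A"
    and f: "(\<lambda>(r, t, p). f r t p) \<in> borel_measurable (borel \<Otimes>\<^sub>M (borel \<Otimes>\<^sub>M (borel \<Otimes>\<^sub>M borel)))"
  shows "(\<integral>\<^sup>+\<omega>\<in>A. f (jump_value \<omega> n) (jump_time \<omega> n) (\<omega> (2 * n + 1), \<omega> (Suc (2 * n + 1))) \<partial>noise) =
    (\<integral>\<^sup>+\<omega>\<in>A. (\<integral>\<^sup>+p. f (jump_value \<omega> n) (jump_time \<omega> n) p \<partial>(expo \<Otimes>\<^sub>M expo)) \<partial>noise)"
proof -
  have [measurable]: "A \<in> sets noise" using A by (simp add: determined_by_def)
  have m: "(\<lambda>q. f (jump_value (fst q) n) (jump_time (fst q) n) (snd q)) \<in> borel_measurable (noise \<Otimes>\<^sub>M (borel \<Otimes>\<^sub>M borel))"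
    using measurable_compose[OF _ f, of "\<lambda>q. (jump_value (fst q) n, jump_time (fst q) n, snd q)"] by simp
  have m': "(\<lambda>p. f r t p) \<in> borel_measurable (expo \<Otimes>\<^sub>M expo)" for r t
  proof -
    have "(\<lambda>p. (r, t, p)) \<in> expo \<Otimes>\<^sub>M expo \<rightarrow>\<^sub>M borel \<Otimes>\<^sub>M (borel \<Otimes>\<^sub>M (borel \<Otimes>\<^sub>M borel))" by measurable
    from measurable_compose[OF this f] show ?thesis by simp
  qed
  have "(\<integral>\<^sup>+\<omega>. (\<lambda>\<omega> p. f (jump_value \<omega> n) (jump_time \<omega> n) p * indicator A \<omega>) \<omega> (\<omega> (2 * n + 1), \<omega> (Suc (2 * n + 1))) \<partial>noise) =
    (\<integral>\<^sup>+\<omega>. (\<integral>\<^sup>+p. (\<lambda>\<omega> p. f (jump_value \<omega> n) (jump_time \<omega> n) p * indicator A \<omega>) \<omega> p \<partial>(expo \<Otimes>\<^sub>M expo)) \<partial>noise)"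
  proof (rule nn_integral_noise_fresh)
    fix \<omega> \<omega>' :: "nat \<Rightarrow> real" and p assume *: "\<And>i. i < 2 * n + 1 \<Longrightarrow> \<omega> i = \<omega>' i"
    then have "\<omega> \<in> A \<longleftrightarrow> \<omega>' \<in> A" using A unfolding determined_by_def by blast
    then show "f (jump_value \<omega> n) (jump_time \<omega> n) p * indicator A \<omega> = f (jump_value \<omega>' n) (jump_time \<omega>' n) p * indicator A \<omega>'"
      using jumps_cong[OF * order_refl] by (simp add: indicator_def)
  qed (use m in \<open>simp_all add: split_beta'\<close>)
  also have "\<dots> = (\<integral>\<^sup>+\<omega>\<in>A. (\<integral>\<^sup>+p. f (jump_value \<omega> n) (jump_time \<omega> n) p \<partial>(expo \<Otimes>\<^sub>M expo)) \<partial>noise)"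
    by (intro nn_integral_cong nn_integral_multc m')
  finally show ?thesis by simp
qed

text \<open>The history is generated by tamed data, which depend on the whole sequence. The raw data
  give an event with the same trace on \<open>good_noise\<close>, and that one depends on finitely
  many coordinates.\<close>

lemma jump_history_determined:
  assumes "A \<in> sets (jump_history noise borel (\<lambda>n \<omega>. jump_time (tame \<omega>) n) (\<lambda>n \<omega>. jump_value (tame \<omega>) n) n)"
  shows "\<exists>A'. determined_by n A' \<and> (\<forall>\<omega>\<in>good_noise. \<omega> \<in> A \<longleftrightarrow> \<omega> \<in> A')"
proof -
  let ?P = "PiM {..n} (\<lambda>_. borel \<Otimes>\<^sub>M borel :: (real \<times> real) measure)"
  let ?h = "\<lambda>\<omega>. \<lambda>i\<in>{..n}. (jump_time \<omega> i, jump_value \<omega> i)"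
  have h [measurable]: "?h \<in> noise \<rightarrow>\<^sub>M ?P" by (intro measurable_restrict) simp
  have "sets (jump_history noise borel (\<lambda>n \<omega>. jump_time (tame \<omega>) n) (\<lambda>n \<omega>. jump_value (tame \<omega>) n) n) =
      {(\<lambda>\<omega>. ?h (tame \<omega>)) -` B \<inter> space noise | B. B \<in> sets ?P}"
    unfolding jump_history_def by (rule sets_vimage_algebra2) (auto simp: space_PiM space_pair_measure)
  then obtain B where B: "B \<in> sets ?P" "A = (\<lambda>\<omega>. ?h (tame \<omega>)) -` B"
    using assms by auto
  have "determined_by n (?h -` B)"
    unfolding determined_by_def
  proof (intro conjI allI impI)
    show "?h -` B \<in> sets noise" using measurable_sets[OF h B(1)] by simp
    fix \<omega> \<omega>' :: "nat \<Rightarrow> real" assume "\<forall>i<2 * n + 1. \<omega> i = \<omega>' i"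
    then have "?h \<omega> = ?h \<omega>'" using jumps_cong[of n \<omega> \<omega>'] by (intro restrict_ext) auto
    then show "\<omega> \<in> ?h -` B \<longleftrightarrow> \<omega>' \<in> ?h -` B" by simp
  qed
  then show ?thesis using B(2) tame_id by (intro exI[of _ "?h -` B"]) auto
qed

lemma rayleigh_distr: "rayleigh = distr expo borel rayleigh_quantile"
  by (simp add: rayleigh_eq rayleigh_quantile_def[abs_def])

lemma rayleigh_quantile_expo: "rayleigh_quantile \<in> borel_measurable expo"
  using measurable_rayleigh_quantile by (simp cong: measurable_cong_sets)

lemma pdmp_limit_path:
  "pdmp noise borel (\<lambda>s x. x + s) (\<lambda>x. max x 0) (\<lambda>_. distr rayleigh borel uminus) limit_path"
  unfolding pdmp_def
proof (intro conjI exI allI ballI impI)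
  interpret E: prob_space expo by (rule prob_space_expo)
  let ?T = "\<lambda>n \<omega>. jump_time (tame \<omega>) n" and ?Y = "\<lambda>n \<omega>. jump_value (tame \<omega>) n"
  show "prob_space noise" by (rule noise.P.prob_space_axioms)
  show "?T n \<in> borel_measurable noise" "?Y n \<in> borel_measurable noise" for n by measurable
  fix \<omega>
  have times: "jump_times (jump_time (tame \<omega>))" by (rule jump_times_good[OF tame_good])
  show "?T 0 \<omega> = 0" "strict_mono (\<lambda>n. ?T n \<omega>)" "filterlim (\<lambda>n. ?T n \<omega>) at_top sequentially"
    using times by (simp_all add: jump_times_def)
  show "limit_path t \<omega> = ?Y n \<omega> + (t - ?T n \<omega>)" if "t \<in> {?T n \<omega>..<?T (Suc n) \<omega>}" for n t
    using that by (simp add: limit_path_eq)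
next
  interpret E: prob_space expo by (rule prob_space_expo)
  let ?T = "\<lambda>n \<omega>. jump_time (tame \<omega>) n" and ?Y = "\<lambda>n \<omega>. jump_value (tame \<omega>) n"
  fix n A and t :: real and C :: "real set"
  assume A: "A \<in> sets (jump_history noise borel ?T ?Y n)" and C [measurable]: "C \<in> sets borel"
  have [measurable]: "A \<in> sets noise"
    using A sets_jump_history_subset[of ?T noise ?Y borel n] by auto
  obtain A' where A': "determined_by n A'" and eq: "\<And>\<omega>. \<omega> \<in> good_noise \<Longrightarrow> \<omega> \<in> A \<longleftrightarrow> \<omega> \<in> A'"
    using jump_history_determined[OF A] by blast
  let ?f = "\<lambda>r \<tau> p. indicator {..t} (wait_time r (fst p)) * indicator C (- rayleigh_quantile (snd p)) :: ennreal"
  have Q: "(\<integral>\<^sup>+e. indicator C (- rayleigh_quantile e) \<partial>expo) = emeasure (distr rayleigh borel uminus) C"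
  proof -
    have "emeasure (distr rayleigh borel uminus) C = (\<integral>\<^sup>+x. indicator C x \<partial>distr rayleigh borel uminus)" by simp
    also have "\<dots> = (\<integral>\<^sup>+x. indicator C (- x) \<partial>rayleigh)"
      by (subst nn_integral_distr) (auto simp: rayleigh_distr)
    also have "\<dots> = (\<integral>\<^sup>+e. indicator C (- rayleigh_quantile e) \<partial>expo)"
      unfolding rayleigh_distr by (rule nn_integral_distr) (simp_all add: rayleigh_quantile_expo)
    finally show ?thesis by simp
  qed
  have "emeasure noise {\<omega>\<in>A. ?T (Suc n) \<omega> - ?T n \<omega> \<le> t \<and> ?Y (Suc n) \<omega> \<in> C} =
      (\<integral>\<^sup>+\<omega>. indicator {\<omega>\<in>A. ?T (Suc n) \<omega> - ?T n \<omega> \<le> t \<and> ?Y (Suc n) \<omega> \<in> C} \<omega> \<partial>noise)"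
  proof (rule nn_integral_indicator[symmetric])
    have "{\<omega>\<in>space noise. \<omega> \<in> A \<and> ?T (Suc n) \<omega> - ?T n \<omega> \<le> t \<and> ?Y (Suc n) \<omega> \<in> C} \<in> sets noise" by measurable
    then show "{\<omega>\<in>A. ?T (Suc n) \<omega> - ?T n \<omega> \<le> t \<and> ?Y (Suc n) \<omega> \<in> C} \<in> sets noise" by simp
  qed
  \<comment> \<open>Almost surely taming changes nothing and \<open>A\<close> may be exchanged for
    \<open>A'\<close>. Only after this exchange are the two coordinates of the next jump independent
    of the event.\<close>
  also have "\<dots> = (\<integral>\<^sup>+\<omega>\<in>A'. ?f (jump_value \<omega> n) (jump_time \<omega> n) (\<omega> (2 * n + 1), \<omega> (Suc (2 * n + 1))) \<partial>noise)"
  proof (rule nn_integral_cong_AE)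
    show "AE \<omega> in noise. indicator {\<omega>\<in>A. ?T (Suc n) \<omega> - ?T n \<omega> \<le> t \<and> ?Y (Suc n) \<omega> \<in> C} \<omega> =
        ?f (jump_value \<omega> n) (jump_time \<omega> n) (\<omega> (2 * n + 1), \<omega> (Suc (2 * n + 1))) * indicator A' \<omega>"
      using AE_good_noise
    proof eventually_elim
      case (elim \<omega>)
      have "jump_value \<omega> (Suc n) = - rayleigh_quantile (\<omega> (Suc (2 * n + 1)))" by (simp add: jump_value_def)
      then show ?case using eq[OF elim] tame_id[OF elim] jump_time_Suc[of \<omega> n] by (auto simp: indicator_def)
    qed
  qed
  also have "\<dots> = (\<integral>\<^sup>+\<omega>\<in>A'. (\<integral>\<^sup>+p. ?f (jump_value \<omega> n) (jump_time \<omega> n) p \<partial>(expo \<Otimes>\<^sub>M expo)) \<partial>noise)"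
    by (rule nn_integral_determined[OF A']) measurable
  also have "\<dots> = (\<integral>\<^sup>+\<omega>\<in>A'. (\<integral>\<^sup>+s\<in>{0..t}. ennreal (max (jump_value \<omega> n + s) 0 *
      exp (- (LINT u:{0..s}|lborel. max (jump_value \<omega> n + u) 0))) * (\<integral>\<^sup>+e. indicator C (- rayleigh_quantile e) \<partial>expo) \<partial>lborel) \<partial>noise)"
    by (subst emeasure_atMost_wait_time) auto
  also have "\<dots> = (\<integral>\<^sup>+\<omega>\<in>A. (\<integral>\<^sup>+s\<in>{0..t}. ennreal (max (?Y n \<omega> + s) 0 *
      exp (- (LINT u:{0..s}|lborel. max (?Y n \<omega> + u) 0))) * emeasure (distr rayleigh borel uminus) C \<partial>lborel) \<partial>noise)"
    unfolding Q using AE_good_noise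
    by (intro nn_integral_cong_AE) (auto elim!: eventually_mono simp: tame_id eq indicator_def)
  finally show "emeasure noise {\<omega>\<in>A. ?T (Suc n) \<omega> - ?T n \<omega> \<le> t \<and> ?Y (Suc n) \<omega> \<in> C} = \<dots>" .
qed

text \<open>The path as seen from the first \<open>k\<close> jumps: segment \<open>k\<close> is
  continued for ever. It involves no later coordinate and agrees with the true path before jump
  \<open>Suc k\<close>.\<close>

definition frozen_path :: "nat \<Rightarrow> real \<Rightarrow> (nat \<Rightarrow> real) \<Rightarrow> real" where
  "frozen_path k u \<omega> =
     (\<Sum>i<k. if jump_time \<omega> i \<le> u \<and> u < jump_time \<omega> (Suc i) then jump_value \<omega> i + (u - jump_time \<omega> i) else 0) +
     (if jump_time \<omega> k \<le> u then jump_value \<omega> k + (u - jump_time \<omega> k) else 0)"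

lemma frozen_path_eq:
  assumes \<omega>: "\<omega> \<in> good_noise" and u: "0 \<le> u" "u < jump_time \<omega> (Suc k)"
  shows "frozen_path k u \<omega> = limit_path u \<omega>"
proof -
  have T: "jump_times (jump_time \<omega>)" by (rule jump_times_good[OF \<omega>])
  obtain n where n: "jump_time \<omega> n \<le> u" "u < jump_time \<omega> (Suc n)" using jump_interval_cases[OF T u(1)] by blast
  have path: "limit_path u \<omega> = jump_value \<omega> n + (u - jump_time \<omega> n)"
    using limit_path_eq[of \<omega> n u] n tame_id[OF \<omega>] by simp
  have uniq: "jump_time \<omega> i \<le> u \<and> u < jump_time \<omega> (Suc i) \<longleftrightarrow> i = n" for i
    using n jump_index_eq[OF T, of i u] jump_index_eq[OF T, of n u] by auto
  have "\<not> Suc k \<le> n" using jump_times_mono[OF T, of "Suc k" n] n u by linarith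
  then consider "n < k" | "n = k" by linarith
  then show ?thesis
  proof cases
    case 1
    then have "\<not> jump_time \<omega> k \<le> u" using jump_times_mono[OF T, of "Suc n" k] n by linarith
    then show ?thesis using 1 unfolding frozen_path_def uniq path by simp
  next
    case 2
    then show ?thesis using n unfolding frozen_path_def uniq path by simp
  qed
qed

text \<open>Generating events are transferred by replacing the path with
  \<open>frozen_path k\<close>. Complements and countable unions preserve agreement on the set where
  jump \<open>Suc k\<close> lies after \<open>s\<close>.\<close>

lemma natural_filtration_determined:
  assumes A: "A \<in> sets (natural_filtration noise limit_path s)"
  shows "\<exists>A'. determined_by k A' \<and> (\<forall>\<omega>\<in>good_noise. s < jump_time \<omega> (Suc k) \<longrightarrow> (\<omega> \<in> A \<longleftrightarrow> \<omega> \<in> A'))"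
proof -
  have "A \<in> sigma_sets UNIV {limit_path u -` B \<inter> space noise | u B. 0 \<le> u \<and> u \<le> s \<and> B \<in> sets borel}"
    using A unfolding natural_filtration_def by (subst (asm) sets_measure_of) auto
  then show ?thesis
  proof induction
    case (Basic A)
    then obtain u B where A: "A = limit_path u -` B" "0 \<le> u" "u \<le> s" "B \<in> sets borel" by auto
    let ?A = "frozen_path k u -` B"
    have m: "frozen_path k u \<in> borel_measurable noise" unfolding frozen_path_def[abs_def] by measurable
    have "determined_by k ?A"
      unfolding determined_by_def
    proof (intro conjI allI impI)
      show "?A \<in> sets noise" using measurable_sets[OF m A(4)] by simp
      fix \<omega> \<omega>' :: "nat \<Rightarrow> real" assume "\<forall>i<2 * k + 1. \<omega> i = \<omega>' i"
      then have "jump_value \<omega> i = jump_value \<omega>' i" "jump_time \<omega> i = jump_time \<omega>' i" if "i \<le> k" for i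
        using jumps_cong[of k \<omega> \<omega>' i] that by blast+
      then have "frozen_path k u \<omega> = frozen_path k u \<omega>'"
        unfolding frozen_path_def by (intro arg_cong2[where f = "(+)"] sum.cong) auto
      then show "\<omega> \<in> ?A \<longleftrightarrow> \<omega>' \<in> ?A" by simp
    qed
    then show ?case
      using frozen_path_eq A by (intro exI[of _ ?A]) auto
  next
    case Empty
    show ?case by (intro exI[of _ "{}"]) (simp add: determined_by_def)
  next
    case (Compl A)
    then obtain A' where A': "determined_by k A'" "\<forall>\<omega>\<in>good_noise. s < jump_time \<omega> (Suc k) \<longrightarrow> (\<omega> \<in> A \<longleftrightarrow> \<omega> \<in> A')" by blast
    have "determined_by k (- A')"
      using A'(1) sets.compl_sets[of A' noise] unfolding determined_by_def by (auto simp: Compl_eq_Diff_UNIV)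
    then show ?case using A'(2) by (intro exI[of _ "- A'"]) auto
  next
    case (Union A)
    then obtain A' where A': "\<And>i. determined_by k (A' i)"
      "\<And>i \<omega>. \<omega> \<in> good_noise \<Longrightarrow> s < jump_time \<omega> (Suc k) \<Longrightarrow> (\<omega> \<in> A i \<longleftrightarrow> \<omega> \<in> A' i)" by metis
    have "determined_by k (\<Union>i. A' i)"
      using A'(1) unfolding determined_by_def by blast
    then show ?case using A'(2) by (intro exI[of _ "\<Union>i. A' i"]) auto
  qed
qed

lemma subalgebra_natural_filtration: "subalgebra noise (natural_filtration noise limit_path s)"
  unfolding subalgebra_def
proof
  show "space (natural_filtration noise limit_path s) = space noise"
    by (simp add: natural_filtration_def space_measure_of_conv)
  show "sets (natural_filtration noise limit_path s) \<subseteq> sets noise"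
    unfolding natural_filtration_def
    using sets.sigma_sets_subset[of "{limit_path u -` B \<inter> space noise | u B. 0 \<le> u \<and> u \<le> s \<and> B \<in> sets borel}" noise]
      measurable_sets[OF measurable_limit_path]
    by (subst sets_measure_of) auto
qed

section \<open>Compensator formula for the jumps\<close>

definition jump_mean :: "(real \<Rightarrow> real \<Rightarrow> ennreal) \<Rightarrow> real \<Rightarrow> ennreal" where
  "jump_mean \<psi> y = (\<integral>\<^sup>+e. \<psi> y (- rayleigh_quantile e) \<partial>expo)"

lemma measurable_jump_mean:
  assumes "(\<lambda>(y, x). \<psi> y x) \<in> borel_measurable (borel \<Otimes>\<^sub>M borel)"
  shows "jump_mean \<psi> \<in> borel_measurable borel"
proof -
  interpret E: prob_space expo by (rule prob_space_expo)
  have "(\<lambda>q. (fst q, - rayleigh_quantile (snd q))) \<in> borel \<Otimes>\<^sub>M expo \<rightarrow>\<^sub>M borel \<Otimes>\<^sub>M borel"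
    using measurable_compose[OF measurable_snd rayleigh_quantile_expo, of borel] by measurable
  from measurable_compose[OF this assms] have "(\<lambda>(y, e). \<psi> y (- rayleigh_quantile e)) \<in> borel_measurable (borel \<Otimes>\<^sub>M expo)"
    by (simp add: split_beta')
  then show ?thesis
    unfolding jump_mean_def[abs_def] by (rule E.borel_measurable_nn_integral)
qed

text \<open>The single-jump formula \<open>nn_integral_wait_time_hazard\<close>, applied given the
  first \<open>k\<close> jumps; afterwards the time since the last jump is shifted to absolute
  time.\<close>

lemma levy_system_step:
  assumes A: "determined_by k A"
    and \<psi>: "(\<lambda>(y, x). \<psi> y x) \<in> borel_measurable (borel \<Otimes>\<^sub>M borel)"
  shows "(\<integral>\<^sup>+\<omega>\<in>A. indicator {s<..t} (jump_time \<omega> (Suc k)) *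
      \<psi> (jump_value \<omega> k + (jump_time \<omega> (Suc k) - jump_time \<omega> k)) (jump_value \<omega> (Suc k)) \<partial>noise) =
    (\<integral>\<^sup>+\<omega>\<in>A. (\<integral>\<^sup>+u\<in>{s<..t}. indicator {jump_time \<omega> k..<jump_time \<omega> (Suc k)} u *
      (ennreal (max (jump_value \<omega> k + (u - jump_time \<omega> k)) 0) * jump_mean \<psi> (jump_value \<omega> k + (u - jump_time \<omega> k))) \<partial>lborel) \<partial>noise)"
    (is "?L = ?R")
proof -
  interpret E: prob_space expo by (rule prob_space_expo)
  note [measurable] = measurable_jump_mean[OF \<psi>]
  let ?f = "\<lambda>r \<tau> p. indicator {s<..t} (\<tau> + wait_time r (fst p)) *
      \<psi> (r + wait_time r (fst p)) (- rayleigh_quantile (snd p)) :: ennreal"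
  let ?g = "\<lambda>r \<tau> (p :: real \<times> real). (\<integral>\<^sup>+x. ennreal (max (r + x) 0) * indicator {0..<wait_time r (fst p)} x *
      (indicator {s<..t} (\<tau> + x) * jump_mean \<psi> (r + x)) \<partial>lborel)"
  have \<psi>m: "(\<lambda>q. \<psi> (f q) (g q)) \<in> borel_measurable L" if [measurable]: "f \<in> borel_measurable L" "g \<in> borel_measurable L" for f g and L :: "'z measure"
    using measurable_compose[OF _ \<psi>, of "\<lambda>q. (f q, g q)" L] by simp
  have fm: "(\<lambda>(r, \<tau>, p). ?f r \<tau> p) \<in> borel_measurable (borel \<Otimes>\<^sub>M (borel \<Otimes>\<^sub>M (borel \<Otimes>\<^sub>M borel)))"
    unfolding split_beta' by (intro borel_measurable_times_ennreal \<psi>m) measurable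
  have gm: "(\<lambda>(r, \<tau>, p). ?g r \<tau> p) \<in> borel_measurable (borel \<Otimes>\<^sub>M (borel \<Otimes>\<^sub>M (borel \<Otimes>\<^sub>M borel)))"
  proof -
    have "(\<lambda>q. ennreal (max (fst (fst q) + snd q) 0) *
        (if 0 \<le> snd q \<and> snd q < wait_time (fst (fst q)) (fst (snd (snd (fst q)))) then 1 else 0) *
        (indicator {s<..t} (fst (snd (fst q)) + snd q) * jump_mean \<psi> (fst (fst q) + snd q)))
      \<in> borel_measurable ((borel \<Otimes>\<^sub>M (borel \<Otimes>\<^sub>M (borel \<Otimes>\<^sub>M borel))) \<Otimes>\<^sub>M lborel)" by measurable
    then have "(\<lambda>(q, x). ennreal (max (fst q + x) 0) * indicator {0..<wait_time (fst q) (fst (snd (snd q)))} x *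
        (indicator {s<..t} (fst (snd q) + x) * jump_mean \<psi> (fst q + x)))
      \<in> borel_measurable ((borel \<Otimes>\<^sub>M (borel \<Otimes>\<^sub>M (borel \<Otimes>\<^sub>M borel))) \<Otimes>\<^sub>M lborel)"
      by (rule measurable_cong[THEN iffD1, rotated]) (auto simp: split_beta' indicator_def)
    from lborel.borel_measurable_nn_integral[OF this] show ?thesis by (simp add: split_beta')
  qed
  have step: "(\<integral>\<^sup>+p. ?f r \<tau> p \<partial>(expo \<Otimes>\<^sub>M expo)) = (\<integral>\<^sup>+p. ?g r \<tau> p \<partial>(expo \<Otimes>\<^sub>M expo))" for r \<tau>
  proof -
    have fm': "(\<lambda>p. ?f r \<tau> p) \<in> borel_measurable (expo \<Otimes>\<^sub>M expo)"
      by (intro borel_measurable_times_ennreal \<psi>m) measurable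
    have gm': "(\<lambda>p. ?g r \<tau> p) \<in> borel_measurable (expo \<Otimes>\<^sub>M expo)"
      using measurable_compose[OF _ gm, of "\<lambda>p. (r, \<tau>, p)" "expo \<Otimes>\<^sub>M expo"] by simp
    have "(\<integral>\<^sup>+p. ?f r \<tau> p \<partial>(expo \<Otimes>\<^sub>M expo)) =
        (\<integral>\<^sup>+e. (\<integral>\<^sup>+e'. indicator {s<..t} (\<tau> + wait_time r e) * \<psi> (r + wait_time r e) (- rayleigh_quantile e') \<partial>expo) \<partial>expo)"
      using fm' by (subst E.nn_integral_fst[symmetric]) simp_all
    also have "\<dots> = (\<integral>\<^sup>+e. indicator {s<..t} (\<tau> + wait_time r e) * jump_mean \<psi> (r + wait_time r e) \<partial>expo)"
      unfolding jump_mean_def by (intro nn_integral_cong nn_integral_cmult \<psi>m) (use rayleigh_quantile_expo in measurable)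
    \<comment> \<open>\<open>?g\<close> ignores the second component of the pair, so the 0 is a
      placeholder that the next step averages over.\<close>
    also have "\<dots> = (\<integral>\<^sup>+e. ?g r \<tau> (e, 0) \<partial>expo)"
      using nn_integral_wait_time_hazard[of "\<lambda>x. indicator {s<..t} (\<tau> + x) * jump_mean \<psi> (r + x)" r] by simp
    also have "\<dots> = (\<integral>\<^sup>+e. (\<integral>\<^sup>+e'. ?g r \<tau> (e, e') \<partial>expo) \<partial>expo)"
      using E.emeasure_space_1 by simp
    also have "\<dots> = (\<integral>\<^sup>+p. ?g r \<tau> p \<partial>(expo \<Otimes>\<^sub>M expo))"
      using E.nn_integral_fst[OF gm'] by simp
    finally show ?thesis .
  qed
  have "?L = (\<integral>\<^sup>+\<omega>\<in>A. ?f (jump_value \<omega> k) (jump_time \<omega> k) (\<omega> (2 * k + 1), \<omega> (Suc (2 * k + 1))) \<partial>noise)"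
    by (intro nn_integral_cong) (simp add: jump_time_Suc jump_value_def)
  also have "\<dots> = (\<integral>\<^sup>+\<omega>\<in>A. ?g (jump_value \<omega> k) (jump_time \<omega> k) (\<omega> (2 * k + 1), \<omega> (Suc (2 * k + 1))) \<partial>noise)"
    unfolding nn_integral_determined[OF A fm] nn_integral_determined[OF A gm] step ..
  also have "\<dots> = ?R"
  proof (rule nn_integral_cong)
    fix \<omega> :: "nat \<Rightarrow> real"
    let ?r = "jump_value \<omega> k" and ?\<tau> = "jump_time \<omega> k" and ?w = "wait_time (jump_value \<omega> k) (\<omega> (2 * k + 1))"
    let ?G = "\<lambda>u. indicator {?\<tau>..<?\<tau> + ?w} u * (ennreal (max (?r + (u - ?\<tau>)) 0) * jump_mean \<psi> (?r + (u - ?\<tau>))) * indicator {s<..t} u"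
    have "(\<integral>\<^sup>+u. ?G u \<partial>lborel) = ennreal \<bar>1\<bar> * (\<integral>\<^sup>+x. ?G (?\<tau> + 1 * x) \<partial>lborel)"
      by (rule nn_integral_real_affine) simp_all
    also have "\<dots> = ?g ?r ?\<tau> (\<omega> (2 * k + 1), \<omega> (Suc (2 * k + 1)))"
      by (auto intro!: nn_integral_cong simp: indicator_def)
    finally show "?g ?r ?\<tau> (\<omega> (2 * k + 1), \<omega> (Suc (2 * k + 1))) * indicator A \<omega> =
      (\<integral>\<^sup>+u\<in>{s<..t}. indicator {?\<tau>..<jump_time \<omega> (Suc k)} u *
        (ennreal (max (?r + (u - ?\<tau>)) 0) * jump_mean \<psi> (?r + (u - ?\<tau>))) \<partial>lborel) * indicator A \<omega>"
      by (simp add: jump_time_Suc)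
  qed
  finally show ?thesis .
qed

definition jump_sum :: "(real \<Rightarrow> real \<Rightarrow> ennreal) \<Rightarrow> real \<Rightarrow> real \<Rightarrow> (nat \<Rightarrow> real) \<Rightarrow> ennreal" where
  "jump_sum \<psi> s t \<omega> = (\<Sum>k. indicator {s<..t} (jump_time (tame \<omega>) (Suc k)) *
     \<psi> (jump_value (tame \<omega>) k + (jump_time (tame \<omega>) (Suc k) - jump_time (tame \<omega>) k)) (jump_value (tame \<omega>) (Suc k)))"

text \<open>The compensator formula for the jumps, conditionally on the past. Before the next jump an event of
  the past coincides with one that is determined by the previous jumps.\<close>

lemma levy_system:
  assumes A: "A \<in> sets (natural_filtration noise limit_path s)" and s: "0 \<le> s"
    and \<psi>: "(\<lambda>(y, x). \<psi> y x) \<in> borel_measurable (borel \<Otimes>\<^sub>M borel)"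
  shows "(\<integral>\<^sup>+\<omega>\<in>A. jump_sum \<psi> s t \<omega> \<partial>noise) =
    (\<integral>\<^sup>+\<omega>\<in>A. (\<integral>\<^sup>+u\<in>{s<..t}. ennreal (max (limit_path u \<omega>) 0) * jump_mean \<psi> (limit_path u \<omega>) \<partial>lborel) \<partial>noise)"
proof -
  let ?T = "\<lambda>k \<omega>. jump_time (tame \<omega>) k" and ?Y = "\<lambda>k \<omega>. jump_value (tame \<omega>) k"
  note jm [measurable] = measurable_jump_mean[OF \<psi>]
  have [measurable]: "A \<in> sets noise"
    using A subalgebra_natural_filtration by (auto simp: subalgebra_def)
  have \<psi>m: "(\<lambda>q. \<psi> (f q) (g q)) \<in> borel_measurable L" if [measurable]: "f \<in> borel_measurable L" "g \<in> borel_measurable L" for f g and L :: "'z measure"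
    using measurable_compose[OF _ \<psi>, of "\<lambda>q. (f q, g q)" L] by simp
  let ?a = "\<lambda>k \<omega>. indicator {s<..t} (?T (Suc k) \<omega>) * \<psi> (?Y k \<omega> + (?T (Suc k) \<omega> - ?T k \<omega>)) (?Y (Suc k) \<omega>) :: ennreal"
  let ?d = "\<lambda>k \<omega> u. indicator {?T k \<omega>..<?T (Suc k) \<omega>} u *
      (ennreal (max (?Y k \<omega> + (u - ?T k \<omega>)) 0) * jump_mean \<psi> (?Y k \<omega> + (u - ?T k \<omega>)))"
  let ?b = "\<lambda>k \<omega>. \<integral>\<^sup>+u\<in>{s<..t}. ?d k \<omega> u \<partial>lborel"
  have am [measurable]: "?a k \<in> borel_measurable noise" for k
    by (intro borel_measurable_times_ennreal \<psi>m) measurable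
  have dm: "(\<lambda>(\<omega>, u). ?d k \<omega> u * indicator {s<..t} u) \<in> borel_measurable (noise \<Otimes>\<^sub>M lborel)" for k
  proof -
    have "(\<lambda>q. (if ?T k (fst q) \<le> snd q \<and> snd q < ?T (Suc k) (fst q) then 1 else 0) *
      (ennreal (max (?Y k (fst q) + (snd q - ?T k (fst q))) 0) * jump_mean \<psi> (?Y k (fst q) + (snd q - ?T k (fst q)))) * indicator {s<..t} (snd q))
        \<in> borel_measurable (noise \<Otimes>\<^sub>M lborel)" by measurable
    then show ?thesis
      by (rule measurable_cong[THEN iffD1, rotated]) (auto simp: split_beta' indicator_def)
  qed
  have bm [measurable]: "?b k \<in> borel_measurable noise" for k
    using lborel.borel_measurable_nn_integral[OF dm[of k]] by simp
  have step: "(\<integral>\<^sup>+\<omega>. ?a k \<omega> * indicator A \<omega> \<partial>noise) = (\<integral>\<^sup>+\<omega>. ?b k \<omega> * indicator A \<omega> \<partial>noise)" for k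
  proof -
    obtain A' where A': "determined_by k A'"
      and eq: "\<And>\<omega>. \<omega> \<in> good_noise \<Longrightarrow> s < jump_time \<omega> (Suc k) \<Longrightarrow> (\<omega> \<in> A \<longleftrightarrow> \<omega> \<in> A')"
      using natural_filtration_determined[OF A, of k] by blast
    \<comment> \<open>Both terms vanish unless jump \<open>Suc k\<close> falls after
      \<open>s\<close>, and this is exactly where \<open>A\<close> and \<open>A'\<close> are known
      to agree.\<close>
    have ab0: "?a k \<omega> = 0" "?b k \<omega> = 0" if "\<not> s < ?T (Suc k) \<omega>" for \<omega>
    proof -
      show "?a k \<omega> = 0" using that by simp
      have "?b k \<omega> = (\<integral>\<^sup>+u. 0 \<partial>(lborel :: real measure))"
        using that by (intro nn_integral_cong) (auto simp: indicator_def)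
      then show "?b k \<omega> = 0" by simp
    qed
    have sw: "c * indicator A \<omega> = c * indicator A' \<omega>" if "\<omega> \<in> good_noise" "\<not> s < ?T (Suc k) \<omega> \<Longrightarrow> c = 0" for c :: ennreal and \<omega>
      using eq[OF that(1)] that tame_id[OF that(1)] by (cases "s < ?T (Suc k) \<omega>") (auto simp: indicator_def)
    have "(\<integral>\<^sup>+\<omega>. ?a k \<omega> * indicator A \<omega> \<partial>noise) = (\<integral>\<^sup>+\<omega>\<in>A'. indicator {s<..t} (jump_time \<omega> (Suc k)) *
      \<psi> (jump_value \<omega> k + (jump_time \<omega> (Suc k) - jump_time \<omega> k)) (jump_value \<omega> (Suc k)) \<partial>noise)"
    proof (rule nn_integral_cong_AE, rule eventually_mono[OF AE_good_noise])
      fix \<omega> :: "nat \<Rightarrow> real" assume good: "\<omega> \<in> good_noise"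
      show "?a k \<omega> * indicator A \<omega> = indicator {s<..t} (jump_time \<omega> (Suc k)) *
          \<psi> (jump_value \<omega> k + (jump_time \<omega> (Suc k) - jump_time \<omega> k)) (jump_value \<omega> (Suc k)) * indicator A' \<omega>"
        using sw[OF good ab0(1)[of \<omega>]] tame_id[OF good] by simp
    qed
    also have "\<dots> = (\<integral>\<^sup>+\<omega>\<in>A'. (\<integral>\<^sup>+u\<in>{s<..t}. indicator {jump_time \<omega> k..<jump_time \<omega> (Suc k)} u *
      (ennreal (max (jump_value \<omega> k + (u - jump_time \<omega> k)) 0) * jump_mean \<psi> (jump_value \<omega> k + (u - jump_time \<omega> k))) \<partial>lborel) \<partial>noise)"
      by (rule levy_system_step[OF A' \<psi>])
    also have "\<dots> = (\<integral>\<^sup>+\<omega>. ?b k \<omega> * indicator A \<omega> \<partial>noise)"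
    proof (rule nn_integral_cong_AE, rule eventually_mono[OF AE_good_noise])
      fix \<omega> :: "nat \<Rightarrow> real" assume good: "\<omega> \<in> good_noise"
      show "(\<integral>\<^sup>+u\<in>{s<..t}. indicator {jump_time \<omega> k..<jump_time \<omega> (Suc k)} u *
          (ennreal (max (jump_value \<omega> k + (u - jump_time \<omega> k)) 0) * jump_mean \<psi> (jump_value \<omega> k + (u - jump_time \<omega> k))) \<partial>lborel) *
          indicator A' \<omega> = ?b k \<omega> * indicator A \<omega>"
        using sw[OF good ab0(2)[of \<omega>]] tame_id[OF good] by simp
    qed
    finally show ?thesis .
  qed
  have path: "(\<Sum>k. ?b k \<omega>) = (\<integral>\<^sup>+u\<in>{s<..t}. ennreal (max (limit_path u \<omega>) 0) * jump_mean \<psi> (limit_path u \<omega>) \<partial>lborel)" for \<omega>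
  proof -
    have T: "jump_times (jump_time (tame \<omega>))" by (rule jump_times_good[OF tame_good])
    have "(\<lambda>u. ?d k \<omega> u * indicator {s<..t} u) \<in> borel_measurable lborel" for k
      using measurable_compose[OF measurable_Pair1'[of \<omega> noise lborel] dm[of k]] by simp
    then have "(\<Sum>k. ?b k \<omega>) = (\<integral>\<^sup>+u. (\<Sum>k. ?d k \<omega> u * indicator {s<..t} u) \<partial>lborel)"
      by (intro nn_integral_suminf[symmetric])
    also have "\<dots> = (\<integral>\<^sup>+u\<in>{s<..t}. ennreal (max (limit_path u \<omega>) 0) * jump_mean \<psi> (limit_path u \<omega>) \<partial>lborel)"
    proof (rule nn_integral_cong)
      fix u :: real
      show "(\<Sum>k. ?d k \<omega> u * indicator {s<..t} u) = ennreal (max (limit_path u \<omega>) 0) * jump_mean \<psi> (limit_path u \<omega>) * indicator {s<..t} u"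
      proof (cases "u \<in> {s<..t}")
        case True
        then have "0 \<le> u" using s by simp
        obtain n where n: "?T n \<omega> \<le> u" "u < ?T (Suc n) \<omega>" using jump_interval_cases[OF T \<open>0 \<le> u\<close>] by blast
        \<comment> \<open>Each time lies in exactly one segment, so the sum of compensators over all
          jumps is a single integral along the path.\<close>
        have uniq: "u \<in> {?T k \<omega>..<?T (Suc k) \<omega>} \<longleftrightarrow> k = n" for k
          using n jump_index_eq[OF T, of k u] jump_index_eq[OF T, of n u] by auto
        have "(\<Sum>k. ?d k \<omega> u * indicator {s<..t} u) = (\<Sum>k\<in>{n}. ?d k \<omega> u * indicator {s<..t} u)"
          by (rule suminf_finite) (use uniq in \<open>auto simp: indicator_def\<close>)
        also have "\<dots> = ?d n \<omega> u * indicator {s<..t} u"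
          by (simp only: sum.insert[OF finite.emptyI] sum.empty empty_iff not_False_eq_True add_0_right)
        also have "\<dots> = ennreal (max (limit_path u \<omega>) 0) * jump_mean \<psi> (limit_path u \<omega>) * indicator {s<..t} u"
          using n unfolding limit_path_eq[OF n] by simp
        finally show ?thesis .
      qed simp
    qed
    finally show ?thesis .
  qed
  have "(\<integral>\<^sup>+\<omega>\<in>A. jump_sum \<psi> s t \<omega> \<partial>noise) = (\<integral>\<^sup>+\<omega>. (\<Sum>k. ?a k \<omega> * indicator A \<omega>) \<partial>noise)"
    unfolding jump_sum_def by simp
  also have "\<dots> = (\<Sum>k. \<integral>\<^sup>+\<omega>. ?a k \<omega> * indicator A \<omega> \<partial>noise)"
    by (rule nn_integral_suminf) measurable
  also have "\<dots> = (\<Sum>k. \<integral>\<^sup>+\<omega>. ?b k \<omega> * indicator A \<omega> \<partial>noise)" unfolding step ..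
  also have "\<dots> = (\<integral>\<^sup>+\<omega>. (\<Sum>k. ?b k \<omega> * indicator A \<omega>) \<partial>noise)"
    by (rule nn_integral_suminf[symmetric]) measurable
  also have "\<dots> = (\<integral>\<^sup>+\<omega>\<in>A. (\<Sum>k. ?b k \<omega>) \<partial>noise)" by simp
  finally show ?thesis unfolding path .
qed

section \<open>Integrals along the path and measurability in time\<close>

lemma set_integral_half_open:
  fixes h :: "real \<Rightarrow> real"
  shows "(LINT x:{a..<b}|lborel. h x) = (LINT x:{a..b}|lborel. h x)"
    and "set_integrable lborel {a..<b} h \<longleftrightarrow> set_integrable lborel {a..b} h"
  by (rule set_integral_discrete_difference[where X = "{b}"]; auto)
    (rule set_integrable_discrete_difference[where X = "{b}"]; auto)

text \<open>At unit speed, integration over time within a segment becomes integration over the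
  values of the path by a translation.\<close>

lemma limit_path_piece:
  fixes h :: "real \<Rightarrow> real" and \<omega> :: "nat \<Rightarrow> real"
  defines "T \<equiv> jump_time (tame \<omega>)" and "Y \<equiv> jump_value (tame \<omega>)"
  assumes t: "t \<le> T (Suc n)" and h: "set_integrable lborel {Y n..Y n + (t - T n)} h"
  shows "set_integrable lborel {T n..<t} (\<lambda>s. h (limit_path s \<omega>))"
    and "(LINT s:{T n..<t}|lborel. h (limit_path s \<omega>)) = (LINT x:{Y n..Y n + (t - T n)}|lborel. h x)"
proof -
  let ?f = "\<lambda>x. indicator {Y n..<Y n + (t - T n)} x *\<^sub>R h x"
  have eq: "?f ((Y n - T n) + 1 * s) = indicator {T n..<t} s *\<^sub>R h (limit_path s \<omega>)" for s
  proof -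
    have shift: "(Y n - T n) + 1 * s = Y n + (s - T n)" by simp
    have "h (Y n + (s - T n)) = h (limit_path s \<omega>)" if "T n \<le> s" "s < t"
      using t that limit_path_eq[of \<omega> n s] by (simp add: T_def Y_def)
    then show ?thesis unfolding shift by (auto simp: indicator_def)
  qed
  show "set_integrable lborel {T n..<t} (\<lambda>s. h (limit_path s \<omega>))"
    using h lborel_integrable_real_affine_iff[of 1 ?f "Y n - T n"] set_integral_half_open(2)[of "Y n" "Y n + (t - T n)" h]
    unfolding set_integrable_def eq by simp
  show "(LINT s:{T n..<t}|lborel. h (limit_path s \<omega>)) = (LINT x:{Y n..Y n + (t - T n)}|lborel. h x)"
    using lborel_integral_real_affine[of 1 ?f "Y n - T n"] set_integral_half_open(1)[of "Y n" "Y n + (t - T n)" h]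
    unfolding set_lebesgue_integral_def eq by simp
qed

lemma limit_path_integral:
  fixes h :: "real \<Rightarrow> real" and \<omega> :: "nat \<Rightarrow> real"
  defines "T \<equiv> jump_time (tame \<omega>)" and "Y \<equiv> jump_value (tame \<omega>)"
  assumes h: "\<And>a b. set_integrable lborel {a..b} h"
  shows "set_integrable lborel {0..<T n} (\<lambda>s. h (limit_path s \<omega>))"
    and "(LINT s:{0..<T n}|lborel. h (limit_path s \<omega>)) =
      (\<Sum>i<n. LINT x:{Y i..Y i + (T (Suc i) - T i)}|lborel. h x)"
proof -
  have T: "jump_times T" unfolding T_def by (rule jump_times_good[OF tame_good])
  have "set_integrable lborel {0..<T n} (\<lambda>s. h (limit_path s \<omega>)) \<and>
      (LINT s:{0..<T n}|lborel. h (limit_path s \<omega>)) = (\<Sum>i<n. LINT x:{Y i..Y i + (T (Suc i) - T i)}|lborel. h x)"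
  proof (induction n)
    case 0
    show ?case using T by (simp add: jump_times_def set_integrable_def set_lebesgue_integral_def)
  next
    case (Suc n)
    have *: "{0..<T (Suc n)} = {0..<T n} \<union> {T n..<T (Suc n)}"
      using jump_times_nonneg[OF T, of n] jump_times_less[OF T, of n] by auto
    note piece = limit_path_piece[OF _ h, of "T (Suc n)" \<omega> n, folded T_def Y_def, OF order_refl]
    have "set_integrable lborel {0..<T (Suc n)} (\<lambda>s. h (limit_path s \<omega>))"
      unfolding * using Suc piece by (intro set_integrable_Un) auto
    moreover have "(LINT s:{0..<T (Suc n)}|lborel. h (limit_path s \<omega>)) =
        (LINT s:{0..<T n}|lborel. h (limit_path s \<omega>)) + (LINT s:{T n..<T (Suc n)}|lborel. h (limit_path s \<omega>))"
      unfolding * using Suc piece by (intro set_integral_Un) auto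
    ultimately show ?case using Suc piece by simp
  qed
  then show "set_integrable lborel {0..<T n} (\<lambda>s. h (limit_path s \<omega>))"
    and "(LINT s:{0..<T n}|lborel. h (limit_path s \<omega>)) = (\<Sum>i<n. LINT x:{Y i..Y i + (T (Suc i) - T i)}|lborel. h x)"
    by blast+
qed

lemma limit_path_integrable:
  fixes h :: "real \<Rightarrow> real"
  assumes "\<And>a b. set_integrable lborel {a..b} h" and S: "S \<in> sets borel" "S \<subseteq> {0..t}"
  shows "set_integrable lborel S (\<lambda>s. h (limit_path s \<omega>))"
proof -
  obtain n where n: "t < jump_time (tame \<omega>) n"
    using jump_times_exceed[OF jump_times_good[OF tame_good]] by blast
  show ?thesis
    by (rule set_integrable_subset[OF limit_path_integral(1)[OF assms(1), of \<omega> n]]) (use S n in auto)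
qed

lemma limit_path_upper_bound:
  assumes t: "0 \<le> t"
  shows "limit_path t \<omega> \<le> max (limit_path 0 \<omega>) 0 + t"
proof -
  have T: "jump_times (jump_time (tame \<omega>))" by (rule jump_times_good[OF tame_good])
  have 0: "limit_path 0 \<omega> = jump_value (tame \<omega>) 0"
    using limit_path_eq[of \<omega> 0 0] jump_times_less[OF T, of 0] by (simp add: jump_time_def)
  obtain n where n: "jump_time (tame \<omega>) n \<le> t" "t < jump_time (tame \<omega>) (Suc n)"
    using jump_interval_cases[OF T t] by blast
  have "jump_value (tame \<omega>) n \<le> max (limit_path 0 \<omega>) 0"
  proof (cases n)
    case (Suc k)
    have "0 < tame \<omega> (Suc (2 * k + 1))" using tame_good by (simp add: good_noise_def)
    then have "jump_value (tame \<omega>) n \<le> 0" using Suc by (simp add: jump_value_def rayleigh_quantile_def)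
    then show ?thesis by simp
  qed (simp add: 0)
  then show ?thesis using limit_path_eq[OF n] jump_times_nonneg[OF T, of n] by simp
qed

lemma limit_path_right_limit:
  assumes v: "0 \<le> v" and r: "r \<longlonglongrightarrow> v" "\<And>n. v \<le> r n"
  shows "(\<lambda>n. limit_path (r n) \<omega>) \<longlonglongrightarrow> limit_path v \<omega>"
proof -
  obtain n where n: "jump_time (tame \<omega>) n \<le> v" "v < jump_time (tame \<omega>) (Suc n)"
    using jump_interval_cases[OF jump_times_good[OF tame_good] v] by blast
  have "(\<lambda>j. jump_value (tame \<omega>) n + (r j - jump_time (tame \<omega>) n)) \<longlonglongrightarrow> limit_path v \<omega>"
    unfolding limit_path_eq[OF n] by (intro tendsto_intros r)
  moreover have "\<forall>\<^sub>F j in sequentially. jump_value (tame \<omega>) n + (r j - jump_time (tame \<omega>) n) = limit_path (r j) \<omega>"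
    using order_tendstoD(2)[OF r(1) n(2)]
  proof eventually_elim
    case (elim j)
    then show ?case using limit_path_eq[of \<omega> n "r j"] n r(2)[of j] by simp
  qed
  ultimately show ?thesis by (rule Lim_transform_eventually)
qed

lemma sets_natural_filtration:
  "sets (natural_filtration M R t) =
    sigma_sets (space M) {R s -` B \<inter> space M | s B. 0 \<le> s \<and> s \<le> t \<and> B \<in> sets borel}"
  unfolding natural_filtration_def by (rule sets_measure_of) auto

lemma space_natural_filtration [simp]: "space (natural_filtration M R t) = space M"
  by (simp add: natural_filtration_def space_measure_of_conv)

lemma natural_filtration_adapted:
  assumes "0 \<le> u" "u \<le> t"
  shows "R u \<in> borel_measurable (natural_filtration M R t)"
proof (rule measurableI)
  fix B :: "real set" assume "B \<in> sets borel"
  then have "R u -` B \<inter> space M \<in> {R s -` B \<inter> space M | s B. 0 \<le> s \<and> s \<le> t \<and> B \<in> sets borel}"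
    using assms by blast
  then show "R u -` B \<inter> space (natural_filtration M R t) \<in> sets (natural_filtration M R t)"
    unfolding sets_natural_filtration space_natural_filtration by (rule sigma_sets.Basic)
qed simp

lemma natural_filtration_mono:
  assumes "s \<le> t" shows "sets (natural_filtration M R s) \<subseteq> sets (natural_filtration M R t)"
  unfolding sets_natural_filtration by (rule sigma_sets_mono') (use assms order_trans in blast)

text \<open>Right continuity: the path is the limit of its values at grid points to the right of the
  current time. Truncation of these points at \<open>t\<close> keeps every approximation measurable
  with respect to the past of \<open>t\<close>.\<close>

lemma limit_path_progressive:
  assumes t: "0 \<le> t"
  shows "(\<lambda>(\<omega>, u). limit_path (min (max u 0) t) \<omega>) \<in>
    borel_measurable (natural_filtration noise limit_path t \<Otimes>\<^sub>M lborel)"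
proof (rule borel_measurable_LIMSEQ_real)
  let ?F = "natural_filtration noise limit_path t"
  let ?i = "\<lambda>n u. nat \<lfloor>max u 0 * real (Suc n)\<rfloor>"
  \<comment> \<open>The successor moves the grid point to the right of the time, as right continuity
    requires.\<close>
  let ?r = "\<lambda>n u. real (Suc (?i n u)) / real (Suc n)"
  fix n
  have adapted: "limit_path (min (real (Suc i) / real (Suc n)) t) \<in> borel_measurable ?F" for i
    using t by (intro natural_filtration_adapted) auto
  have "(\<lambda>q. limit_path (min (real (Suc i) / real (Suc n)) t) (fst q)) \<in> borel_measurable (?F \<Otimes>\<^sub>M lborel)" for i
    by (rule measurable_compose[OF measurable_fst adapted])
  moreover have "(\<lambda>q. ?i n (snd q)) \<in> ?F \<Otimes>\<^sub>M lborel \<rightarrow>\<^sub>M count_space UNIV" by measurable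
  ultimately show "(\<lambda>q. limit_path (min (?r n (snd q)) t) (fst q)) \<in> borel_measurable (?F \<Otimes>\<^sub>M lborel)"
    by (rule measurable_compose_countable)
next
  let ?i = "\<lambda>n u. nat \<lfloor>max u 0 * real (Suc n)\<rfloor>"
  let ?r = "\<lambda>n u. real (Suc (?i n u)) / real (Suc n)"
  fix q :: "(nat \<Rightarrow> real) \<times> real"
  let ?v = "max (snd q) 0"
  have bounds: "?v \<le> ?r n (snd q)" "?r n (snd q) \<le> ?v + 1 / real (Suc n)" for n
  proof -
    have "real (?i n (snd q)) = of_int \<lfloor>?v * real (Suc n)\<rfloor>" by simp
    then have "?v * real (Suc n) \<le> real (Suc (?i n (snd q)))" "real (Suc (?i n (snd q))) \<le> ?v * real (Suc n) + 1"
      by linarith+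
    then show "?v \<le> ?r n (snd q)" "?r n (snd q) \<le> ?v + 1 / real (Suc n)"
      by (simp_all only: pos_le_divide_eq pos_divide_le_eq of_nat_0_less_iff zero_less_Suc distrib_right) auto
  qed
  have "(\<lambda>n. ?v + 1 / real (Suc n)) \<longlonglongrightarrow> ?v + 0"
    by (intro tendsto_intros LIMSEQ_Suc[OF lim_1_over_n])
  then have "(\<lambda>n. ?r n (snd q)) \<longlonglongrightarrow> ?v"
    by (intro tendsto_sandwich[OF _ _ tendsto_const, of _ "\<lambda>n. ?r n (snd q)" _ "\<lambda>n. ?v + 1 / real (Suc n)"])
      (use bounds in \<open>auto intro!: always_eventually\<close>)
  then have "(\<lambda>n. min (?r n (snd q)) t) \<longlonglongrightarrow> min ?v t" by (intro tendsto_min tendsto_const)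
  moreover have "min ?v t \<le> min (?r n (snd q)) t" for n using bounds(1)[of n] by linarith
  ultimately have "(\<lambda>n. limit_path (min (?r n (snd q)) t) (fst q)) \<longlonglongrightarrow> limit_path (min ?v t) (fst q)"
    using t by (intro limit_path_right_limit) auto
  then show "(\<lambda>n. limit_path (min (?r n (snd q)) t) (fst q)) \<longlonglongrightarrow> (case q of (\<omega>, u) \<Rightarrow> limit_path (min (max u 0) t) \<omega>)"
    by (simp add: split_beta')
qed

lemma measurable_jump_sum:
  assumes \<psi>: "(\<lambda>(y, x). \<psi> y x) \<in> borel_measurable (borel \<Otimes>\<^sub>M borel)"
  shows "jump_sum \<psi> s t \<in> borel_measurable noise"
proof -
  have "(\<lambda>\<omega>. \<psi> (jump_value (tame \<omega>) k + (jump_time (tame \<omega>) (Suc k) - jump_time (tame \<omega>) k)) (jump_value (tame \<omega>) (Suc k)))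
      \<in> borel_measurable noise" for k
    using measurable_compose[OF _ \<psi>, of "\<lambda>\<omega>. (jump_value (tame \<omega>) k + (jump_time (tame \<omega>) (Suc k) - jump_time (tame \<omega>) k), jump_value (tame \<omega>) (Suc k))" noise]
    by simp
  then show ?thesis unfolding jump_sum_def[abs_def] by measurable
qed

lemma measurable_path_integral:
  assumes [measurable]: "k \<in> borel_measurable borel" and s: "0 \<le> s"
  shows "(\<lambda>\<omega>. \<integral>\<^sup>+u\<in>{s<..t}. k (limit_path u \<omega>) \<partial>lborel) \<in> borel_measurable noise"
proof (cases "s \<le> t")
  case True
  then have t: "0 \<le> t" using s by simp
  let ?F = "natural_filtration noise limit_path t"
  have "(\<lambda>q. limit_path (min (max (snd q) 0) t) (fst q)) \<in> borel_measurable (noise \<Otimes>\<^sub>M lborel)"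
  proof -
    have "(\<lambda>\<omega>. \<omega>) \<in> noise \<rightarrow>\<^sub>M ?F"
      using subalgebra_natural_filtration[of t] by (auto simp: measurable_def subalgebra_def intro: sets.Int_space_eq2)
    from measurable_compose[OF measurable_fst this, of lborel]
    have "(\<lambda>q. (fst q, snd q)) \<in> noise \<Otimes>\<^sub>M lborel \<rightarrow>\<^sub>M ?F \<Otimes>\<^sub>M lborel" by (rule measurable_Pair) simp
    from measurable_compose[OF this limit_path_progressive[OF t]] show ?thesis by (simp add: split_beta')
  qed
  then have "(\<lambda>q. k (limit_path (min (max (snd q) 0) t) (fst q)) * indicator {s<..t} (snd q)) \<in> borel_measurable (noise \<Otimes>\<^sub>M lborel)"
    by measurable
  then have "(\<lambda>(\<omega>, u). k (limit_path u \<omega>) * indicator {s<..t} u) \<in> borel_measurable (noise \<Otimes>\<^sub>M lborel)"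
    by (rule measurable_cong[THEN iffD1, rotated]) (use s in \<open>auto simp: split_beta' indicator_def\<close>)
  then show ?thesis by (rule lborel.borel_measurable_nn_integral)
qed simp

section \<open>The extended generator\<close>

locale generator_function =
  fixes f f' :: "real \<Rightarrow> real"
  assumes ac: "abs_continuous_deriv f f'" and int: "integrable rayleigh (\<lambda>\<tau>. f (- \<tau>))"
begin

lemma deriv_integrable: "set_integrable lborel {a..b} f'"
  using ac by (cases "a \<le> b") (auto simp: abs_continuous_deriv_def set_integrable_def)

lemma deriv_integral: "a \<le> b \<Longrightarrow> (LINT x:{a..b}|lborel. f' x) = f b - f a"
  using ac by (simp add: abs_continuous_deriv_def)

lemma measurable_deriv [measurable]: "f' \<in> borel_measurable borel"
  using ac by (simp add: abs_continuous_deriv_def)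

lemma continuous: "continuous_on UNIV f"
proof -
  have "isCont f x" for x
  proof -
    let ?a = "x - 1" and ?b = "x + 1"
    have "f' integrable_on {?a..?b}" by (rule set_borel_integral_eq_integral(1)[OF deriv_integrable])
    then have "continuous_on {?a..?b} (\<lambda>y. f ?a + integral {?a..y} f')"
      by (intro continuous_intros indefinite_integral_continuous_1)
    moreover have "f ?a + integral {?a..y} f' = f y" if "y \<in> {?a..?b}" for y
      using set_borel_integral_eq_integral(2)[OF deriv_integrable[of ?a y]] deriv_integral[of ?a y] that by simp
    ultimately have "continuous_on {?a..?b} f" by (rule continuous_on_eq)
    then show ?thesis
      by (rule continuous_on_interior) (simp add: interior_atLeastAtMost_real)
  qed
  then show ?thesis by (simp add: continuous_on_eq_continuous_at)
qed

lemma measurable_f [measurable]: "f \<in> borel_measurable borel"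
  using continuous by (rule borel_measurable_continuous_onI)

definition "post_mean = (\<integral>\<tau>. f (- \<tau>) \<partial>rayleigh)"

definition "jump_part x = max x 0 * (post_mean - f x)"

lemma limit_generator_eq: "limit_generator f f' = (\<lambda>x. f' x + jump_part x)"
  by (simp add: limit_generator_def jump_part_def post_mean_def fun_eq_iff)

lemma measurable_jump_part [measurable]: "jump_part \<in> borel_measurable borel"
  unfolding jump_part_def[abs_def] by measurable

lemma jump_part_integrable: "set_integrable lborel {a..b} jump_part"
  unfolding jump_part_def[abs_def]
  by (rule borel_integrable_atLeastAtMost')
    (intro continuous_intros continuous_on_subset[OF continuous subset_UNIV])

lemma generator_integrable: "set_integrable lborel {a..b} (limit_generator f f')"
  unfolding limit_generator_eq using deriv_integrable jump_part_integrable by (rule set_integral_add(1))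

lemma integrable_post: "integrable expo (\<lambda>e. f (- rayleigh_quantile e))"
  and post_mean_expo: "(\<integral>e. f (- rayleigh_quantile e) \<partial>expo) = post_mean"
proof -
  have m: "(\<lambda>\<tau>. f (- \<tau>)) \<in> borel_measurable borel" by measurable
  show "integrable expo (\<lambda>e. f (- rayleigh_quantile e))"
    using int unfolding rayleigh_distr by (rule integrable_distr[OF rayleigh_quantile_expo])
  show "(\<integral>e. f (- rayleigh_quantile e) \<partial>expo) = post_mean"
    unfolding post_mean_def rayleigh_distr by (rule integral_distr[OF rayleigh_quantile_expo m, symmetric])
qed

definition "dynkin t \<omega> = f (limit_path t \<omega>) - f (limit_path 0 \<omega>) - (LINT s:{0..t}|lborel. limit_generator f f' (limit_path s \<omega>))"

definition "jump_incr \<omega> k = f (jump_value (tame \<omega>) (Suc k)) -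
  f (jump_value (tame \<omega>) k + (jump_time (tame \<omega>) (Suc k) - jump_time (tame \<omega>) k))"

text \<open>Between jumps the path moves at unit speed, so the drift part of the generator integrates to the
  increment of \<open>f\<close> and only the jumps remain.\<close>

lemma dynkin_eq:
  assumes n: "jump_time (tame \<omega>) n \<le> t" "t < jump_time (tame \<omega>) (Suc n)"
  shows "dynkin t \<omega> = (\<Sum>k<n. jump_incr \<omega> k) - (LINT s:{0..t}|lborel. jump_part (limit_path s \<omega>))"
proof -
  let ?T = "jump_time (tame \<omega>)" and ?Y = "jump_value (tame \<omega>)"
  have T: "jump_times ?T" by (rule jump_times_good[OF tame_good])
  have t: "0 \<le> t" using jump_times_nonneg[OF T, of n] n by simp
  have drift: "(LINT s:{0..t}|lborel. f' (limit_path s \<omega>)) =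
      (\<Sum>i<n. f (?Y i + (?T (Suc i) - ?T i)) - f (?Y i)) + (f (?Y n + (t - ?T n)) - f (?Y n))"
  proof -
    have "{0..<t} = {0..<?T n} \<union> {?T n..<t}" using n jump_times_nonneg[OF T, of n] by auto
    then have "(LINT s:{0..t}|lborel. f' (limit_path s \<omega>)) = (LINT s:{0..<?T n} \<union> {?T n..<t}|lborel. f' (limit_path s \<omega>))"
      by (simp add: set_integral_half_open(1)[symmetric])
    also have "\<dots> = (LINT s:{0..<?T n}|lborel. f' (limit_path s \<omega>)) + (LINT s:{?T n..<t}|lborel. f' (limit_path s \<omega>))"
      using limit_path_integral(1)[OF deriv_integrable] limit_path_piece(1)[OF less_imp_le[OF n(2)] deriv_integrable]
      by (intro set_integral_Un) auto
    also have "\<dots> = (\<Sum>i<n. f (?Y i + (?T (Suc i) - ?T i)) - f (?Y i)) + (f (?Y n + (t - ?T n)) - f (?Y n))"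
      unfolding limit_path_integral(2)[OF deriv_integrable] limit_path_piece(2)[OF less_imp_le[OF n(2)] deriv_integrable]
      using jump_times_less[OF T] n by (simp add: deriv_integral less_imp_le)
    finally show ?thesis .
  qed
  have 0: "limit_path 0 \<omega> = ?Y 0"
    using limit_path_eq[of \<omega> 0 0] jump_times_less[OF T, of 0] by (simp add: jump_time_def)
  have "(\<Sum>k<n. jump_incr \<omega> k) = (\<Sum>k<n. (f (?Y (Suc k)) - f (?Y k)) - (f (?Y k + (?T (Suc k) - ?T k)) - f (?Y k)))"
    by (simp add: jump_incr_def)
  also have "\<dots> = f (?Y n) - f (?Y 0) - (\<Sum>i<n. f (?Y i + (?T (Suc i) - ?T i)) - f (?Y i))"
    using sum_lessThan_telescope[of "\<lambda>k. f (?Y k)" n] by (simp only: sum_subtractf)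
  finally have jumps: "(\<Sum>k<n. jump_incr \<omega> k) = f (?Y n) - f (?Y 0) - (\<Sum>i<n. f (?Y i + (?T (Suc i) - ?T i)) - f (?Y i))" .
  have "(LINT s:{0..t}|lborel. limit_generator f f' (limit_path s \<omega>)) =
      (LINT s:{0..t}|lborel. f' (limit_path s \<omega>)) + (LINT s:{0..t}|lborel. jump_part (limit_path s \<omega>))"
    unfolding limit_generator_eq
    by (intro set_integral_add(2) limit_path_integrable[of _ _ t] deriv_integrable jump_part_integrable) auto
  then show ?thesis
    unfolding dynkin_def 0 limit_path_eq[OF n] using drift jumps by simp
qed

text \<open>\<open>ennreal\<close> sends negative reals to 0, so these are the positive and negative
  parts of the increment of \<open>f\<close> at a jump. The compensator formula is available for
  nonnegative functions and is applied to each part.\<close>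

definition "pos_jump y x = ennreal (f x - f y)"
definition "neg_jump y x = ennreal (f y - f x)"

lemma measurable_jumps:
  "(\<lambda>(y, x). pos_jump y x) \<in> borel_measurable (borel \<Otimes>\<^sub>M borel)"
  "(\<lambda>(y, x). neg_jump y x) \<in> borel_measurable (borel \<Otimes>\<^sub>M borel)"
  unfolding pos_jump_def neg_jump_def by measurable

text \<open>Only the jumps leading out of segments \<open>m\<close> up to \<open>n - 1\<close>
  happen after \<open>s\<close> and not after \<open>t\<close>, so the series is a finite
  sum.\<close>

lemma jump_sum_eq:
  assumes s: "0 \<le> s" "s \<le> t"
    and m: "jump_time (tame \<omega>) m \<le> s" "s < jump_time (tame \<omega>) (Suc m)"
    and n: "jump_time (tame \<omega>) n \<le> t" "t < jump_time (tame \<omega>) (Suc n)"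
  shows "jump_sum \<psi> s t \<omega> = (\<Sum>k\<in>{m..<n}. \<psi> (jump_value (tame \<omega>) k + (jump_time (tame \<omega>) (Suc k) - jump_time (tame \<omega>) k)) (jump_value (tame \<omega>) (Suc k)))"
proof -
  have T: "jump_times (jump_time (tame \<omega>))" by (rule jump_times_good[OF tame_good])
  have "jump_time (tame \<omega>) (Suc k) \<in> {s<..t} \<longleftrightarrow> k \<in> {m..<n}" for k
  proof -
    have "s < jump_time (tame \<omega>) (Suc k) \<longleftrightarrow> m \<le> k"
      using m jump_times_mono[OF T, of "Suc m" "Suc k"] jump_times_mono[OF T, of "Suc k" m] by force
    moreover have "jump_time (tame \<omega>) (Suc k) \<le> t \<longleftrightarrow> k < n"
      using n jump_times_mono[OF T, of "Suc n" "Suc k"] jump_times_mono[OF T, of "Suc k" n] by force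
    ultimately show ?thesis by auto
  qed
  then have ind: "indicator {s<..t} (jump_time (tame \<omega>) (Suc k)) = (indicator {m..<n} k :: ennreal)" for k
    by (simp only: indicator_def)
  have "jump_sum \<psi> s t \<omega> = (\<Sum>k\<in>{m..<n}. indicator {m..<n} k * \<psi> (jump_value (tame \<omega>) k + (jump_time (tame \<omega>) (Suc k) - jump_time (tame \<omega>) k)) (jump_value (tame \<omega>) (Suc k)))"
    unfolding jump_sum_def ind by (rule suminf_finite) (auto simp: indicator_def)
  then show ?thesis by (simp add: indicator_def)
qed

lemma jump_sums:
  assumes s: "0 \<le> s" "s \<le> t"
  shows "jump_sum pos_jump s t \<omega> < top" "jump_sum neg_jump s t \<omega> < top"
    and "dynkin t \<omega> - dynkin s \<omega> = enn2real (jump_sum pos_jump s t \<omega>) - enn2real (jump_sum neg_jump s t \<omega>)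
      - (LINT u:{s<..t}|lborel. jump_part (limit_path u \<omega>))"
proof -
  have T: "jump_times (jump_time (tame \<omega>))" by (rule jump_times_good[OF tame_good])
  obtain m where m: "jump_time (tame \<omega>) m \<le> s" "s < jump_time (tame \<omega>) (Suc m)" using jump_interval_cases[OF T s(1)] by blast
  have "0 \<le> t" using s by simp
  obtain n where n: "jump_time (tame \<omega>) n \<le> t" "t < jump_time (tame \<omega>) (Suc n)" using jump_interval_cases[OF T \<open>0 \<le> t\<close>] by blast
  have "\<not> Suc n \<le> m" using jump_times_mono[OF T, of "Suc n" m] m n s by linarith
  then have mn: "m \<le> n" by simp
  have trunc: "ennreal a = ennreal (max a 0)" for a :: real
    by (cases "a \<le> 0") (simp_all add: ennreal_neg max_def)
  have pos: "jump_sum pos_jump s t \<omega> = ennreal (\<Sum>k\<in>{m..<n}. max (jump_incr \<omega> k) 0)"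
    and neg: "jump_sum neg_jump s t \<omega> = ennreal (\<Sum>k\<in>{m..<n}. max (- jump_incr \<omega> k) 0)"
    unfolding jump_sum_eq[OF s m n] pos_jump_def neg_jump_def
    by (subst sum_ennreal[symmetric], simp, subst trunc, simp add: jump_incr_def)+
  show "jump_sum pos_jump s t \<omega> < top" "jump_sum neg_jump s t \<omega> < top"
    unfolding pos neg by simp_all
  have "enn2real (jump_sum pos_jump s t \<omega>) - enn2real (jump_sum neg_jump s t \<omega>) =
      (\<Sum>k\<in>{m..<n}. max (jump_incr \<omega> k) 0 - max (- jump_incr \<omega> k) 0)"
    unfolding pos neg by (simp add: sum_nonneg sum_subtractf)
  also have "\<dots> = (\<Sum>k\<in>{m..<n}. jump_incr \<omega> k)" by (intro sum.cong) auto
  also have "\<dots> = (\<Sum>k<n. jump_incr \<omega> k) - (\<Sum>k<m. jump_incr \<omega> k)"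
    using mn sum_diff[of "{..<n}" "{..<m}" "jump_incr \<omega>"]
    by (metis atLeast0LessThan finite_lessThan ivl_diff le0 lessThan_subset_iff)
  finally have jumps: "enn2real (jump_sum pos_jump s t \<omega>) - enn2real (jump_sum neg_jump s t \<omega>) =
      (\<Sum>k<n. jump_incr \<omega> k) - (\<Sum>k<m. jump_incr \<omega> k)" .
  have "{0..t} = {0..s} \<union> {s<..t}" using s by auto
  moreover have "(LINT u:{0..s} \<union> {s<..t}|lborel. jump_part (limit_path u \<omega>)) =
      (LINT u:{0..s}|lborel. jump_part (limit_path u \<omega>)) + (LINT u:{s<..t}|lborel. jump_part (limit_path u \<omega>))"
    by (intro set_integral_Un limit_path_integrable[of _ _ t] jump_part_integrable) (use s in auto)
  ultimately show "dynkin t \<omega> - dynkin s \<omega> = enn2real (jump_sum pos_jump s t \<omega>) - enn2real (jump_sum neg_jump s t \<omega>)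
      - (LINT u:{s<..t}|lborel. jump_part (limit_path u \<omega>))"
    unfolding jumps dynkin_eq[OF m] dynkin_eq[OF n] by simp
qed

lemma jump_means:
  shows "jump_mean pos_jump y < top" "jump_mean neg_jump y < top"
    and "enn2real (jump_mean pos_jump y) - enn2real (jump_mean neg_jump y) = post_mean - f y"
proof -
  interpret E: prob_space expo by (rule prob_space_expo)
  have i: "integrable expo (\<lambda>e. f (- rayleigh_quantile e) - f y)"
    using integrable_post by simp
  have neg: "- (f (- rayleigh_quantile e) - f y) = f y - f (- rayleigh_quantile e)" for e by simp
  show "jump_mean pos_jump y < top" "jump_mean neg_jump y < top"
    using i unfolding real_integrable_def jump_mean_def pos_jump_def neg_jump_def neg
    by (simp_all add: less_top)
  have "post_mean - f y = (\<integral>e. f (- rayleigh_quantile e) - f y \<partial>expo)"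
    using integrable_post post_mean_expo E.prob_space by simp
  also have "\<dots> = enn2real (jump_mean pos_jump y) - enn2real (jump_mean neg_jump y)"
    unfolding real_lebesgue_integral_def[OF i] jump_mean_def pos_jump_def neg_jump_def neg ..
  finally show "enn2real (jump_mean pos_jump y) - enn2real (jump_mean neg_jump y) = post_mean - f y" ..
qed

text \<open>Continuity bounds \<open>f\<close> on the compact interval, and integrability under the
  Rayleigh law bounds the value after the jump. Nonnegative \<open>y\<close> are enough, as the jump
  rate vanishes below 0, where \<open>f\<close> may be unbounded.\<close>

lemma jump_mean_bounded: "\<exists>K::real. 0 \<le> K \<and> (\<forall>y\<in>{0..b}. jump_mean pos_jump y \<le> ennreal K \<and> jump_mean neg_jump y \<le> ennreal K)"
proof -
  interpret E: prob_space expo by (rule prob_space_expo)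
  have "compact (f ` {0..b})"
    by (intro compact_continuous_image continuous_on_subset[OF continuous]) auto
  then obtain B where B: "\<And>y. y \<in> {0..b} \<Longrightarrow> \<bar>f y\<bar> \<le> B"
    using compact_imp_bounded by (fastforce simp: bounded_iff)
  define L where "L = (\<integral>e. \<bar>f (- rayleigh_quantile e)\<bar> + \<bar>B\<bar> \<partial>expo)"
  have i: "integrable expo (\<lambda>e. \<bar>f (- rayleigh_quantile e)\<bar> + \<bar>B\<bar>)" using integrable_post by simp
  have "jump_mean pos_jump y \<le> ennreal L \<and> jump_mean neg_jump y \<le> ennreal L" if "y \<in> {0..b}" for y
  proof -
    have le: "\<bar>f y\<bar> \<le> \<bar>B\<bar>" using B[OF that] by simp
    have "jump_mean pos_jump y \<le> (\<integral>\<^sup>+e. ennreal (\<bar>f (- rayleigh_quantile e)\<bar> + \<bar>B\<bar>) \<partial>expo)"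
      "jump_mean neg_jump y \<le> (\<integral>\<^sup>+e. ennreal (\<bar>f (- rayleigh_quantile e)\<bar> + \<bar>B\<bar>) \<partial>expo)"
      unfolding jump_mean_def pos_jump_def neg_jump_def
      by (intro nn_integral_mono ennreal_leI; use le in linarith)+
    then show ?thesis using nn_integral_eq_integral[OF i] by (simp add: L_def)
  qed
  moreover have "0 \<le> L" unfolding L_def by (intro integral_nonneg_AE) auto
  ultimately show ?thesis by blast
qed

end

lemma integral_enn2real:
  assumes [measurable]: "Z \<in> borel_measurable M" "A \<in> sets M"
    and fin: "\<And>x. x \<in> A \<Longrightarrow> Z x < top" "(\<integral>\<^sup>+x\<in>A. Z x \<partial>M) < top"
  shows "integrable M (\<lambda>x. indicator A x * enn2real (Z x))"
    and "(\<integral>x. indicator A x * enn2real (Z x) \<partial>M) = enn2real (\<integral>\<^sup>+x\<in>A. Z x \<partial>M)"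
proof -
  have eq: "ennreal (indicator A x * enn2real (Z x)) = Z x * indicator A x" for x
    using fin(1)[of x] by (simp add: indicator_def)
  show "integrable M (\<lambda>x. indicator A x * enn2real (Z x))"
    using fin(2) by (intro integrableI_nonneg) (auto simp: eq)
  show "(\<integral>x. indicator A x * enn2real (Z x) \<partial>M) = enn2real (\<integral>\<^sup>+x\<in>A. Z x \<partial>M)"
    by (subst integral_eq_nn_integral) (auto simp: eq)
qed

context generator_function
begin

text \<open>With the initial value bounded on \<open>A\<close>, the path stays below
  \<open>b\<close> up to time \<open>t\<close>, so rate and jump means are bounded where the rate is
  positive. The compensators thus have finite expectation, the compensator formula passes this on to
  the jump sums, and positive and negative parts cancel separately.\<close>

lemma dynkin_increment:
  assumes A: "A \<in> sets (natural_filtration noise limit_path s)" and A_le: "\<And>\<omega>. \<omega> \<in> A \<Longrightarrow> limit_path 0 \<omega> \<le> m"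
    and s: "0 \<le> s" "s \<le> t"
  shows "integrable noise (\<lambda>\<omega>. indicator A \<omega> * (dynkin t \<omega> - dynkin s \<omega>))"
    and "(\<integral>\<omega>. indicator A \<omega> * (dynkin t \<omega> - dynkin s \<omega>) \<partial>noise) = 0"
proof -
  have A' [measurable]: "A \<in> sets noise"
    using A subalgebra_natural_filtration by (auto simp: subalgebra_def)
  define b where "b = max m 0 + t"
  have b: "0 \<le> b" using s by (simp add: b_def)
  obtain K :: real where K: "0 \<le> K"
    "\<And>y. y \<in> {0..b} \<Longrightarrow> jump_mean pos_jump y \<le> ennreal K \<and> jump_mean neg_jump y \<le> ennreal K"
    using jump_mean_bounded[of b] by blast
  define \<kappa> where "\<kappa> \<psi> y = ennreal (max y 0) * jump_mean \<psi> y" for \<psi> :: "real \<Rightarrow> real \<Rightarrow> ennreal" and y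
  define I where "I \<psi> \<omega> = (\<integral>\<^sup>+u\<in>{s<..t}. \<kappa> \<psi> (limit_path u \<omega>) \<partial>lborel)" for \<psi> \<omega>
  have \<kappa>_meas [measurable]: "\<kappa> pos_jump \<in> borel_measurable borel" "\<kappa> neg_jump \<in> borel_measurable borel"
    unfolding \<kappa>_def[abs_def] using measurable_jumps[THEN measurable_jump_mean] by measurable
  have I_meas [measurable]: "I pos_jump \<in> borel_measurable noise" "I neg_jump \<in> borel_measurable noise"
    unfolding I_def[abs_def]
    by (rule measurable_path_integral[OF \<kappa>_meas(1) s(1)]) (rule measurable_path_integral[OF \<kappa>_meas(2) s(1)])
  have J_meas [measurable]: "jump_sum pos_jump s t \<in> borel_measurable noise" "jump_sum neg_jump s t \<in> borel_measurable noise"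
    using measurable_jumps by (intro measurable_jump_sum; simp)+
  have \<kappa>_le: "\<kappa> pos_jump y \<le> ennreal (b * K)" "\<kappa> neg_jump y \<le> ennreal (b * K)" if "y \<le> b" for y
  proof -
    have "ennreal (max y 0) * c \<le> ennreal b * ennreal K" if "0 \<le> y \<Longrightarrow> c \<le> ennreal K" for c
    proof (cases "0 \<le> y")
      case True
      then show ?thesis using that \<open>y \<le> b\<close> by (intro mult_mono ennreal_leI) auto
    qed (simp add: max_def)
    then show "\<kappa> pos_jump y \<le> ennreal (b * K)" "\<kappa> neg_jump y \<le> ennreal (b * K)"
      using K that b unfolding \<kappa>_def by (auto simp: ennreal_mult)
  qed
  have path_le: "limit_path u \<omega> \<le> b" if "\<omega> \<in> A" "u \<in> {s<..t}" for u \<omega>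
    using limit_path_upper_bound[of u \<omega>] A_le[OF that(1)] that(2) s unfolding b_def by auto
  have I_le: "I pos_jump \<omega> \<le> ennreal (b * K) * ennreal (t - s)" "I neg_jump \<omega> \<le> ennreal (b * K) * ennreal (t - s)" if "\<omega> \<in> A" for \<omega>
  proof -
    have "I \<psi> \<omega> \<le> (\<integral>\<^sup>+u. ennreal (b * K) * indicator {s<..t} u \<partial>lborel)"
      if "\<And>y. y \<le> b \<Longrightarrow> \<kappa> \<psi> y \<le> ennreal (b * K)" for \<psi>
      unfolding I_def using that path_le[OF \<open>\<omega> \<in> A\<close>] by (intro nn_integral_mono) (auto simp: indicator_def)
    moreover have "(\<integral>\<^sup>+u. ennreal (b * K) * indicator {s<..t} u \<partial>lborel) = ennreal (b * K) * ennreal (t - s)"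
      using s by (simp add: nn_integral_cmult_indicator)
    ultimately show "I pos_jump \<omega> \<le> ennreal (b * K) * ennreal (t - s)" "I neg_jump \<omega> \<le> ennreal (b * K) * ennreal (t - s)"
      using \<kappa>_le by simp_all
  qed
  have I_fin: "I pos_jump \<omega> < top" "I neg_jump \<omega> < top" if "\<omega> \<in> A" for \<omega>
    using I_le[OF that] by (auto simp: less_top[symmetric] top_unique ennreal_mult_eq_top_iff)
  have I_int: "(\<integral>\<^sup>+\<omega>\<in>A. I \<psi> \<omega> \<partial>noise) < top" if "\<And>\<omega>. \<omega> \<in> A \<Longrightarrow> I \<psi> \<omega> \<le> ennreal (b * K) * ennreal (t - s)" for \<psi>
  proof -
    have "(\<integral>\<^sup>+\<omega>\<in>A. I \<psi> \<omega> \<partial>noise) \<le> (\<integral>\<^sup>+\<omega>. ennreal (b * K) * ennreal (t - s) \<partial>noise)"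
      using that by (intro nn_integral_mono) (auto simp: indicator_def)
    also have "\<dots> = ennreal (b * K) * ennreal (t - s)"
      using noise.P.emeasure_space_1 by simp
    also have "\<dots> < top" by (simp add: ennreal_mult_less_top)
    finally show ?thesis .
  qed
  have levy: "(\<integral>\<^sup>+\<omega>\<in>A. jump_sum pos_jump s t \<omega> \<partial>noise) = (\<integral>\<^sup>+\<omega>\<in>A. I pos_jump \<omega> \<partial>noise)"
    "(\<integral>\<^sup>+\<omega>\<in>A. jump_sum neg_jump s t \<omega> \<partial>noise) = (\<integral>\<^sup>+\<omega>\<in>A. I neg_jump \<omega> \<partial>noise)"
    unfolding I_def \<kappa>_def using measurable_jumps by (intro levy_system[OF A s(1)]; simp)+
  have compensator: "(LINT u:{s<..t}|lborel. jump_part (limit_path u \<omega>)) = enn2real (I pos_jump \<omega>) - enn2real (I neg_jump \<omega>)"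
    if \<omega>: "\<omega> \<in> A" for \<omega>
  proof -
    \<comment> \<open>Clamping the time to \<open>{0..t}\<close> gives a function that is measurable
      on the whole line and agrees with the path on \<open>{s<..t}\<close>.\<close>
    let ?P = "\<lambda>u. limit_path (min (max u 0) t) \<omega>"
    have "0 \<le> t" using s by simp
    from measurable_compose[OF measurable_Pair1'[of \<omega>] limit_path_progressive[OF this]]
    have [measurable]: "?P \<in> borel_measurable lborel" by simp
    have I': "I \<psi> \<omega> = (\<integral>\<^sup>+u\<in>{s<..t}. \<kappa> \<psi> (?P u) \<partial>lborel)" for \<psi>
      unfolding I_def using s by (intro nn_integral_cong) (auto simp: indicator_def)
    have fin: "\<kappa> pos_jump (?P u) < top" "\<kappa> neg_jump (?P u) < top" for u
      using jump_means(1,2)[of "?P u"] unfolding \<kappa>_def by (simp_all add: ennreal_mult_less_top)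
    have "(\<lambda>u. \<kappa> pos_jump (?P u)) \<in> borel_measurable lborel" "(\<lambda>u. \<kappa> neg_jump (?P u)) \<in> borel_measurable lborel"
      by measurable
    note pos = integral_enn2real[OF this(1) _ fin(1), of "{s<..t}"] and neg = integral_enn2real[OF this(2) _ fin(2), of "{s<..t}"]
    have I_fin': "(\<integral>\<^sup>+u\<in>{s<..t}. \<kappa> pos_jump (?P u) \<partial>lborel) < top" "(\<integral>\<^sup>+u\<in>{s<..t}. \<kappa> neg_jump (?P u) \<partial>lborel) < top"
      using I_fin[OF \<omega>] unfolding I' by simp_all
    have "(LINT u:{s<..t}|lborel. jump_part (limit_path u \<omega>)) =
        (\<integral>u. indicator {s<..t} u * enn2real (\<kappa> pos_jump (?P u)) - indicator {s<..t} u * enn2real (\<kappa> neg_jump (?P u)) \<partial>lborel)"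
      unfolding set_lebesgue_integral_def
    proof (rule Bochner_Integration.integral_cong[OF refl])
      fix u :: real
      have "jump_part y = enn2real (\<kappa> pos_jump y) - enn2real (\<kappa> neg_jump y)" for y
        unfolding jump_part_def \<kappa>_def enn2real_mult jump_means(3)[of y, symmetric]
        by (simp only: enn2real_ennreal max.cobounded2 right_diff_distrib)
      then show "indicator {s<..t} u *\<^sub>R jump_part (limit_path u \<omega>) =
          indicator {s<..t} u * enn2real (\<kappa> pos_jump (?P u)) - indicator {s<..t} u * enn2real (\<kappa> neg_jump (?P u))"
        using s by (simp add: indicator_def)
    qed
    also have "\<dots> = enn2real (I pos_jump \<omega>) - enn2real (I neg_jump \<omega>)"
      unfolding I' using pos neg I_fin' by simp
    finally show ?thesis .
  qed
  let ?X = "\<lambda>Z \<omega>. indicator A \<omega> * enn2real (Z \<omega>)"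
  have eq: "indicator A \<omega> * (dynkin t \<omega> - dynkin s \<omega>) =
      (?X (jump_sum pos_jump s t) \<omega> - ?X (jump_sum neg_jump s t) \<omega>) - (?X (I pos_jump) \<omega> - ?X (I neg_jump) \<omega>)" for \<omega>
    using jump_sums(3)[OF s, of \<omega>] compensator[of \<omega>] by (simp add: indicator_def)
  have X: "integrable noise (?X (I pos_jump))" "integrable noise (?X (I neg_jump))"
      "integrable noise (?X (jump_sum pos_jump s t))" "integrable noise (?X (jump_sum neg_jump s t))"
      "(\<integral>\<omega>. ?X (jump_sum pos_jump s t) \<omega> \<partial>noise) = (\<integral>\<omega>. ?X (I pos_jump) \<omega> \<partial>noise)"
      "(\<integral>\<omega>. ?X (jump_sum neg_jump s t) \<omega> \<partial>noise) = (\<integral>\<omega>. ?X (I neg_jump) \<omega> \<partial>noise)"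
    using integral_enn2real[OF I_meas(1) A' I_fin(1) I_int[OF I_le(1)]]
      integral_enn2real[OF I_meas(2) A' I_fin(2) I_int[OF I_le(2)]]
      integral_enn2real[OF J_meas(1) A' jump_sums(1)[OF s]] integral_enn2real[OF J_meas(2) A' jump_sums(2)[OF s]]
      I_int[OF I_le(1)] I_int[OF I_le(2)]
    unfolding levy by simp_all
  show "integrable noise (\<lambda>\<omega>. indicator A \<omega> * (dynkin t \<omega> - dynkin s \<omega>))"
    unfolding eq by (intro Bochner_Integration.integrable_diff X)
  show "(\<integral>\<omega>. indicator A \<omega> * (dynkin t \<omega> - dynkin s \<omega>) \<partial>noise) = 0"
    unfolding eq using X by simp
qed

section \<open>The localised martingale\<close>

lemma dynkin_0: "dynkin 0 \<omega> = 0"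
  unfolding dynkin_def using set_integral_half_open(1)[of 0 0 "\<lambda>s. limit_generator f f' (limit_path s \<omega>)"]
  by (simp add: set_lebesgue_integral_def)

lemma dynkin_adapted:
  assumes t: "0 \<le> t"
  shows "dynkin t \<in> borel_measurable (natural_filtration noise limit_path t)"
proof -
  let ?F = "natural_filtration noise limit_path t"
  have [measurable]: "limit_path t \<in> borel_measurable ?F" "limit_path 0 \<in> borel_measurable ?F"
    using t by (auto intro!: natural_filtration_adapted)
  have [measurable]: "limit_generator f f' \<in> borel_measurable borel" unfolding limit_generator_eq by measurable
  have "(\<lambda>q. limit_path (min (max (snd q) 0) t) (fst q)) \<in> borel_measurable (?F \<Otimes>\<^sub>M lborel)"
    using limit_path_progressive[OF t] by (simp add: split_beta')
  then have "(\<lambda>q. indicator {0..t} (snd q) *\<^sub>R limit_generator f f' (limit_path (min (max (snd q) 0) t) (fst q))) \<in> borel_measurable (?F \<Otimes>\<^sub>M lborel)"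
    by measurable
  then have "(\<lambda>(\<omega>, u). indicator {0..t} u *\<^sub>R limit_generator f f' (limit_path u \<omega>)) \<in> borel_measurable (?F \<Otimes>\<^sub>M lborel)"
    by (rule measurable_cong[THEN iffD1, rotated]) (auto simp: split_beta' indicator_def)
  from lborel.borel_measurable_lebesgue_integral[OF this]
  have [measurable]: "(\<lambda>\<omega>. LINT s:{0..t}|lborel. limit_generator f f' (limit_path s \<omega>)) \<in> borel_measurable ?F"
    by (simp add: set_lebesgue_integral_def)
  show ?thesis unfolding dynkin_def[abs_def] by measurable
qed

text \<open>The localising time is \<open>n\<close> or 0 according to the initial value, hence known
  at time 0. Stopping amounts to multiplication by an indicator from the initial sigma-algebra, and
  the martingale identity on \<open>A\<close> becomes the increment identity on
  \<open>A \<inter> ?L\<close>.\<close>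

lemma dynkin_stopped_martingale:
  fixes n :: nat
  defines "\<sigma> \<equiv> \<lambda>\<omega>. if limit_path 0 \<omega> \<le> real n then real n else 0"
  shows "is_martingale noise (natural_filtration noise limit_path) (\<lambda>t \<omega>. dynkin (min t (\<sigma> \<omega>)) \<omega>)"
proof -
  let ?F = "natural_filtration noise limit_path" and ?L = "{\<omega>. limit_path 0 \<omega> \<le> real n}"
  have L: "?L \<in> sets (?F t)" if "0 \<le> t" for t
  proof -
    have "limit_path 0 \<in> borel_measurable (?F t)" using that by (intro natural_filtration_adapted) auto
    from measurable_sets[OF this, of "{..real n}"] show ?thesis by (simp add: vimage_def)
  qed
  have eq: "dynkin (min t (\<sigma> \<omega>)) \<omega> = indicator ?L \<omega> * (dynkin (min t (real n)) \<omega> - dynkin 0 \<omega>)" if "0 \<le> t" for t \<omega>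
    using that by (simp add: \<sigma>_def indicator_def dynkin_0 min_def)
  have int: "integrable noise (\<lambda>\<omega>. dynkin (min t (\<sigma> \<omega>)) \<omega>)" if "0 \<le> t" for t
    unfolding eq[OF that] by (rule dynkin_increment(1)[OF L[of 0]]) (use that in auto)
  have adapted: "(\<lambda>\<omega>. dynkin (min t (\<sigma> \<omega>)) \<omega>) \<in> borel_measurable (?F t)" if "0 \<le> t" for t
  proof -
    have sub: "sets (?F (min t (real n))) \<subseteq> sets (?F t)" by (intro natural_filtration_mono) simp
    have "dynkin (min t (real n)) \<in> borel_measurable (?F t)"
      by (rule measurable_mono[OF order_refl refl sub, THEN subsetD]) (use that in \<open>auto intro: dynkin_adapted\<close>)
    then show ?thesis unfolding eq[OF that] dynkin_0 using L[OF that] by measurable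
  qed
  show ?thesis
    unfolding is_martingale_def
  proof (intro conjI allI impI)
    fix t :: real assume "0 \<le> t"
    then show "(\<lambda>\<omega>. dynkin (min t (\<sigma> \<omega>)) \<omega>) \<in> borel_measurable (?F t)" "integrable noise (\<lambda>\<omega>. dynkin (min t (\<sigma> \<omega>)) \<omega>)"
      using adapted int by blast+
  next
    fix s t :: real assume st: "0 \<le> s \<and> s \<le> t"
    then have t: "0 \<le> t" by simp
    interpret S: finite_measure_subalgebra noise "?F s"
      by unfold_locales (rule subalgebra_natural_filtration)
    show "AE \<omega> in noise. real_cond_exp noise (?F s) (\<lambda>\<omega>. dynkin (min t (\<sigma> \<omega>)) \<omega>) \<omega> = dynkin (min s (\<sigma> \<omega>)) \<omega>"
    proof (rule S.real_cond_exp_charact)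
      show "integrable noise (\<lambda>\<omega>. dynkin (min t (\<sigma> \<omega>)) \<omega>)" "integrable noise (\<lambda>\<omega>. dynkin (min s (\<sigma> \<omega>)) \<omega>)"
        "(\<lambda>\<omega>. dynkin (min s (\<sigma> \<omega>)) \<omega>) \<in> borel_measurable (?F s)"
        using st t int adapted by blast+
      fix A assume A: "A \<in> sets (?F s)"
      then have A' [measurable]: "A \<in> sets noise" using subalgebra_natural_filtration by (auto simp: subalgebra_def)
      have i: "integrable noise (\<lambda>\<omega>. indicator A \<omega> * dynkin (min u (\<sigma> \<omega>)) \<omega>)" if "0 \<le> u" for u
        using integrable_mult_indicator[OF A' int[OF that]] by simp
      have "(\<integral>\<omega>. indicator A \<omega> * dynkin (min t (\<sigma> \<omega>)) \<omega> \<partial>noise) - (\<integral>\<omega>. indicator A \<omega> * dynkin (min s (\<sigma> \<omega>)) \<omega> \<partial>noise) =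
          (\<integral>\<omega>. indicator A \<omega> * dynkin (min t (\<sigma> \<omega>)) \<omega> - indicator A \<omega> * dynkin (min s (\<sigma> \<omega>)) \<omega> \<partial>noise)"
        using st t i by simp
      also have "\<dots> = (\<integral>\<omega>. indicator (A \<inter> ?L) \<omega> * (dynkin (min t (real n)) \<omega> - dynkin (min s (real n)) \<omega>) \<partial>noise)"
        using st t by (intro Bochner_Integration.integral_cong refl) (auto simp: eq indicator_def dynkin_0)
      also have "\<dots> = 0"
      proof (cases "s \<le> real n")
        case True
        then have min_s: "min s (real n) = s" by simp
        have "A \<inter> ?L \<in> sets (?F s)" using A L[of s] st by blast
        then show ?thesis
          unfolding min_s by (rule dynkin_increment(2)[where m = "real n"]) (use st True in simp_all)
      next
        \<comment> \<open>Beyond time \<open>n\<close> both stopped times equal \<open>n\<close> and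
          the increment vanishes.\<close>
        case False
        then show ?thesis using st by simp
      qed
      finally show "(LINT \<omega>:A|noise. dynkin (min t (\<sigma> \<omega>)) \<omega>) = (LINT \<omega>:A|noise. dynkin (min s (\<sigma> \<omega>)) \<omega>)"
        by (simp add: set_lebesgue_integral_def)
    qed
  qed
qed

lemma extended_generator_limit_path: "extended_generator noise limit_path f (limit_generator f f')"
proof -
  let ?F = "natural_filtration noise limit_path"
  let ?\<sigma> = "\<lambda>(n::nat) \<omega>. if limit_path 0 \<omega> \<le> real n then real n else 0"
  have "is_local_martingale noise ?F dynkin"
    unfolding is_local_martingale_def
  proof (intro conjI allI impI exI[of _ ?\<sigma>])
    show "dynkin t \<in> borel_measurable (?F t)" if "0 \<le> t" for t by (rule dynkin_adapted[OF that])
    show "stopping_time ?F (?\<sigma> n)" for n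
      unfolding stopping_time_def
    proof
      fix t :: real
      show "Measurable.pred (?F t) (\<lambda>\<omega>. ?\<sigma> n \<omega> \<le> t)"
      proof (cases "0 \<le> t")
        case True
        then have [measurable]: "limit_path 0 \<in> borel_measurable (?F t)" by (intro natural_filtration_adapted) auto
        show ?thesis by measurable
      next
        case False
        \<comment> \<open>The filtration is adapted to the path for nonnegative times only; before 0
          the event is empty because the stopping time is nonnegative.\<close>
        then have "(\<lambda>\<omega>. ?\<sigma> n \<omega> \<le> t) = (\<lambda>_. False)" by (auto simp: fun_eq_iff)
        then show ?thesis by simp
      qed
    qed
    show "\<forall>\<omega>\<in>space noise. 0 \<le> ?\<sigma> n \<omega>" for n by simp
    have "incseq (\<lambda>n. ?\<sigma> n \<omega>)" for \<omega> by (auto simp: incseq_def)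
    moreover have "filterlim (\<lambda>n. ?\<sigma> n \<omega>) at_top sequentially" for \<omega>
    proof -
      obtain N :: nat where N: "limit_path 0 \<omega> \<le> real N" using real_arch_simple by blast
      have "\<forall>\<^sub>F n in sequentially. real n = ?\<sigma> n \<omega>"
        using eventually_ge_at_top[of N] by eventually_elim (use N in auto)
      then show ?thesis
        by (rule filterlim_mono_eventually[OF filterlim_real_sequentially order_refl order_refl])
    qed
    ultimately show "AE \<omega> in noise. incseq (\<lambda>n. ?\<sigma> n \<omega>) \<and> filterlim (\<lambda>n. ?\<sigma> n \<omega>) at_top sequentially" by simp
    show "is_martingale noise ?F (\<lambda>t \<omega>. dynkin (min t (?\<sigma> n \<omega>)) \<omega>)" for n by (rule dynkin_stopped_martingale)
  qed
  moreover have "set_integrable lborel {0..t} (\<lambda>s. limit_generator f f' (limit_path s \<omega>))" for t \<omega>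
    by (rule limit_path_integrable[OF generator_integrable]) auto
  moreover have "limit_generator f f' \<in> borel_measurable borel" unfolding limit_generator_eq by measurable
  ultimately show ?thesis
    unfolding extended_generator_def dynkin_def[abs_def] by simp
qed

end

section \<open>The limit process and the convergence of the paths\<close>

lemma limit_process_limit_path: "limit_process noise limit_path"
  unfolding limit_process_def
  by (intro conjI allI impI pdmp_limit_path generator_function.extended_generator_limit_path generator_function.intro) auto

theorem proposition3p2:
  fixes M :: "nat \<Rightarrow> 'w measure"
    and X V :: "nat \<Rightarrow> real \<Rightarrow> 'w \<Rightarrow> vec"
    and \<nu> :: "nat \<Rightarrow> vec \<Rightarrow> mat measure"
    and R :: "nat \<Rightarrow> real \<Rightarrow> 'w \<Rightarrow> real"
  assumes fecmc: "\<And>d. d \<ge> 2 \<Longrightarrow> fecmc_process d (\<nu> d) (M d) (X d) (V d)"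
    and start: "\<And>d. d \<ge> 2 \<Longrightarrow>
      law_at d (M d) (X d) (V d) 0 = std_gaussian d \<Otimes>\<^sub>M sphere_uniform d"
    and invariant: "\<And>d t. d \<ge> 2 \<Longrightarrow> t \<ge> 0 \<Longrightarrow>
      law_at d (M d) (X d) (V d) t = std_gaussian d \<Otimes>\<^sub>M sphere_uniform d"
    and R_def: "\<And>d t \<omega>. R d t \<omega> = vinner d (X d t \<omega>) (V d t \<omega>)"
  shows "\<exists>(N :: (nat \<Rightarrow> real) measure) RF. limit_process N RF \<and>
    weakly_converges skorokhod M (\<lambda>d. path_of (R d)) N (path_of RF)"
proof (intro exI conjI)
  show "limit_process noise limit_path" by (rule limit_process_limit_path)
  define \<rho> where "\<rho> d \<omega> = vinner d (X d 0 \<omega>) (V d 0 \<omega>)" for d \<omega>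
  define \<alpha> where "\<alpha> d \<omega> = vinner d (X d 0 \<omega>) (X d 0 \<omega>) / real d" for d \<omega>
  have R: "R d = (\<lambda>t \<omega>. vinner d (X d t \<omega>) (V d t \<omega>))" for d using R_def by blast
  \<comment> \<open>All properties are collected in one predicate so that the chains of all
    dimensions can be chosen simultaneously.\<close>
  define P where "P d Z \<longleftrightarrow> markov_chain (M d) chain_space (expo \<Otimes>\<^sub>M expo) (chain_step (radial_scale d) (1 / real d)) Z \<and>
      (\<forall>\<omega>\<in>space (M d). chain_data (\<lambda>n. Z n \<omega>) \<in> jump_data) \<and>
      (\<forall>\<omega>\<in>space (M d). data_path (chain_data (\<lambda>n. Z n \<omega>)) = path_of (R d) \<omega>) \<and>
      (\<forall>\<omega>\<in>space (M d). Z 0 \<omega> = (0, \<rho> d \<omega>, \<alpha> d \<omega>)) \<and>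
      \<rho> d \<in> borel_measurable (M d) \<and> \<alpha> d \<in> borel_measurable (M d) \<and>
      distr (M d) borel (\<rho> d) = std_normal_distribution \<and>
      distr (M d) (vec_space d) (X d 0) = std_gaussian d \<and> X d 0 \<in> M d \<rightarrow>\<^sub>M vec_space d" for d Z
  have "\<exists>Z. P d Z" if d: "2 \<le> d" for d
  proof (rule fecmc_jump_chain[OF fecmc[OF d] d])
    fix Z
    assume Z: "markov_chain (M d) chain_space (expo \<Otimes>\<^sub>M expo) (chain_step (radial_scale d) (1 / real d)) Z"
      and data: "\<And>\<omega>. \<omega> \<in> space (M d) \<Longrightarrow> chain_data (\<lambda>n. Z n \<omega>) \<in> jump_data"
      and path: "\<And>\<omega>. \<omega> \<in> space (M d) \<Longrightarrow>
        data_path (chain_data (\<lambda>n. Z n \<omega>)) = path_of (\<lambda>t \<omega>. vinner d (X d t \<omega>) (V d t \<omega>)) \<omega>"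
      and Z0: "\<And>\<omega>. \<omega> \<in> space (M d) \<Longrightarrow> Z 0 \<omega> = (0, vinner d (X d 0 \<omega>) (V d 0 \<omega>), vinner d (X d 0 \<omega>) (X d 0 \<omega>) / real d)"
      and unit: "\<And>\<omega>. \<omega> \<in> space (M d) \<Longrightarrow> vinner d (V d 0 \<omega>) (V d 0 \<omega>) = 1"
      and XV: "(\<lambda>\<omega>. (X d 0 \<omega>, V d 0 \<omega>)) \<in> M d \<rightarrow>\<^sub>M state_space d"
    have [measurable]: "X d 0 \<in> M d \<rightarrow>\<^sub>M vec_space d" "V d 0 \<in> M d \<rightarrow>\<^sub>M vec_space d"
      using measurable_compose[OF XV measurable_fst] measurable_compose[OF XV measurable_snd] by simp_all
    have "prob_space (M d)" using Z by (simp add: markov_chain_def)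
    from initial_law[OF this XV start[OF d, unfolded law_at_def] unit]
    have "distr (M d) borel (\<rho> d) = std_normal_distribution" "distr (M d) (vec_space d) (X d 0) = std_gaussian d"
      unfolding \<rho>_def[abs_def] by blast+
    moreover have "\<rho> d \<in> borel_measurable (M d)" "\<alpha> d \<in> borel_measurable (M d)"
      unfolding \<rho>_def[abs_def] \<alpha>_def[abs_def] by measurable
    ultimately show ?thesis
      using Z data path Z0 unfolding P_def R \<rho>_def \<alpha>_def by (intro exI[of _ Z]) simp
  qed
  then obtain Z where P: "\<And>d. 2 \<le> d \<Longrightarrow> P d (Z d)" by metis
  have Z: "\<And>d. 2 \<le> d \<Longrightarrow> markov_chain (M d) chain_space (expo \<Otimes>\<^sub>M expo) (chain_step (radial_scale d) (1 / real d)) (Z d)"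
    and data: "\<And>d \<omega>. 2 \<le> d \<Longrightarrow> \<omega> \<in> space (M d) \<Longrightarrow> chain_data (\<lambda>n. Z d n \<omega>) \<in> jump_data"
    and path: "\<And>d \<omega>. 2 \<le> d \<Longrightarrow> \<omega> \<in> space (M d) \<Longrightarrow> data_path (chain_data (\<lambda>n. Z d n \<omega>)) = path_of (R d) \<omega>"
    and Z0: "\<And>d \<omega>. 2 \<le> d \<Longrightarrow> \<omega> \<in> space (M d) \<Longrightarrow> Z d 0 \<omega> = (0, \<rho> d \<omega>, \<alpha> d \<omega>)"
    and \<rho>: "\<And>d. 2 \<le> d \<Longrightarrow> \<rho> d \<in> borel_measurable (M d)" and \<alpha>: "\<And>d. 2 \<le> d \<Longrightarrow> \<alpha> d \<in> borel_measurable (M d)"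
    and normal: "\<And>d. 2 \<le> d \<Longrightarrow> distr (M d) borel (\<rho> d) = std_normal_distribution"
    and gauss: "\<And>d. 2 \<le> d \<Longrightarrow> distr (M d) (vec_space d) (X d 0) = std_gaussian d"
    and X0: "\<And>d. 2 \<le> d \<Longrightarrow> X d 0 \<in> M d \<rightarrow>\<^sub>M vec_space d"
    using P unfolding P_def by simp_all
  have prob: "prob_space (M d)" if "2 \<le> d" for d using Z[OF that] by (simp add: markov_chain_def)
  have conc: "measure (M d) {\<omega> \<in> space (M d). \<delta> \<le> \<bar>\<alpha> d \<omega> - 1\<bar>} \<le> 2 / (\<delta>\<^sup>2 * real d)" if d: "2 \<le> d" and \<delta>: "0 < \<delta>" for d \<delta>
  proof -
    let ?S = "{x \<in> space (vec_space d). \<delta> \<le> \<bar>vinner d x x / real d - 1\<bar>}"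
    have "measure (M d) {\<omega> \<in> space (M d). \<delta> \<le> \<bar>\<alpha> d \<omega> - 1\<bar>} = measure (distr (M d) (vec_space d) (X d 0)) ?S"
      using measurable_space[OF X0[OF d]]
      by (subst measure_distr[OF X0[OF d]]) (auto intro!: arg_cong2[where f = measure] simp: \<alpha>_def)
    then show ?thesis
      unfolding gauss[OF d] using std_gaussian_radius_concentration[of d \<delta>] d \<delta> sets_eq_imp_space_eq[OF sets_std_gaussian[of d]] by simp
  qed
  have measurable_data: "(\<lambda>\<omega>. chain_data (\<lambda>n. W n \<omega>)) \<in> L \<rightarrow>\<^sub>M PiM UNIV (\<lambda>_. borel)"
    if W: "\<And>n. W n \<in> L \<rightarrow>\<^sub>M chain_space" for L :: "'z measure" and W
  proof -
    have "(\<lambda>\<omega> n. W n \<omega>) \<in> L \<rightarrow>\<^sub>M PiM UNIV (\<lambda>_. chain_space)"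
      by (intro measurable_PiM_single') (use W measurable_space[OF W] in auto)
    from measurable_compose[OF this measurable_chain_data] show ?thesis .
  qed
  show "weakly_converges skorokhod M (\<lambda>d. path_of (R d)) noise (path_of limit_path)"
    unfolding weakly_converges_def
  proof (intro conjI allI impI)
    show "\<forall>\<^sub>F d in sequentially. path_of (R d) \<in> M d \<rightarrow>\<^sub>M borel_algebra skorokhod"
      using eventually_ge_at_top[of 2]
    proof eventually_elim
      case (elim d)
      have "Z d n \<in> M d \<rightarrow>\<^sub>M chain_space" for n using Z[OF elim] by (simp add: markov_chain_def)
      then have "(\<lambda>\<omega>. data_path (chain_data (\<lambda>n. Z d n \<omega>))) \<in> M d \<rightarrow>\<^sub>M borel_algebra skorokhod"
        by (intro measurable_data_path measurable_data data[OF elim])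
      then show ?case by (rule measurable_cong[THEN iffD1, rotated]) (rule path[OF elim])
    qed
    let ?C = "\<lambda>\<omega> n. chain rayleigh_quantile 0 (0, \<omega> 0, 1) \<omega> n"
    have C_meas: "(\<lambda>\<omega>. ?C \<omega> n) \<in> noise \<rightarrow>\<^sub>M chain_space" for n by measurable
    have C_data: "chain_data (?C \<omega>) \<in> jump_data" if "\<omega> \<in> good_noise" for \<omega>
      using that rayleigh_quantile_nonneg by (rule chain_data_jump_data)
    have "(\<lambda>\<omega>. data_path (chain_data (?C (tame \<omega>)))) \<in> noise \<rightarrow>\<^sub>M borel_algebra skorokhod"
      by (intro measurable_data_path measurable_compose[OF measurable_tame measurable_data[OF C_meas]] C_data tame_good)
    then show "path_of limit_path \<in> noise \<rightarrow>\<^sub>M borel_algebra skorokhod"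
      unfolding path_of_limit_path[symmetric] .
    fix g assume g: "continuous_map skorokhod euclideanreal g \<and> bounded (g ` topspace skorokhod)"
    then obtain B where B: "\<And>y. y \<in> cadlag_paths \<Longrightarrow> \<bar>g y\<bar> \<le> B" by (auto simp: bounded_iff)
    \<comment> \<open>The absolute value supplies the nonnegative bound that the locale asks
      for.\<close>
    interpret bounded_path_functional g "\<bar>B\<bar>"
      by unfold_locales (use g B in \<open>force intro: order_trans[OF _ abs_ge_self]\<close>)+
    have lim: "(\<lambda>d. \<integral>\<omega>. chain_mean g (radial_scale d) (1 / real d) (0, \<rho> d \<omega>, \<alpha> d \<omega>) \<partial>M d)
        \<longlonglongrightarrow> (\<integral>r. limit_mean r \<partial>std_normal_distribution)"
      by (rule weak_limit[OF prob \<rho> \<alpha> normal conc])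
    have ev: "\<forall>\<^sub>F d in sequentially. (\<integral>\<omega>. chain_mean g (radial_scale d) (1 / real d) (0, \<rho> d \<omega>, \<alpha> d \<omega>) \<partial>M d) =
        (\<integral>\<omega>. g (path_of (R d) \<omega>) \<partial>M d)"
      using eventually_ge_at_top[of 2]
    proof eventually_elim
      case (elim d)
      have "(\<integral>\<omega>. g (path_of (R d) \<omega>) \<partial>M d) = (\<integral>\<omega>. path_functional g (chain_data (\<lambda>n. Z d n \<omega>)) \<partial>M d)"
        using data[OF elim] path[OF elim] by (intro Bochner_Integration.integral_cong refl) (simp add: path_functional_def)
      also have "\<dots> = (\<integral>\<omega>. chain_mean g (radial_scale d) (1 / real d) (Z d 0 \<omega>) \<partial>M d)"
        by (rule integral_markov_chain_functional[OF measurable_radial_scale Z[OF elim]])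
      finally show ?case using Z0[OF elim] by (simp cong: Bochner_Integration.integral_cong)
    qed
    have mean: "(\<integral>r. limit_mean r \<partial>std_normal_distribution) = (\<integral>\<omega>. g (path_of limit_path \<omega>) \<partial>noise)"
    proof -
      have "(\<integral>\<omega>. g (path_of limit_path \<omega>) \<partial>noise) = (\<integral>\<omega>. path_functional g (chain_data (?C (tame \<omega>))) \<partial>noise)"
        using C_data[OF tame_good] unfolding path_of_limit_path by (simp add: path_functional_def)
      also have "\<dots> = (\<integral>\<omega>. path_functional g (chain_data (?C \<omega>)) \<partial>noise)"
      proof (rule integral_cong_AE)
        show "(\<lambda>\<omega>. path_functional g (chain_data (?C \<omega>))) \<in> borel_measurable noise"
          by (rule measurable_functional_data[OF C_meas])
        from measurable_compose[OF measurable_tame this]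
        show "(\<lambda>\<omega>. path_functional g (chain_data (?C (tame \<omega>)))) \<in> borel_measurable noise" .
        show "AE \<omega> in noise. path_functional g (chain_data (?C (tame \<omega>))) = path_functional g (chain_data (?C \<omega>))"
          using AE_tame by eventually_elim simp
      qed
      \<comment> \<open>The limit is treated like the other processes: its chain is driven by the
        noise and started in \<open>(0, \<omega> 0, 1)\<close>, and coordinate 0 is standard normal,
        the common law of all initial values.\<close>
      also have "\<dots> = (\<integral>\<omega>. limit_mean (\<omega> 0) \<partial>noise)"
        using integral_markov_chain_functional[OF measurable_rayleigh_quantile
          markov_chain_noise[OF measurable_rayleigh_quantile, of "\<lambda>x. (0, x, 1)" 0]] by simp
      also have "\<dots> = (\<integral>r. limit_mean r \<partial>distr noise borel (\<lambda>\<omega>. \<omega> 0))"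
        by (rule integral_distr[symmetric]) (auto intro!: measurable_compose[OF _ measurable_chain_mean])
      also have "distr noise borel (\<lambda>\<omega>. \<omega> 0) = std_normal_distribution"
        using noise.PiM_component[of 0] by (simp cong: distr_cong)
      finally show ?thesis ..
    qed
    show "(\<lambda>d. \<integral>\<omega>. g (path_of (R d) \<omega>) \<partial>M d) \<longlonglongrightarrow> (\<integral>\<omega>. g (path_of limit_path \<omega>) \<partial>noise)"
      using Lim_transform_eventually[OF lim ev] unfolding mean .
  qed
qed

end
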